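(* Consider the linear system $x_{t+1}=Ax_t+B_uu_t+B_ww_t$ with per-step cost $x_t^*Qx_t+u_t^*u_t$, where $Q\succ0$, $(A,B_u)$ is stabilizable and $B_w$ has full column rank, and where $G(e^{j\omega})$ has full column rank for all $\omega$. With the notation of the context, the optimal competitive ratio is $$\text{Comp-Ratio}=\inf_{\mathcal K\text{ strictly causal}}\ \sup_{\mathbf w}\frac{\mathrm{cost}(\mathcal K,\mathbf w)}{\mathrm{cost}(\mathcal K_0,\mathbf w)}=1+\lambda_{\max}(Z_1\Pi).$$ Moreover, an optimal competitive-ratio controller (i.e. a strictly causal controller attaining this value) is given by $$u_t=-K_{\text{lqr}}x_t+(I+B_u^*PB_u)^{-1}B_u^*\begin{pmatrix}U&-\Pi\end{pmatrix}\begin{pmatrix}\xi^1_t\\ \xi^2_t\end{pmatrix},$$ $$\begin{pmatrix}\xi^1_{t+1}\\ \xi^2_{t+1}\end{pmatrix}=\begin{pmatrix}A_T&0\\ K_\gamma K_M&F_\gamma\end{pmatrix}\begin{pmatrix}\xi^1_t\\ \xi^2_t\end{pmatrix}+\begin{pmatrix}B_w\\ K_\gamma\end{pmatrix}w_t,$$ where $$K_\gamma=(I-A_KZ_\ast A_K^*\Pi)^{-1}A_KZ_\ast(P-A_K^*U)B_w,\qquad F_\gamma=A_K-K_\gamma R_M^{-1}B_w^*(P-U^*A_K).$$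
   Context: Setting. Time runs over all integers. $x_t\in\mathbb R^n$ is the state, $u_t\in\mathbb R^p$ the control, $w_t\in\mathbb R^m$ the disturbance; $x_{t+1}=Ax_t+B_uu_t+B_ww_t$; ${}^*$ is conjugate transpose; $Q^{1/2}$ is the symmetric square root; $\lambda_{\max}(\cdot)$ is the largest eigenvalue. The disturbance $\mathbf w=\{w_t\}$ is in $\ell_2$ (nonzero when it appears in a ratio). Set $F(z)=Q^{1/2}(zI-A)^{-1}B_u$ and $G(z)=Q^{1/2}(zI-A)^{-1}B_w$, and let $\mathcal F,\mathcal G$ be the associated causal time-invariant doubly infinite block Toeplitz operators, with Markov parameters $Q^{1/2}A^{i-1}B_u$ and $Q^{1/2}A^{i-1}B_w$, $i>0$; thus $\{Q^{1/2}x_t\}=\mathcal F\mathbf u+\mathcal G\mathbf w$. A strictly causal (linear) controller is a linear map $\mathbf u=\mathcal K\mathbf w$ such that $u_t$ depends only on $\{w_i\}_{i<t}$. Its cost is $$\mathrm{cost}(\mathcal K,\mathbf w)=\sum_{t\in\mathbb Z}(x_t^*Qx_t+u_t^*u_t)=\mathbf w^*T_{\mathcal K}^*T_{\mathcal K}\mathbf w,\qquad T_{\mathcal K}=\begin{bmatrix}\mathcal F\mathcal K+\mathcal G\\ \mathcal K\end{bmatrix}.$$ The optimal non-causal (clairvoyant) controller is $\mathcal K_0=-(I+\mathcal F^*\mathcal F)^{-1}\mathcal F^*\mathcal G$, with $T_{\mathcal K_0}^*T_{\mathcal K_0}=\mathcal G^*(I+\mathcal F\mathcal F^* )^{-1}\mathcal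 G$. Riccati equations (stabilizing solutions, i.e. those for which $A_K$, $A_T$, $A_M$ below, respectively, have all eigenvalues in the open unit disc). $P=A^*PA+Q-K_{\text{lqr}}^*(I+B_u^*PB_u)K_{\text{lqr}}$, with $K_{\text{lqr}}=(I+B_u^*PB_u)^{-1}B_u^*PA$ and $A_K=A-B_uK_{\text{lqr}}$. $T=ATA^*+B_uB_u^*-ATQ^{1/2}R_T^{-1}Q^{1/2}TA^*$, with $R_T=I+Q^{1/2}TQ^{1/2}$ and $A_T=A-AT(Q^{-1}+T)^{-1}$. $M=A_T^*MA_T+A_T^*Q^{1/2}R_T^{-1}Q^{1/2}A_T-K_M^*R_MK_M$, with $R_M=B_w^*Q^{1/2}R_T^{-1}Q^{1/2}B_w+B_w^*MB_w$, $K_M=R_M^{-1}(B_w^*MA_T+B_w^*Q^{1/2}R_T^{-1}Q^{1/2}A_T)$ and $A_M=A_T-B_wK_M$. Linear equations. $U$ solves $U=A_K^*UA_M+PB_wK_M$. $\Pi$ solves $\Pi=A_K^*\Pi A_K+(P-A_K^*U)B_wR_M^{-1}B_w^*(P-A_K^*U)^*$. For a scalar $\gamma$, $Z_\gamma$ solves $Z_\gamma=A_KZ_\gamma A_K^*+\gamma^{-2}B_u(I+B_u^*PB_u)^{-1}B_u^*$. $Z_1$ is the solution for $\gamma^2=1$, and $Z_\ast$ is the solution for $\gamma^2=\lambda_{\max}(Z_1\Pi)$.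
   Formalization: The optimal-controller claim is stated only when I − A_K Z_* A_K^* Π is invertible, since K_γ is otherwise undefined (e.g. A=[0 1;0 0], Q=I, B_u=e₂, B_w=e₁); if λ_max(Z_1Π)=0, γ^{-2} is read as 0. The ratio formula has no such condition. *)

theory Defs
  imports "HOL-Analysis.Analysis"
begin

subsection \<open>Matrices\<close>

abbreviation cmat :: "real^'n^'m \<Rightarrow> complex^'n^'m" where
  "cmat \<equiv> map_matrix complex_of_real"

definition schur_stable :: "real^'n^'n \<Rightarrow> bool" where
  "schur_stable A \<longleftrightarrow> (\<forall>l v. v \<noteq> 0 \<and> cmat A *v v = l *s v \<longrightarrow> cmod l < 1)"

definition stabilizable :: "real^'n^'n \<Rightarrow> real^'p^'n \<Rightarrow> bool" where
  "stabilizable A B \<longleftrightarrow> (\<exists>K. schur_stable (A - B ** K))"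

definition pos_def :: "real^'n^'n \<Rightarrow> bool" where
  "pos_def Q \<longleftrightarrow> transpose Q = Q \<and> (\<forall>x. x \<noteq> 0 \<longrightarrow> x \<bullet> (Q *v x) > 0)"

definition msqrt :: "real^'n^'n \<Rightarrow> real^'n^'n" where
  "msqrt Q = (THE S. transpose S = S \<and> (\<forall>x. x \<bullet> (S *v x) \<ge> 0) \<and> S ** S = Q)"

text \<open>Largest real eigenvalue. It is only applied to products of two positive semidefinite
  matrices, whose complex eigenvalues are all real.\<close>

definition lambda_max :: "real^'n^'n \<Rightarrow> real" where
  "lambda_max M = Max {l. \<exists>v. v \<noteq> 0 \<and> M *v v = l *\<^sub>R v}"

definition transfer_function ::
  "real^'n^'n \<Rightarrow> real^'m^'n \<Rightarrow> real^'n^'n \<Rightarrow> complex \<Rightarrow> complex^'m^'n" where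
  "transfer_function A B Q z = cmat (msqrt Q) ** matrix_inv (mat z - cmat A) ** cmat B"

text \<open>The first conjunct says that \<open>G\<close> is defined on the whole unit circle;
  \<open>matrix_inv\<close> is unspecified on singular matrices.\<close>

definition full_rank_on_circle :: "real^'n^'n \<Rightarrow> real^'m^'n \<Rightarrow> real^'n^'n \<Rightarrow> bool" where
  "full_rank_on_circle A Bw Q \<longleftrightarrow>
     (\<forall>\<omega>::real. invertible (mat (cis \<omega>) - cmat A) \<and>
               rank (transfer_function A Bw Q (cis \<omega>)) = CARD('m))"
  for Bw :: "real^'m^'n"

subsection \<open>Doubly infinite signals and operators\<close>

definition ell2 :: "(int \<Rightarrow> 'a::real_inner) set" where
  "ell2 = {x. (\<lambda>t. (norm (x t))\<^sup>2) summable_on UNIV}"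

definition ell2_inner :: "(int \<Rightarrow> 'a::real_inner) \<Rightarrow> (int \<Rightarrow> 'a) \<Rightarrow> real" where
  "ell2_inner x y = (\<Sum>\<^sub>\<infinity>t. x t \<bullet> y t)"

definition ell2_adjoint ::
  "((int \<Rightarrow> 'a::real_inner) \<Rightarrow> (int \<Rightarrow> 'b::real_inner)) \<Rightarrow> (int \<Rightarrow> 'b) \<Rightarrow> (int \<Rightarrow> 'a)" where
  "ell2_adjoint L y = (THE z. z \<in> ell2 \<and> (\<forall>u\<in>ell2. ell2_inner (L u) y = ell2_inner u z))"

text \<open>When \<open>A\<close> has no eigenvalue on the unit circle, the equation
  \<open>x (t + 1) = A x t + v t\<close> has exactly one solution in \<open>ell2\<close> for each \<open>v\<close> in \<open>ell2\<close>. If \<open>A\<close>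
  is stable this solution is the convolution \<open>x t = (\<Sum>i>0. A^(i-1) v (t-i))\<close>, so that
  \<open>toeplitz_op A B Q\<close> is the causal block Toeplitz operator with Markov parameters
  \<open>msqrt Q A^(i-1) B\<close>. If \<open>A\<close> is not stable the convolution diverges for general \<open>v\<close>, and
  \<open>toeplitz_op\<close> is the closure of the causal Toeplitz operator, that is, the operator on
  \<open>ell2\<close> whose symbol is \<open>transfer_function A B Q\<close> on the unit circle.\<close>

definition ell2_response ::
  "real^'n^'n \<Rightarrow> (int \<Rightarrow> real^'n) \<Rightarrow> (int \<Rightarrow> real^'n)" where
  "ell2_response A v = (THE x. x \<in> ell2 \<and> (\<forall>t. x (t + 1) = A *v x t + v t))"

definition toeplitz_op ::
  "real^'n^'n \<Rightarrow> real^'p^'n \<Rightarrow> real^'n^'n \<Rightarrow> (int \<Rightarrow> real^'p) \<Rightarrow> (int \<Rightarrow> real^'n)" where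
  "toeplitz_op A B Q u = (\<lambda>t. msqrt Q *v ell2_response A (\<lambda>s. B *v u s) t)"

subsection \<open>Controllers and cost\<close>

definition cost :: "real^'n^'n \<Rightarrow> (int \<Rightarrow> real^'n) \<Rightarrow> (int \<Rightarrow> real^'p) \<Rightarrow> ennreal" where
  "cost Q x u = (\<Sum>\<^sub>\<infinity>t. ennreal (x t \<bullet> (Q *v x t) + u t \<bullet> u t))"

text \<open>\<open>-(I + F\<^sup>* F)\<^sup>-\<^sup>1 F\<^sup>* G\<close>\<close>

definition noncausal_controller ::
  "real^'n^'n \<Rightarrow> real^'p^'n \<Rightarrow> real^'m^'n \<Rightarrow> real^'n^'n \<Rightarrow>
   (int \<Rightarrow> real^'m) \<Rightarrow> (int \<Rightarrow> real^'p)" where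
  "noncausal_controller A Bu Bw Q w =
     (let F = toeplitz_op A Bu Q; G = toeplitz_op A Bw Q;
          y = ell2_adjoint F (G w)
      in (\<lambda>t. - (THE u. u \<in> ell2 \<and> (\<forall>s. u s + ell2_adjoint F (F u) s = y s)) t))"

definition noncausal_cost ::
  "real^'n^'n \<Rightarrow> real^'p^'n \<Rightarrow> real^'m^'n \<Rightarrow> real^'n^'n \<Rightarrow> (int \<Rightarrow> real^'m) \<Rightarrow> ennreal" where
  "noncausal_cost A Bu Bw Q w =
     (let u = noncausal_controller A Bu Bw Q w
      in cost Q (ell2_response A (\<lambda>t. Bu *v u t + Bw *v w t)) u)"

definition strictly_causal ::
  "((int \<Rightarrow> 'a::real_inner) \<Rightarrow> (int \<Rightarrow> 'b::real_inner)) \<Rightarrow> bool" where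
  "strictly_causal K \<longleftrightarrow>
     (\<forall>v\<in>ell2. \<forall>w\<in>ell2. \<forall>a b t.
        K (\<lambda>s. a *\<^sub>R v s + b *\<^sub>R w s) t = a *\<^sub>R K v t + b *\<^sub>R K w t) \<and>
     (\<forall>v\<in>ell2. \<forall>w\<in>ell2. \<forall>t. (\<forall>i<t. v i = w i) \<longrightarrow> K v t = K w t)"

text \<open>The state of the causal system under the control \<open>K w\<close>, as a map of the disturbance.
  Strict causality says that the system is at rest before the disturbance starts. It
  determines \<open>X w\<close> for every \<open>w\<close> that vanishes before some time, with impulse responses the
  blocks of the lower triangular operator that, multiplied by \<open>msqrt Q\<close>, is \<open>F K + G\<close>.
  If \<open>A\<close> is not stable, a solution that is merely in \<open>ell2\<close> would not do, since it can depend
  on future disturbances.\<close>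

definition state_response ::
  "real^'n^'n \<Rightarrow> real^'p^'n \<Rightarrow> real^'m^'n \<Rightarrow>
   ((int \<Rightarrow> real^'m) \<Rightarrow> (int \<Rightarrow> real^'p)) \<Rightarrow> ((int \<Rightarrow> real^'m) \<Rightarrow> (int \<Rightarrow> real^'n)) \<Rightarrow> bool" where
  "state_response A Bu Bw K X \<longleftrightarrow> strictly_causal X \<and>
     (\<forall>w\<in>ell2. \<forall>t. X w (t + 1) = A *v X w t + Bu *v K w t + Bw *v w t)"

definition worst_case_ratio ::
  "real^'n^'n \<Rightarrow> real^'p^'n \<Rightarrow> real^'m^'n \<Rightarrow> real^'n^'n \<Rightarrow>
   ((int \<Rightarrow> real^'m) \<Rightarrow> (int \<Rightarrow> real^'p)) \<Rightarrow> ((int \<Rightarrow> real^'m) \<Rightarrow> (int \<Rightarrow> real^'n)) \<Rightarrow> ennreal" where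
  "worst_case_ratio A Bu Bw Q K X =
     (SUP w\<in>ell2 - {\<lambda>_. 0}. cost Q (X w) (K w) / noncausal_cost A Bu Bw Q w)"

text \<open>The inner infimum only serves to pick the state response of \<open>K\<close>. A state response with
  finite ratio is bounded and hence determined by its values on disturbances with a starting
  time. If none exists, the infimum is \<open>\<infinity>\<close>.\<close>

definition competitive_ratio ::
  "real^'n^'n \<Rightarrow> real^'p^'n \<Rightarrow> real^'m^'n \<Rightarrow> real^'n^'n \<Rightarrow> ennreal" where
  "competitive_ratio A Bu Bw Q =
     (INF K\<in>{K. strictly_causal K}. INF X\<in>{X. state_response A Bu Bw K X}.
        worst_case_ratio A Bu Bw Q K X)"

subsection \<open>Riccati and linear equations\<close>

text \<open>Solutions of the Riccati equations are symmetric, and the matrices inverted in the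
  equations are required to be invertible.\<close>

definition R_lqr :: "real^'p^'n \<Rightarrow> real^'n^'n \<Rightarrow> real^'p^'p" where
  "R_lqr Bu P = mat 1 + transpose Bu ** P ** Bu"

definition K_lqr :: "real^'n^'n \<Rightarrow> real^'p^'n \<Rightarrow> real^'n^'n \<Rightarrow> real^'n^'p" where
  "K_lqr A Bu P = matrix_inv (R_lqr Bu P) ** transpose Bu ** P ** A"

definition A_K :: "real^'n^'n \<Rightarrow> real^'p^'n \<Rightarrow> real^'n^'n \<Rightarrow> real^'n^'n" where
  "A_K A Bu P = A - Bu ** K_lqr A Bu P"

definition stabilizing_P ::
  "real^'n^'n \<Rightarrow> real^'p^'n \<Rightarrow> real^'n^'n \<Rightarrow> real^'n^'n \<Rightarrow> bool" where
  "stabilizing_P A Bu Q P \<longleftrightarrow>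
     transpose P = P \<and> invertible (R_lqr Bu P) \<and>
     P = transpose A ** P ** A + Q - transpose (K_lqr A Bu P) ** R_lqr Bu P ** K_lqr A Bu P \<and>
     schur_stable (A_K A Bu P)"

definition R_T :: "real^'n^'n \<Rightarrow> real^'n^'n \<Rightarrow> real^'n^'n" where
  "R_T Q T = mat 1 + msqrt Q ** T ** msqrt Q"

definition A_T :: "real^'n^'n \<Rightarrow> real^'n^'n \<Rightarrow> real^'n^'n \<Rightarrow> real^'n^'n" where
  "A_T A Q T = A - A ** T ** matrix_inv (matrix_inv Q + T)"

definition stabilizing_T ::
  "real^'n^'n \<Rightarrow> real^'p^'n \<Rightarrow> real^'n^'n \<Rightarrow> real^'n^'n \<Rightarrow> bool" where
  "stabilizing_T A Bu Q T \<longleftrightarrow>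
     transpose T = T \<and> invertible (R_T Q T) \<and> invertible (matrix_inv Q + T) \<and>
     T = A ** T ** transpose A + Bu ** transpose Bu
         - A ** T ** msqrt Q ** matrix_inv (R_T Q T) ** msqrt Q ** T ** transpose A \<and>
     schur_stable (A_T A Q T)"

definition R_M ::
  "real^'m^'n \<Rightarrow> real^'n^'n \<Rightarrow> real^'n^'n \<Rightarrow> real^'n^'n \<Rightarrow> real^'m^'m" where
  "R_M Bw Q T M =
     transpose Bw ** msqrt Q ** matrix_inv (R_T Q T) ** msqrt Q ** Bw + transpose Bw ** M ** Bw"

definition K_M ::
  "real^'n^'n \<Rightarrow> real^'m^'n \<Rightarrow> real^'n^'n \<Rightarrow> real^'n^'n \<Rightarrow> real^'n^'n \<Rightarrow> real^'n^'m" where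
  "K_M A Bw Q T M = matrix_inv (R_M Bw Q T M) **
     (transpose Bw ** M ** A_T A Q T +
      transpose Bw ** msqrt Q ** matrix_inv (R_T Q T) ** msqrt Q ** A_T A Q T)"

definition A_M ::
  "real^'n^'n \<Rightarrow> real^'m^'n \<Rightarrow> real^'n^'n \<Rightarrow> real^'n^'n \<Rightarrow> real^'n^'n \<Rightarrow> real^'n^'n" where
  "A_M A Bw Q T M = A_T A Q T - Bw ** K_M A Bw Q T M"

definition stabilizing_M ::
  "real^'n^'n \<Rightarrow> real^'m^'n \<Rightarrow> real^'n^'n \<Rightarrow> real^'n^'n \<Rightarrow> real^'n^'n \<Rightarrow> bool" where
  "stabilizing_M A Bw Q T M \<longleftrightarrow>
     transpose M = M \<and> invertible (R_M Bw Q T M) \<and>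
     M = transpose (A_T A Q T) ** M ** A_T A Q T
         + transpose (A_T A Q T) ** msqrt Q ** matrix_inv (R_T Q T) ** msqrt Q ** A_T A Q T
         - transpose (K_M A Bw Q T M) ** R_M Bw Q T M ** K_M A Bw Q T M \<and>
     schur_stable (A_M A Bw Q T M)"

definition solves_U ::
  "real^'n^'n \<Rightarrow> real^'p^'n \<Rightarrow> real^'m^'n \<Rightarrow> real^'n^'n \<Rightarrow> real^'n^'n \<Rightarrow> real^'n^'n \<Rightarrow>
   real^'n^'n \<Rightarrow> real^'n^'n \<Rightarrow> bool" where
  "solves_U A Bu Bw Q P T M U \<longleftrightarrow>
     U = transpose (A_K A Bu P) ** U ** A_M A Bw Q T M + P ** Bw ** K_M A Bw Q T M"

definition solves_Pi ::
  "real^'n^'n \<Rightarrow> real^'p^'n \<Rightarrow> real^'m^'n \<Rightarrow> real^'n^'n \<Rightarrow> real^'n^'n \<Rightarrow> real^'n^'n \<Rightarrow>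
   real^'n^'n \<Rightarrow> real^'n^'n \<Rightarrow> real^'n^'n \<Rightarrow> bool" where
  "solves_Pi A Bu Bw Q P T M U Pi0 \<longleftrightarrow>
     Pi0 = transpose (A_K A Bu P) ** Pi0 ** A_K A Bu P
         + (P - transpose (A_K A Bu P) ** U) ** Bw ** matrix_inv (R_M Bw Q T M) **
           transpose Bw ** transpose (P - transpose (A_K A Bu P) ** U)"

text \<open>The parameter \<open>g\<close> is the square of \<open>\<gamma>\<close>. At \<open>g = 0\<close> the convention \<open>1 / 0 = 0\<close> makes
  \<open>Z = 0\<close> the solution.\<close>

definition solves_Z ::
  "real^'n^'n \<Rightarrow> real^'p^'n \<Rightarrow> real^'n^'n \<Rightarrow> real \<Rightarrow> real^'n^'n \<Rightarrow> bool" where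
  "solves_Z A Bu P g Z \<longleftrightarrow>
     Z = A_K A Bu P ** Z ** transpose (A_K A Bu P)
         + (1 / g) *\<^sub>R (Bu ** matrix_inv (R_lqr Bu P) ** transpose Bu)"

subsection \<open>The state-space controller\<close>

definition K_gamma ::
  "real^'n^'n \<Rightarrow> real^'p^'n \<Rightarrow> real^'m^'n \<Rightarrow> real^'n^'n \<Rightarrow> real^'n^'n \<Rightarrow> real^'n^'n \<Rightarrow>
   real^'n^'n \<Rightarrow> real^'m^'n" where
  "K_gamma A Bu Bw P U Pi0 Z =
     matrix_inv (mat 1 - A_K A Bu P ** Z ** transpose (A_K A Bu P) ** Pi0) **
     A_K A Bu P ** Z ** (P - transpose (A_K A Bu P) ** U) ** Bw"

definition F_gamma ::
  "real^'n^'n \<Rightarrow> real^'p^'n \<Rightarrow> real^'m^'n \<Rightarrow> real^'n^'n \<Rightarrow> real^'n^'n \<Rightarrow> real^'n^'n \<Rightarrow>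
   real^'n^'n \<Rightarrow> real^'n^'n \<Rightarrow> real^'n^'n \<Rightarrow> real^'n^'n \<Rightarrow> real^'n^'n" where
  "F_gamma A Bu Bw Q P T M U Pi0 Z =
     A_K A Bu P - K_gamma A Bu Bw P U Pi0 Z ** matrix_inv (R_M Bw Q T M) ** transpose Bw **
       (P - transpose U ** A_K A Bu P)"

text \<open>The signals \<open>K w\<close> and \<open>X w\<close> are those produced by the controller. Membership in \<open>ell2\<close>
  replaces an initial condition, as time is doubly infinite.\<close>

definition generated_by_controller ::
  "real^'n^'n \<Rightarrow> real^'p^'n \<Rightarrow> real^'m^'n \<Rightarrow> real^'n^'n \<Rightarrow> real^'n^'n \<Rightarrow> real^'n^'n \<Rightarrow>
   real^'n^'n \<Rightarrow> real^'n^'n \<Rightarrow> real^'n^'n \<Rightarrow> real^'n^'n \<Rightarrow>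
   ((int \<Rightarrow> real^'m) \<Rightarrow> (int \<Rightarrow> real^'p)) \<Rightarrow> ((int \<Rightarrow> real^'m) \<Rightarrow> (int \<Rightarrow> real^'n)) \<Rightarrow> bool" where
  "generated_by_controller A Bu Bw Q P T M U Pi0 Z K X \<longleftrightarrow>
     (\<forall>w\<in>ell2. X w \<in> ell2 \<and>
        (\<exists>\<xi>1\<in>ell2. \<exists>\<xi>2\<in>ell2. \<forall>t.
           K w t = - (K_lqr A Bu P *v X w t) +
             (matrix_inv (R_lqr Bu P) ** transpose Bu) *v (U *v \<xi>1 t - Pi0 *v \<xi>2 t) \<and>
           \<xi>1 (t + 1) = A_T A Q T *v \<xi>1 t + Bw *v w t \<and>
           \<xi>2 (t + 1) = (K_gamma A Bu Bw P U Pi0 Z ** K_M A Bw Q T M) *v \<xi>1 t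
             + F_gamma A Bu Bw Q P T M U Pi0 Z *v \<xi>2 t + K_gamma A Bu Bw P U Pi0 Z *v w t))"

end

theory Submission
  imports Defs "HOL-Computational_Algebra.Fundamental_Theorem_Algebra"
begin

text \<open>The proof stays in the time domain: operator factorizations become identities between square
summable sequences, and spectral factors become stabilizing solutions of Riccati equations.

\<^emph>\<open>Reduction to an approximation problem.\<close> For a disturbance \<open>w\<close> let \<open>(x\<^sub>o, u\<^sub>o)\<close> be the clairvoyant
optimum with costate \<open>k\<close>. The signal \<open>\<xi> = x\<^sub>o + T k\<close> is a causal function of \<open>w\<close>
(lemma \<open>innovation_state_step\<close>), and with the innovation \<open>e = w + K\<^sub>M \<xi>\<close> the clairvoyant cost
is \<open>\<Sum> e \<bullet> R\<^sub>M e\<close>. Completing squares with \<open>P\<close>, the cost of any other square summable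
trajectory exceeds this by \<open>\<Sum> r \<bullet> R r\<close>, where \<open>r\<close> is the deviation of \<open>u + K\<^sub>l\<^sub>q\<^sub>r x\<close> from its
clairvoyant value \<open>R\<^sup>-\<^sup>1 B\<^sub>u\<^sup>* (U \<xi> - s)\<close> (lemma \<open>cost_decomposition\<close>). Here \<open>U \<xi>\<close> is causal, and
\<open>s t = A\<^sub>K\<^sup>* s (t + 1) + N (e t)\<close> with \<open>N = (P - A\<^sub>K\<^sup>* U) B\<^sub>w\<close> is anticausal. A controller has
ratio at most \<open>1 + g\<close> exactly if it approximates the anticausal signal \<open>B\<^sub>u\<^sup>* s\<close> strictly causally
with squared error, in the norm of \<open>R\<^sup>-\<^sup>1\<close>, at most \<open>g \<Sum> e \<bullet> R\<^sub>M e\<close>. This is a Nehari problem.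

\<^emph>\<open>Lower bound.\<close> If \<open>e\<close> vanishes before time 0, then a strictly causal controller does nothing up
to time 0, so the whole of \<open>s\<close> on the times \<open>t \<le> 0\<close> remains as error. The map from the future of
\<open>e\<close> to the past of \<open>s\<close> is a Hankel operator with Gramians \<open>\<Pi>\<close> and \<open>Z\<^sub>1\<close>; the eigenvector of
\<open>Z\<^sub>1 \<Pi>\<close> for the largest eigenvalue \<open>\<lambda>\<close> yields an \<open>e\<close> for which the error is \<open>\<lambda>\<close> times the energy
(lemma \<open>hankel_norm_attained\<close>).

\<^emph>\<open>Upper bound.\<close> At a level \<open>g \<ge> \<lambda>\<close> the second state \<open>\<zeta>\<close> of the given controller satisfies a
dissipation identity for a quadratic storage function of \<open>(s - \<Pi> \<zeta>, \<zeta>)\<close>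
(lemma \<open>dissipation\<close>). Its supply rate is \<open>e \<bullet> R\<^sub>M e\<close> minus a quadratic form that is nonnegative
because \<open>Z \<Pi> Z \<le> Z\<close> for \<open>Z = Z\<^sub>1 / g\<close>. Summation over time gives the bound. The same identity
with \<open>e = 0\<close> and \<open>s = 0\<close> is a Lyapunov inequality, and an unstable mode of the controller would be
a kernel vector of \<open>I - A\<^sub>K Z A\<^sub>K\<^sup>* \<Pi>\<close> (lemma \<open>central_controller_stable\<close>). For \<open>g > \<lambda>\<close> this
matrix is always invertible, so the infimum is \<open>1 + \<lambda>\<close>. At \<open>g = \<lambda>\<close> invertibility is the
hypothesis of the second part. If \<open>\<lambda> = 0\<close>, the gain \<open>K\<^sub>\<gamma>\<close> vanishes at every level, and the single
resulting controller satisfies all bounds \<open>1 + g\<close> with \<open>g > 0\<close>.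

The analytic basis is that \<open>x (t + 1) = A (x t) + v t\<close> has a unique square summable solution if
\<open>A\<close> has no eigenvalue of modulus one, and that this solution is causal in \<open>v\<close> if \<open>A\<close> is stable.
A polynomial that annihilates \<open>A\<close> reduces this to scalar recursions.\<close>

section \<open>Symmetric matrices and their square roots\<close>

text \<open>The default rule turns \<open>transpose M *v x\<close> into a product with the vector on the left, which would
hide the adjoints that the energy identities move across inner products.\<close>

declare transpose_matrix_vector [simp del]

lemma inner_matrix_left: "(M *v x) \<bullet> y = x \<bullet> (transpose M *v y)"
  for M :: "real^'n^'m"
  by (metis dot_lmul_matrix inner_commute transpose_matrix_vector transpose_transpose)

lemma mat_matrix_vector: "mat c *v x = c *\<^sub>R x"
  for c :: real
proof -
  have "mat c = c *\<^sub>R (mat 1 :: real^'a^'a)"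
    by (simp add: mat_def vec_eq_iff)
  then show ?thesis by (simp add: scaleR_matrix_vector_assoc[symmetric])
qed

lemma matrix_eqI: "(\<And>x. M *v x = N *v x) \<Longrightarrow> M = N"
  for M N :: "real^'n^'m"
  by (simp add: matrix_eq)

lemma transpose_eqI:
  fixes M :: "real^'n^'m"
  assumes "\<And>x y. (M *v x) \<bullet> y = x \<bullet> (N *v y)"
  shows "transpose M = N"
proof (rule matrix_eqI)
  fix y
  have "x \<bullet> (transpose M *v y) = x \<bullet> (N *v y)" for x
    using assms[of x y] by (simp add: inner_matrix_left)
  then show "transpose M *v y = N *v y"
    by (metis vector_eq_ldot)
qed

lemma transpose_add: "transpose (M + N) = transpose M + transpose N"
  by (simp add: transpose_def vec_eq_iff)

lemma transpose_diff: "transpose (M - N) = transpose M - transpose N"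
  by (simp add: transpose_def vec_eq_iff)

definition pos_semidef :: "real^'n^'n \<Rightarrow> bool" where
  "pos_semidef M \<longleftrightarrow> transpose M = M \<and> (\<forall>x. 0 \<le> x \<bullet> (M *v x))"

lemma pos_semidefD:
  assumes "pos_semidef M"
  shows "transpose M = M" "0 \<le> x \<bullet> (M *v x)"
  using assms by (auto simp: pos_semidef_def)

lemma pos_def_imp_pos_semidef: "pos_def M \<Longrightarrow> pos_semidef M"
  unfolding pos_def_def pos_semidef_def
  by (metis inner_zero_left less_eq_real_def)

lemma symmetric_inner: "transpose M = M \<Longrightarrow> (M *v x) \<bullet> y = x \<bullet> (M *v y)"
  for M :: "real^'n^'n"
  by (simp add: inner_matrix_left)

text \<open>The variational principle behind the kernel of semidefinite forms: a quadratic polynomial without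
constant term that is nonnegative on the whole line has its minimum at 0.\<close>

lemma quadratic_nonneg_imp_linear_zero:
  fixes c d :: real
  assumes "\<And>t. 0 \<le> 2 * t * c + t\<^sup>2 * d"
  shows "c = 0"
proof (rule ccontr)
  assume "c \<noteq> 0"
  define e where "e = 1 + \<bar>d\<bar>"
  have e: "e > 0" "d < e" by (auto simp: e_def)
  have "0 \<le> (2 * (- c / e) * c + (- c / e)\<^sup>2 * d) * e\<^sup>2"
    using assms[of "- c / e"] by simp
  also have "\<dots> = c\<^sup>2 * (d - 2 * e)"
    using e by (simp add: power2_eq_square field_simps)
  also have "\<dots> < 0"
    using e \<open>c \<noteq> 0\<close> by (simp add: mult_pos_neg)
  finally show False by simp
qed

lemma semidefinite_on_subspace_kernel:
  fixes M :: "real^'n^'n"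
  assumes "transpose M = M" "subspace V" "\<And>x. x \<in> V \<Longrightarrow> 0 \<le> x \<bullet> (M *v x)"
    and "b \<in> V" "b \<bullet> (M *v b) = 0" "y \<in> V"
  shows "y \<bullet> (M *v b) = 0"
proof (rule quadratic_nonneg_imp_linear_zero)
  fix t :: real
  have "b + t *\<^sub>R y \<in> V"
    using assms by (simp add: subspace_add subspace_scale)
  then have "0 \<le> (b + t *\<^sub>R y) \<bullet> (M *v (b + t *\<^sub>R y))" by (rule assms(3))
  moreover have "b \<bullet> (M *v y) = y \<bullet> (M *v b)"
    using symmetric_inner[OF assms(1), of b y] by (simp add: inner_commute)
  ultimately show "0 \<le> 2 * t * (y \<bullet> (M *v b)) + t\<^sup>2 * (y \<bullet> (M *v y))"
    using assms(5)
    by (simp add: matrix_vector_right_distrib matrix_vector_mult_scaleR inner_add_left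
        inner_add_right power2_eq_square algebra_simps)
qed

lemma pos_semidef_kernel:
  assumes "pos_semidef M" "b \<bullet> (M *v b) = 0"
  shows "M *v b = 0"
  using semidefinite_on_subspace_kernel[of M UNIV b "M *v b"] assms
  by (simp add: pos_semidef_def)

text \<open>A maximizer \<open>b\<close> of the Rayleigh quotient on an invariant subspace exists by compactness. Its
maximal value \<open>l\<close> makes \<open>l - M\<close> positive semidefinite there with \<open>b\<close> as a null direction, so \<open>b\<close> is
in the kernel.\<close>

lemma rayleigh_maximum:
  fixes M :: "real^'n^'n"
  assumes sym: "transpose M = M" and V: "subspace V" "\<And>x. x \<in> V \<Longrightarrow> M *v x \<in> V"
    and "V \<noteq> {0}"
  obtains b l where "b \<in> V" "norm b = 1" "M *v b = l *\<^sub>R b"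
    "\<And>x. x \<in> V \<Longrightarrow> x \<bullet> (M *v x) \<le> l * (x \<bullet> x)"
proof -
  obtain z where z: "z \<in> V" "z \<noteq> 0"
    using \<open>V \<noteq> {0}\<close> subspace_0[OF V(1)] by blast
  let ?S = "V \<inter> sphere 0 1"
  have "z /\<^sub>R norm z \<in> ?S"
    using z V(1) by (simp add: subspace_scale)
  moreover have "compact ?S"
    using closed_subspace[OF V(1)] by (simp add: closed_Int_compact)
  moreover have "continuous_on ?S (\<lambda>x. x \<bullet> (M *v x))"
    by (intro continuous_intros matrix_vector_mult_linear_continuous_on)
  ultimately obtain b where b: "b \<in> ?S" and
    max: "\<And>x. x \<in> ?S \<Longrightarrow> x \<bullet> (M *v x) \<le> b \<bullet> (M *v b)"
    using continuous_attains_sup[of ?S "\<lambda>x. x \<bullet> (M *v x)"] by blast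
  define l where "l = b \<bullet> (M *v b)"
  have bound: "x \<bullet> (M *v x) \<le> l * (x \<bullet> x)" if "x \<in> V" for x
  proof (cases "x = 0")
    case False
    then have "x /\<^sub>R norm x \<in> ?S" using that V(1) by (simp add: subspace_scale)
    then have "(x /\<^sub>R norm x) \<bullet> (M *v (x /\<^sub>R norm x)) \<le> l"
      unfolding l_def by (rule max)
    then have "(x \<bullet> (M *v x)) / (norm x)\<^sup>2 \<le> l"
      by (simp add: matrix_vector_mult_scaleR power2_eq_square divide_inverse mult_ac)
    then show ?thesis
      using False by (simp add: pos_divide_le_eq dot_square_norm)
  qed simp
  let ?D = "mat l - M"
  have D: "?D *v x = l *\<^sub>R x - M *v x" for x
    by (simp add: matrix_vector_mult_diff_rdistrib mat_matrix_vector)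
  have nb: "norm b = 1" "b \<in> V" using b by auto
  have "transpose ?D = ?D"
    by (rule transpose_eqI) (simp add: D inner_diff_left inner_diff_right symmetric_inner[OF sym])
  moreover have "b \<bullet> (?D *v b) = 0"
    using nb by (simp add: D inner_diff_right dot_square_norm) (simp add: l_def)
  moreover have "?D *v b \<in> V"
    using V nb by (simp add: D subspace_diff subspace_scale)
  moreover have "0 \<le> x \<bullet> (?D *v x)" if "x \<in> V" for x
    using bound[OF that] by (simp add: D inner_diff_right)
  ultimately have "(?D *v b) \<bullet> (?D *v b) = 0"
    using semidefinite_on_subspace_kernel[of ?D V b "?D *v b"] V nb by blast
  then have "M *v b = l *\<^sub>R b" by (simp add: D)
  with nb bound that show thesis by blast
qed

text \<open>The spectral theorem, by induction on the dimension: the orthogonal complement of an eigenvector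
within an invariant subspace is again invariant.\<close>

lemma symmetric_invariant_subspace_eigenbasis:
  fixes M :: "real^'n^'n"
  assumes sym: "transpose M = M"
  shows "subspace V \<Longrightarrow> (\<And>x. x \<in> V \<Longrightarrow> M *v x \<in> V) \<Longrightarrow>
    \<exists>B\<subseteq>V. pairwise orthogonal B \<and> (\<forall>b\<in>B. norm b = 1 \<and> (\<exists>l. M *v b = l *\<^sub>R b)) \<and> span B = V"
proof (induction "dim V" arbitrary: V rule: less_induct)
  case less
  note V = less.prems
  show ?case
  proof (cases "V = {0}")
    case True
    then show ?thesis by (intro exI[of _ "{}"]) auto
  next
    case False
    then obtain b l where b: "b \<in> V" "norm b = 1" "M *v b = l *\<^sub>R b"
      using rayleigh_maximum[OF sym V] by metis
    define V' where "V' = {x \<in> V. x \<bullet> b = 0}"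
    have V': "subspace V'"
      using V(1) unfolding V'_def subspace_def by (simp add: inner_add_left)
    have inv: "M *v x \<in> V'" if "x \<in> V'" for x
      using that V(2) b by (simp add: V'_def symmetric_inner[OF sym])
    have "b \<notin> V'" using b by (auto simp: V'_def)
    then have "V' \<subset> V" using b unfolding V'_def by blast
    then have "dim V' < dim V"
      using V' V(1) by (intro dim_psubset) (simp add: span_eq_iff[symmetric] del: span_eq_iff)
    from less.hyps[OF this V' inv] obtain B where B: "B \<subseteq> V'" "pairwise orthogonal B"
      "\<forall>b\<in>B. norm b = 1 \<and> (\<exists>l. M *v b = l *\<^sub>R b)" "span B = V'"
      by auto
    have "pairwise orthogonal (insert b B)"
      using B(1,2) by (auto simp: pairwise_insert orthogonal_def V'_def inner_commute)
    moreover have "span (insert b B) = V"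
    proof
      show "span (insert b B) \<subseteq> V"
        by (rule span_minimal) (use B(1) b V in \<open>auto simp: V'_def\<close>)
      show "V \<subseteq> span (insert b B)"
      proof
        fix x assume "x \<in> V"
        have "x - (x \<bullet> b) *\<^sub>R b \<in> V'"
          using \<open>x \<in> V\<close> b V(1)
          by (simp add: V'_def subspace_diff subspace_scale inner_diff_left dot_square_norm)
        then show "x \<in> span (insert b B)"
          using B(4) by (metis span_breakdown_eq)
      qed
    qed
    ultimately show ?thesis
      using B b by (intro exI[of _ "insert b B"]) (auto simp: V'_def)
  qed
qed

lemma symmetric_eigenbasis:
  fixes M :: "real^'n^'n"
  assumes "transpose M = M"
  obtains B l where "finite B" "pairwise orthogonal B" "\<forall>b\<in>B. norm b = 1"
    "\<forall>b\<in>B. M *v b = l b *\<^sub>R b" "\<forall>x. x = (\<Sum>b\<in>B. (x \<bullet> b) *\<^sub>R b)"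
proof -
  obtain B where B: "pairwise orthogonal B" "\<forall>b\<in>B. norm b = 1 \<and> (\<exists>l. M *v b = l *\<^sub>R b)"
    "span B = UNIV"
    using symmetric_invariant_subspace_eigenbasis[OF assms, of UNIV] by auto
  have "independent B"
    by (rule pairwise_orthogonal_independent) (use B in auto)
  then have "finite B" by (rule independent_imp_finite)
  obtain l where "\<forall>b\<in>B. M *v b = l b *\<^sub>R b" using B(2) by metis
  moreover have "x = (\<Sum>b\<in>B. (x \<bullet> b) *\<^sub>R b)" for x
    using orthonormal_basis_expand[of B x] B \<open>finite B\<close> by (simp add: inner_commute)
  ultimately show thesis using that[of B l] B \<open>finite B\<close> by blast
qed

text \<open>Existence is read off an orthonormal eigenbasis. For uniqueness, a square root \<open>C\<close> satisfies
\<open>(C + sqrt l) (C - sqrt l) b = 0\<close> on an eigenvector \<open>b\<close>, and \<open>C + sqrt l\<close> is injective for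
\<open>l > 0\<close>, so \<open>C\<close> acts on the eigenbasis as prescribed.\<close>

lemma pos_semidef_square_root:
  assumes "pos_semidef M"
  shows "\<exists>!S. transpose S = S \<and> (\<forall>x. 0 \<le> x \<bullet> (S *v x)) \<and> S ** S = M"
proof -
  note sym = pos_semidefD(1)[OF assms]
  obtain B l where B: "finite B" "pairwise orthogonal B" "\<forall>b\<in>B. norm b = 1"
    and "\<forall>b\<in>B. M *v b = l b *\<^sub>R b" "\<forall>x. x = (\<Sum>b\<in>B. (x \<bullet> b) *\<^sub>R b)"
    by (rule symmetric_eigenbasis[OF sym])
  then have l: "\<And>b. b \<in> B \<Longrightarrow> M *v b = l b *\<^sub>R b"
    and expand: "\<And>x. x = (\<Sum>b\<in>B. (x \<bullet> b) *\<^sub>R b)"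
    by blast+
  have l_nonneg: "l b \<ge> 0" if "b \<in> B" for b
    using pos_semidefD(2)[OF assms, of b] l[OF that] B(3)[rule_format, OF that] by (simp add: dot_square_norm)
  define S where "S = matrix (\<lambda>x. \<Sum>b\<in>B. (sqrt (l b) * (x \<bullet> b)) *\<^sub>R b)"
  have S: "S *v x = (\<Sum>b\<in>B. (sqrt (l b) * (x \<bullet> b)) *\<^sub>R b)" for x
    unfolding S_def
    by (subst matrix_works)
      (auto intro!: linearI simp: linear_matrix_vector_mul_eq inner_add_left algebra_simps sum.distrib scaleR_sum_right)
  have SB: "S *v b = sqrt (l b) *\<^sub>R b" if "b \<in> B" for b
  proof -
    have "S *v b = (\<Sum>c\<in>B. if c = b then sqrt (l b) *\<^sub>R b else 0)"
      unfolding S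
    proof (rule sum.cong)
      fix c assume "c \<in> B"
      then show "(sqrt (l c) * (b \<bullet> c)) *\<^sub>R c = (if c = b then sqrt (l b) *\<^sub>R b else 0)"
        using B(2) B(3)[rule_format, OF that] that
        by (auto simp: pairwise_def orthogonal_def dot_square_norm)
    qed simp
    then show ?thesis using that B(1) by simp
  qed
  have eqI: "C = D" if "\<And>b. b \<in> B \<Longrightarrow> C *v b = D *v b" for C D :: "real^'a^'a"
  proof (rule matrix_eqI)
    fix x
    have "E *v x = (\<Sum>b\<in>B. (x \<bullet> b) *\<^sub>R (E *v b))" for E :: "real^'a^'a"
      by (subst expand[of x]) (simp add: linear_sum[OF matrix_vector_mul_linear] matrix_vector_mult_scaleR)
    then show "C *v x = D *v x" using that by simp
  qed
  have "transpose S = S"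
    by (rule transpose_eqI)
      (simp add: S inner_sum_left inner_sum_right mult_ac inner_commute)
  moreover have "0 \<le> x \<bullet> (S *v x)" for x
    unfolding S inner_sum_right
    by (rule sum_nonneg) (simp add: l_nonneg mult.assoc inner_commute)
  moreover have "S ** S = M"
    by (rule eqI) (simp add: matrix_vector_mul_assoc[symmetric] SB l l_nonneg matrix_vector_mult_scaleR)
  moreover have "C = S" if C: "transpose C = C \<and> (\<forall>x. 0 \<le> x \<bullet> (C *v x)) \<and> C ** C = M" for C
  proof (rule eqI)
    fix b assume b: "b \<in> B"
    define c where "c = C *v b - sqrt (l b) *\<^sub>R b"
    have CC: "C *v (C *v b) = l b *\<^sub>R b"
      using C l[OF b] by (simp add: matrix_vector_mul_assoc)
    have "c = 0"
    proof (cases "l b = 0")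
      case True
      have "(C *v b) \<bullet> (C *v b) = b \<bullet> (C *v (C *v b))"
        using C symmetric_inner by blast
      then show ?thesis using True CC by (simp add: c_def)
    next
      case False
      have "C *v c = - sqrt (l b) *\<^sub>R c"
        using l_nonneg[OF b]
        by (simp add: c_def matrix_vector_mult_diff_distrib CC matrix_vector_mult_scaleR algebra_simps)
      then have "0 \<le> - sqrt (l b) * (c \<bullet> c)" using C
        by (metis inner_scaleR_right)
      moreover have "sqrt (l b) > 0" using l_nonneg[OF b] False by simp
      ultimately show ?thesis
        by (metis inner_eq_zero_iff inner_ge_zero less_eq_real_def mult_minus_left mult_pos_pos
            neg_0_le_iff_le not_less)
    qed
    then show "C *v b = S *v b" by (simp add: c_def SB[OF b])
  qed
  ultimately show ?thesis by blast
qed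

lemma msqrt_properties:
  assumes "pos_semidef Q"
  shows "transpose (msqrt Q) = msqrt Q" "0 \<le> x \<bullet> (msqrt Q *v x)" "msqrt Q ** msqrt Q = Q"
  using theI'[OF pos_semidef_square_root[OF assms]] by (auto simp: msqrt_def)

section \<open>Square summable sequences and scalar recursions\<close>

lemma ell2_summable: "x \<in> ell2 \<longleftrightarrow> (\<lambda>t. (norm (x t))\<^sup>2) summable_on UNIV"
  by (simp add: ell2_def)

lemma ell2_finite_sum_le:
  assumes "x \<in> ell2" "finite F"
  shows "(\<Sum>t\<in>F. (norm (x t))\<^sup>2) \<le> (\<Sum>\<^sub>\<infinity>t. (norm (x t))\<^sup>2)"
  using assms by (intro finite_sum_le_infsum) (auto simp: ell2_def)

lemma ell2_bounded:
  assumes "x \<in> ell2"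
  obtains B where "B \<ge> 0" "\<And>t. norm (x t) \<le> B"
proof
  show "0 \<le> sqrt (\<Sum>\<^sub>\<infinity>t. (norm (x t))\<^sup>2)"
    by (simp add: infsum_nonneg)
  fix t
  have "(norm (x t))\<^sup>2 \<le> (\<Sum>\<^sub>\<infinity>t. (norm (x t))\<^sup>2)"
    using ell2_finite_sum_le[OF assms, of "{t}"] by simp
  then show "norm (x t) \<le> sqrt (\<Sum>\<^sub>\<infinity>t. (norm (x t))\<^sup>2)"
    by (rule real_le_rsqrt)
qed

lemma ell2_dominated:
  assumes "x \<in> ell2" "\<And>t. norm (y t) \<le> c * norm (x t)"
  shows "y \<in> ell2"
  unfolding ell2_summable
proof (rule summable_on_comparison_test)
  show "(\<lambda>t. c\<^sup>2 * (norm (x t))\<^sup>2) summable_on UNIV"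
    using assms(1) unfolding ell2_summable by (rule summable_on_cmult_right)
  show "(norm (y t))\<^sup>2 \<le> c\<^sup>2 * (norm (x t))\<^sup>2" for t
    unfolding power_mult_distrib[symmetric] by (rule power_mono) (use assms(2) in auto)
qed simp

lemma ell2_zero [simp]: "(\<lambda>_. 0) \<in> ell2"
  by (simp add: ell2_def)

lemma ell2_add:
  assumes "x \<in> ell2" "y \<in> ell2"
  shows "(\<lambda>t. x t + y t) \<in> ell2"
  unfolding ell2_summable
proof (rule summable_on_comparison_test)
  show "(\<lambda>t. 2 * (norm (x t))\<^sup>2 + 2 * (norm (y t))\<^sup>2) summable_on UNIV"
    using assms unfolding ell2_summable by (intro summable_on_add summable_on_cmult_right)
  show "(norm (x t + y t))\<^sup>2 \<le> 2 * (norm (x t))\<^sup>2 + 2 * (norm (y t))\<^sup>2" for t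
  proof -
    have "(norm (x t + y t))\<^sup>2 \<le> (norm (x t) + norm (y t))\<^sup>2"
      by (simp add: norm_triangle_ineq power_mono)
    also have "\<dots> \<le> 2 * (norm (x t))\<^sup>2 + 2 * (norm (y t))\<^sup>2"
      using sum_squares_bound[of "norm (x t)" "norm (y t)"] by (simp add: power2_sum)
    finally show ?thesis .
  qed
qed simp

lemma ell2_bounded_linear:
  assumes "bounded_linear f" "x \<in> ell2"
  shows "(\<lambda>t. f (x t)) \<in> ell2"
proof -
  obtain c where "\<forall>v. norm (f v) \<le> norm v * c"
    using assms(1) bounded_linear.bounded by blast
  then show ?thesis
    by (intro ell2_dominated[OF assms(2), of _ c]) (simp add: mult.commute)
qed

lemma ell2_scaleR: "x \<in> ell2 \<Longrightarrow> (\<lambda>t. c *\<^sub>R x t) \<in> ell2"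
  by (rule ell2_bounded_linear[OF bounded_linear_scaleR_right])

lemma ell2_minus: "x \<in> ell2 \<Longrightarrow> (\<lambda>t. - x t) \<in> ell2"
  using ell2_scaleR[of x "-1"] by simp

lemma ell2_diff: "x \<in> ell2 \<Longrightarrow> y \<in> ell2 \<Longrightarrow> (\<lambda>t. x t - y t) \<in> ell2"
  using ell2_add[of x "\<lambda>t. - y t"] ell2_minus[of y] by simp

lemma ell2_matrix: "x \<in> ell2 \<Longrightarrow> (\<lambda>t. M *v x t) \<in> ell2"
  for M :: "'a::{euclidean_space,real_algebra_1}^'n^'m"
  by (rule ell2_bounded_linear) auto

lemma ell2_reindex:
  assumes "x \<in> ell2" "bij \<pi>"
  shows "(\<lambda>t. x (\<pi> t)) \<in> ell2"
  using assms unfolding ell2_summable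
  by (simp add: summable_on_reindex_bij_betw[of \<pi> UNIV UNIV "\<lambda>t. (norm (x t))\<^sup>2"])

lemma bij_int_shift: "bij (\<lambda>t::int. t + k)"
  by (rule bij_betw_byWitness[where f' = "\<lambda>t. t - k"]) auto

lemma bij_int_reflect: "bij (\<lambda>t::int. k - t)"
  by (rule bij_betw_byWitness[where f' = "\<lambda>t. k - t"]) auto

lemma ell2_shift: "x \<in> ell2 \<Longrightarrow> (\<lambda>t. x (t + k)) \<in> ell2"
  by (rule ell2_reindex[OF _ bij_int_shift])

lemma ell2_reflect: "x \<in> ell2 \<Longrightarrow> (\<lambda>t. x (k - t)) \<in> ell2"
  by (rule ell2_reindex[OF _ bij_int_reflect])

text \<open>Convexity of the square, applied to the combination \<open>r n + (1 - r) (b / (1 - r))\<close>.\<close>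

lemma convex_square_split:
  fixes r n b :: real
  assumes "0 \<le> r" "r < 1"
  shows "(r * n + b)\<^sup>2 \<le> r * n\<^sup>2 + b\<^sup>2 / (1 - r)"
proof -
  have "(1 - r) * (r * n\<^sup>2 + b\<^sup>2 / (1 - r) - (r * n + b)\<^sup>2) = r * ((1 - r) * n - b)\<^sup>2"
    using assms by (simp add: field_simps power2_eq_square)
  also have "\<dots> \<ge> 0" using assms by simp
  finally show ?thesis using assms by (simp add: zero_le_mult_iff)
qed

text \<open>Summing the squared recursion over a window bounds the window sum by \<open>r\<close> times itself plus a
constant that does not depend on the window. Boundedness of \<open>y\<close> controls the term at the left end.\<close>

lemma contractive_recursion_ell2:
  fixes y :: "int \<Rightarrow> 'a::real_inner" and v :: "int \<Rightarrow> 'b::real_inner"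
  assumes r: "0 \<le> r" "r < 1" and v: "v \<in> ell2"
    and bounded: "\<And>t. norm (y t) \<le> B"
    and rec: "\<And>t. norm (y (t + 1)) \<le> r * norm (y t) + norm (v t)"
  shows "y \<in> ell2"
proof -
  define V where "V = (\<Sum>\<^sub>\<infinity>t. (norm (v t))\<^sup>2)"
  define n where "n t = (norm (y t))\<^sup>2" for t
  have step: "n (t + 1) \<le> r * n t + (norm (v t))\<^sup>2 / (1 - r)" for t
  proof -
    have "n (t + 1) \<le> (r * norm (y t) + norm (v t))\<^sup>2"
      unfolding n_def by (rule power_mono[OF rec]) simp
    then show ?thesis
      using convex_square_split[OF r, of "norm (y t)" "norm (v t)"] by (simp add: n_def)
  qed
  have n0: "0 \<le> n t" "n t \<le> B\<^sup>2" for t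
    using bounded[of t] by (auto simp: n_def intro: power_mono)
  have window: "(\<Sum>t\<in>{-M+1..M}. n t) \<le> (B\<^sup>2 + V / (1 - r)) / (1 - r)" if "M > 0" for M :: int
  proof -
    let ?s = "\<Sum>t\<in>{-M+1..M}. n t"
    have "?s = (\<Sum>t\<in>{-M..<M}. n (t + 1))"
      by (rule sum.reindex_bij_witness[of _ "\<lambda>t. t + 1" "\<lambda>t. t - 1"]) auto
    also have "\<dots> \<le> (\<Sum>t\<in>{-M..<M}. r * n t + (norm (v t))\<^sup>2 / (1 - r))"
      by (rule sum_mono) (rule step)
    also have "\<dots> = r * (\<Sum>t\<in>{-M..<M}. n t) + (\<Sum>t\<in>{-M..<M}. (norm (v t))\<^sup>2) / (1 - r)"
      by (simp add: sum.distrib sum_distrib_left sum_divide_distrib)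
    also have "(\<Sum>t\<in>{-M..<M}. n t) \<le> (\<Sum>t\<in>insert (-M) {-M+1..M}. n t)"
      by (rule sum_mono2) (auto simp: n0)
    also have "(\<Sum>t\<in>insert (-M) {-M+1..M}. n t) = n (-M) + ?s"
      by (subst sum.insert) auto
    also have "n (-M) \<le> B\<^sup>2" by (rule n0)
    also have "(\<Sum>t\<in>{-M..<M}. (norm (v t))\<^sup>2) \<le> V"
      unfolding V_def by (rule ell2_finite_sum_le[OF v]) simp
    finally have "?s \<le> r * (B\<^sup>2 + ?s) + V / (1 - r)"
      using r by (simp add: mult_left_mono divide_right_mono)
    moreover have "r * B\<^sup>2 \<le> B\<^sup>2" using r by (simp add: mult_left_le_one_le)
    ultimately have "(1 - r) * ?s \<le> B\<^sup>2 + V / (1 - r)" by (simp add: algebra_simps)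
    then show ?thesis using r by (simp add: pos_le_divide_eq mult.commute)
  qed
  show ?thesis
    unfolding ell2_summable
  proof (rule nonneg_bounded_partial_sums_imp_summable_on)
    have "sum n F \<le> (B\<^sup>2 + V / (1 - r)) / (1 - r)" if "finite F" for F
    proof -
      obtain M where M: "M > 0" "\<And>t. t \<in> F \<Longrightarrow> \<bar>t\<bar> < M"
      proof
        show "0 < (\<Sum>t\<in>F. \<bar>t\<bar>) + 1" by (simp add: add_nonneg_pos sum_nonneg)
        show "\<bar>t\<bar> < (\<Sum>t\<in>F. \<bar>t\<bar>) + 1" if "t \<in> F" for t
          using member_le_sum[OF that, of "\<lambda>t. \<bar>t\<bar>"] \<open>finite F\<close> by simp
      qed
      have "F \<subseteq> {-M+1..M}" using M(2) by force
      then have "sum n F \<le> sum n {-M+1..M}" by (intro sum_mono2) (auto simp: n0)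
      then show ?thesis using window[OF M(1)] by simp
    qed
    then show "\<forall>\<^sub>F F in finite_subsets_at_top UNIV. (\<Sum>t\<in>F. (norm (y t))\<^sup>2) \<le> (B\<^sup>2 + V / (1 - r)) / (1 - r)"
      unfolding n_def[symmetric] by (intro eventually_finite_subsets_at_top_weakI) auto
  qed simp
qed

lemma norm_vec_scale: "norm (l *s x) = cmod l * norm x" for x :: "complex^'n"
proof -
  have "(\<Sum>i\<in>UNIV. (cmod l * cmod (x $ i))\<^sup>2) = (cmod l)\<^sup>2 * (\<Sum>i\<in>UNIV. (cmod (x $ i))\<^sup>2)"
    by (simp add: power_mult_distrib sum_distrib_left)
  then show ?thesis
    by (simp add: norm_vec_def L2_set_def norm_mult real_sqrt_mult)
qed

lemma bounded_linear_vec_scale: "bounded_linear (\<lambda>x::complex^'n. l *s x)"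
  by (rule bounded_linear_intro[where K = "cmod l"])
    (simp_all add: vec_eq_iff algebra_simps norm_vec_scale)

text \<open>The solution is the convolution with the geometric sequence.\<close>

lemma stable_scalar_recursion_solvable:
  fixes v :: "int \<Rightarrow> complex^'n"
  assumes l: "cmod l < 1" and v: "v \<in> ell2"
  shows "\<exists>y\<in>ell2. \<forall>t. y (t + 1) = l *s y t + v t"
proof -
  obtain B where B: "B \<ge> 0" "\<And>t. norm (v t) \<le> B" using ell2_bounded[OF v] by blast
  define y where "y t = (\<Sum>k. l ^ k *s v (t - 1 - int k))" for t
  have term_le: "norm (l ^ k *s v (t - int k)) \<le> B * cmod l ^ k" for t k
    using mult_left_mono[OF B(2)[of "t - int k"], of "cmod l ^ k"] by (simp add: norm_vec_scale norm_power mult.commute)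
  have geo: "summable (\<lambda>k. B * cmod l ^ k)" using l by (simp add: summable_geometric)
  have summable: "summable (\<lambda>k. l ^ k *s v (t - int k))" for t
    by (rule summable_comparison_test'[OF geo]) (rule term_le)
  have bound: "norm (y t) \<le> (\<Sum>k. B * cmod l ^ k)" for t
    unfolding y_def by (rule norm_suminf_le[OF term_le geo])
  have rec: "y (t + 1) = l *s y t + v t" for t
  proof -
    have "y (t + 1) = v t + (\<Sum>k. l ^ Suc k *s v (t - int (Suc k)))"
      unfolding y_def using suminf_split_head[OF summable[of t]] by simp
    also have "(\<Sum>k. l ^ Suc k *s v (t - int (Suc k))) = (\<Sum>k. l *s (l ^ k *s v (t - 1 - int k)))"
      by (simp add: vector_smult_assoc algebra_simps)
    also have "\<dots> = l *s y t"
      unfolding y_def by (rule bounded_linear.suminf[OF bounded_linear_vec_scale summable, symmetric])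
    finally show ?thesis by simp
  qed
  have "y \<in> ell2"
  proof (rule contractive_recursion_ell2[OF _ l v bound])
    show "norm (y (t + 1)) \<le> cmod l * norm (y t) + norm (v t)" for t
      using norm_triangle_ineq[of "l *s y t" "v t"] by (simp add: rec norm_vec_scale)
  qed simp
  then show ?thesis using rec by blast
qed

lemma scalar_recursion_solvable:
  fixes v :: "int \<Rightarrow> complex^'n"
  assumes l: "cmod l \<noteq> 1" and v: "v \<in> ell2"
  shows "\<exists>y\<in>ell2. \<forall>t. y (t + 1) = l *s y t + v t"
proof (cases "cmod l < 1")
  case True
  then show ?thesis using stable_scalar_recursion_solvable v by blast
next
  case False
  then have l1: "cmod l > 1" "l \<noteq> 0" using l by auto
  \<comment> \<open>Run time backwards: the recursion for \<open>y (- t)\<close> has multiplier \<open>1 / l\<close>.\<close>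
  have "(\<lambda>t. - (inverse l *s v (-1 - t))) \<in> ell2"
    by (intro ell2_minus ell2_bounded_linear[OF bounded_linear_vec_scale] ell2_reflect v)
  moreover have "cmod (inverse l) < 1" using l1 by (simp add: norm_inverse inverse_less_1_iff)
  ultimately obtain z where z: "z \<in> ell2"
    "\<And>t. z (t + 1) = inverse l *s z t - inverse l *s v (-1 - t)"
    using stable_scalar_recursion_solvable[of "inverse l" "\<lambda>t. - (inverse l *s v (-1 - t))"] by auto
  have "(\<lambda>t. z (0 - t)) \<in> ell2" by (rule ell2_reflect[OF z(1)])
  moreover have "z (0 - (t + 1)) = l *s z (0 - t) + v t" for t
  proof -
    have e: "z (- t) = inverse l *s z (- t - 1) - inverse l *s v t"
      using z(2)[of "- t - 1"] by simp
    have "l *s z (- t) + v t = z (- t - 1)"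
      unfolding e using l1 by (simp add: vec_eq_iff right_diff_distrib mult.assoc[symmetric])
    moreover have "0 - (t + 1) = - t - 1" by simp
    ultimately show ?thesis by simp
  qed
  ultimately show ?thesis
    by (intro bexI[of _ "\<lambda>t. z (0 - t)"] allI; simp only:)
qed

text \<open>A homogeneous solution grows geometrically in one of the two time directions unless it vanishes.\<close>

lemma scalar_recursion_unique:
  fixes m :: "int \<Rightarrow> complex^'n"
  assumes l: "cmod l \<noteq> 1" and m: "m \<in> ell2" and rec: "\<And>t. m (t + 1) = l *s m t"
  shows "m t = 0"
proof -
  obtain B where B: "B \<ge> 0" "\<And>t. norm (m t) \<le> B" using ell2_bounded[OF m] by blast
  have pow: "norm (m (t + int k)) = cmod l ^ k * norm (m t)" for t k
  proof (induction k)
    case (Suc k)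
    have "m (t + int (Suc k)) = l *s m (t + int k)" using rec[of "t + int k"] by (simp add: algebra_simps)
    then show ?case by (simp add: Suc norm_vec_scale)
  qed simp
  show ?thesis
  proof (rule ccontr)
    assume nz: "m t \<noteq> 0"
    then have p: "norm (m t) > 0" by simp
    show False
    proof (cases "cmod l < 1")
      case True
      have "(\<lambda>k. cmod l ^ k * B) \<longlonglongrightarrow> 0 * B"
        by (intro tendsto_mult tendsto_const LIMSEQ_power_zero) (use True in simp)
      then have "\<forall>\<^sub>F k in sequentially. cmod l ^ k * B < norm (m t)"
        using p by (intro order_tendstoD(2)) auto
      then obtain k where k: "cmod l ^ k * B < norm (m t)" by (auto simp: eventually_sequentially)
      have "norm (m t) = cmod l ^ k * norm (m (t - int k))" using pow[of "t - int k" k] by simp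
      also have "\<dots> \<le> cmod l ^ k * B" by (intro mult_left_mono B) simp
      finally show False using k by simp
    next
      case False
      then have "cmod l > 1" using l by simp
      then obtain k where "B / norm (m t) < cmod l ^ k" using real_arch_pow by blast
      then have "B < cmod l ^ k * norm (m t)" using p by (simp add: pos_divide_less_eq)
      then show False using pow[of t k] B(2)[of "t + int k"] by simp
    qed
  qed
qed

section \<open>Annihilating polynomials\<close>

lemma finite_sequence_linear_relation:
  fixes f :: "nat \<Rightarrow> 'a::euclidean_space"
  obtains c :: "nat \<Rightarrow> real" and N where "\<exists>i\<le>N. c i \<noteq> 0" "(\<Sum>i\<le>N. c i *\<^sub>R f i) = 0"
proof (cases "inj_on f {..DIM('a)}")
  case True
  have "dependent (f ` {..DIM('a)})"
    by (rule dependent_biggerset) (simp add: card_image[OF True])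
  then obtain u v where u: "v \<in> f ` {..DIM('a)}" "u v \<noteq> 0"
    "(\<Sum>v\<in>f ` {..DIM('a)}. u v *\<^sub>R v) = 0"
    by (auto simp: dependent_finite)
  then show thesis
    using that[of "DIM('a)" "\<lambda>i. u (f i)"] by (auto simp: sum.reindex[OF True])
next
  case False
  then obtain i j where ij: "i \<noteq> j" "f i = f j" by (auto simp: inj_on_def)
  define N where "N = max i j"
  define c where "c k = (if k = i then 1 else if k = j then - 1 else (0::real))" for k
  have "(\<Sum>k\<le>N. c k *\<^sub>R f k) = (\<Sum>k\<in>{i, j}. c k *\<^sub>R f k)"
    by (rule sum.mono_neutral_right) (auto simp: N_def c_def)
  also have "\<dots> = 0" using ij by (simp add: c_def)
  finally show thesis
    using that[of N c] by (metis N_def c_def max.cobounded1 zero_neq_one)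
qed

text \<open>The product of the commuting operators \<open>C - l\<close> for \<open>l\<close> in the list. It encodes an annihilating
polynomial by its roots, which is the form that the recursions consume one factor at a time.\<close>

primrec factor_product :: "complex^'n^'n \<Rightarrow> complex list \<Rightarrow> complex^'n \<Rightarrow> complex^'n" where
  "factor_product C [] v = v"
| "factor_product C (l # ls) v = C *v factor_product C ls v - l *s factor_product C ls v"

lemma complex_matrix_scale: "C *v (l *s v) = l *s (C *v v)" for C :: "complex^'n^'m"
  by (simp add: vector_scalar_commute)

lemma factor_product_add: "factor_product C ls (v + w) = factor_product C ls v + factor_product C ls w"
  by (induction ls) (simp_all add: matrix_vector_right_distrib vector_add_ldistrib)

lemma factor_product_scale: "factor_product C ls (c *s v) = c *s factor_product C ls v"
  by (induction ls)
    (simp_all add: complex_matrix_scale vector_smult_assoc mult.commute vector_ssub_ldistrib)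

lemma factor_product_diff: "factor_product C ls (v - w) = factor_product C ls v - factor_product C ls w"
  using factor_product_add[of C ls "v - w" w] by simp

lemma factor_product_commute: "factor_product C ls (C *v v) = C *v factor_product C ls v"
  by (induction ls) (simp_all add: matrix_vector_mult_diff_distrib complex_matrix_scale)

lemma factor_product_Cons': "factor_product C (l # ls) v = factor_product C ls (C *v v - l *s v)"
  by (simp add: factor_product_diff factor_product_commute factor_product_scale)

lemma factor_product_0 [simp]: "factor_product C ls 0 = 0"
  by (induction ls) simp_all

lemma factor_product_bounded_linear: "bounded_linear (factor_product C ls)"
proof (induction ls)
  case (Cons l ls)
  have "bounded_linear (\<lambda>v. C *v factor_product C ls v - l *s factor_product C ls v)"
    by (intro bounded_linear_sub bounded_linear_compose[OF matrix_vector_mul_bounded_linear Cons]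
        bounded_linear_compose[OF bounded_linear_vec_scale Cons])
  then show ?case by simp
qed simp

text \<open>Horner evaluation of the polynomial \<open>p\<close> at the matrix \<open>C\<close>, applied to \<open>v\<close>.\<close>

definition poly_operator :: "complex^'n^'n \<Rightarrow> complex poly \<Rightarrow> complex^'n \<Rightarrow> complex^'n" where
  "poly_operator C p v = fold_coeffs (\<lambda>a x. a *s v + C *v x) p 0"

lemma poly_operator_0 [simp]: "poly_operator C 0 v = 0"
  by (simp add: poly_operator_def)

lemma poly_operator_pCons: "poly_operator C (pCons a p) v = a *s v + C *v poly_operator C p v"
  by (cases "p = 0 \<and> a = 0") (auto simp: poly_operator_def)

lemma poly_operator_add: "poly_operator C (p + q) v = poly_operator C p v + poly_operator C q v"
  by (induction p q rule: poly_induct2)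
    (simp_all add: poly_operator_pCons matrix_vector_right_distrib vector_sadd_rdistrib)

lemma poly_operator_smult: "poly_operator C (smult c p) v = c *s poly_operator C p v"
  by (induction p)
    (simp_all add: poly_operator_pCons complex_matrix_scale vector_add_ldistrib vector_smult_assoc)

lemma poly_operator_linear_factor:
  "poly_operator C ([:- l, 1:] * p) v = C *v poly_operator C p v - l *s poly_operator C p v"
proof -
  have "[:- l, 1:] * p = pCons 0 p + smult (- l) p" by simp
  then show ?thesis
    by (simp only: poly_operator_add poly_operator_smult poly_operator_pCons)
      (simp add: vec_eq_iff)
qed

lemma poly_operator_monom: "poly_operator C (monom c k) v = c *s (((*v) C) ^^ k) v"
  by (induction k)
    (simp_all add: monom_0 monom_Suc poly_operator_pCons complex_matrix_scale)

lemma poly_operator_sum: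
  "poly_operator C (\<Sum>i\<in>I. f i) v = (\<Sum>i\<in>I. poly_operator C (f i) v)"
  by (induction I rule: infinite_finite_induct) (simp_all add: poly_operator_add)

lemma poly_operator_prod_list:
  "poly_operator C (\<Prod>l\<leftarrow>ls. [:- l, 1:]) v = factor_product C ls v"
proof (induction ls)
  case Nil
  show ?case using poly_operator_pCons[of C 1 0 v] by (simp add: one_pCons)
next
  case (Cons l ls)
  then show ?case by (simp only: list.map prod_list.Cons poly_operator_linear_factor factor_product.simps)
qed

text \<open>Eigenvalues are complex while all signals are real; \<open>cvec\<close> and \<open>rvec\<close> move between the two.\<close>

definition cvec :: "real^'n \<Rightarrow> complex^'n" where
  "cvec x = (\<chi> i. complex_of_real (x $ i))"

definition rvec :: "complex^'n \<Rightarrow> real^'n" where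
  "rvec z = (\<chi> i. Re (z $ i))"

lemma cmat_cvec: "cmat A *v cvec x = cvec (A *v x)"
  by (simp add: vec_eq_iff cvec_def matrix_vector_mult_def map_matrix_def)

lemma rvec_cmat: "rvec (cmat A *v z) = A *v rvec z"
  by (simp add: vec_eq_iff rvec_def matrix_vector_mult_def map_matrix_def)

lemma norm_cvec: "norm (cvec x) = norm x"
  by (simp add: cvec_def norm_vec_def L2_set_def)

lemma norm_rvec_le: "norm (rvec z) \<le> norm z"
  unfolding norm_vec_def by (rule L2_set_mono) (simp_all add: rvec_def abs_Re_le_cmod)

lemma rvec_cvec [simp]: "rvec (cvec x) = x"
  by (simp add: cvec_def rvec_def vec_eq_iff)

lemma rvec_add: "rvec (z + w) = rvec z + rvec w"
  by (simp add: rvec_def vec_eq_iff)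

lemma cvec_add: "cvec (z + w) = cvec z + cvec w"
  by (simp add: cvec_def vec_eq_iff)

lemma cvec_0 [simp]: "cvec 0 = 0" "cvec x = 0 \<longleftrightarrow> x = 0"
  by (auto simp: cvec_def vec_eq_iff)

lemma cvec_scaleR: "cvec (c *\<^sub>R x) = complex_of_real c *s cvec x"
  by (simp add: cvec_def vec_eq_iff)

lemma complex_vec_cases:
  obtains x y where "z = cvec x + \<i> *s cvec y"
proof
  show "z = cvec (\<chi> i. Re (z $ i)) + \<i> *s cvec (\<chi> i. Im (z $ i))"
    by (simp add: vec_eq_iff cvec_def complex_eq_iff)
qed

lemma cmat_power_cvec: "(((*v) (cmat A)) ^^ k) (cvec x) = cvec ((((*v) A) ^^ k) x)"
  for A :: "real^'n^'n"
  by (induction k) (simp_all add: cmat_cvec)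

text \<open>The powers of \<open>A\<close> are linearly dependent, so a nonzero polynomial annihilates \<open>A\<close>, and it splits
over the complex numbers. A factor \<open>C - l\<close> at a number \<open>l\<close> that is not an eigenvalue is injective
and can be cancelled, hence only eigenvalues are kept.\<close>

lemma real_matrix_annihilated_by_linear_factors:
  fixes A :: "real^'n^'n"
  obtains ls where "\<forall>v. factor_product (cmat A) ls v = 0"
    "\<And>l. l \<in> set ls \<Longrightarrow> \<exists>v. v \<noteq> 0 \<and> cmat A *v v = l *s v"
proof -
  let ?C = "cmat A"
  obtain c N where c: "\<exists>i\<le>N. c i \<noteq> 0" and
    rel: "(\<Sum>i\<le>N. c i *\<^sub>R (((**) A) ^^ i) (mat 1)) = 0"
    by (rule finite_sequence_linear_relation)
  have pow: "(((**) A) ^^ i) (mat 1) *v x = (((*v) A) ^^ i) x" for i x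
    by (induction i) (simp_all add: matrix_vector_mul_assoc[symmetric])
  define p where "p = (\<Sum>i\<le>N. monom (complex_of_real (c i)) i)"
  have real0: "(\<Sum>i\<le>N. c i *\<^sub>R (((*v) A) ^^ i) x) = 0" for x
  proof -
    have lin: "linear (\<lambda>M::real^'n^'n. M *v x)"
      by (rule linearI) (simp_all add: matrix_vector_mult_add_rdistrib scaleR_matrix_vector_assoc[symmetric])
    have "(\<Sum>i\<le>N. c i *\<^sub>R (((**) A) ^^ i) (mat 1)) *v x = (\<Sum>i\<le>N. c i *\<^sub>R (((*v) A) ^^ i) x)"
      by (subst linear_sum[OF lin]) (simp add: scaleR_matrix_vector_assoc[symmetric] pow)
    then show ?thesis by (simp add: rel)
  qed
  have cvec_sum: "cvec (\<Sum>i\<in>I. f i) = (\<Sum>i\<in>I. cvec (f i))" for I and f :: "nat \<Rightarrow> real^'n"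
    by (induction I rule: infinite_finite_induct) (simp_all add: cvec_add)
  have cvec0: "poly_operator ?C p (cvec x) = 0" for x
    using arg_cong[OF real0[of x], of cvec]
    by (simp add: p_def poly_operator_sum poly_operator_monom cmat_power_cvec cvec_sum cvec_scaleR)
  obtain i where "i \<le> N" "c i \<noteq> 0" using c by blast
  then have "coeff p i \<noteq> 0" by (simp add: p_def coeff_sum)
  then have "p \<noteq> 0" by auto
  obtain A0 where A0: "size A0 = degree p \<and> p = smult (lead_coeff p) (\<Prod>x\<in>#A0. [:-x, 1:])"
    using alg_closed_imp_factorization[OF \<open>p \<noteq> 0\<close>] by (elim exE) (rule that)
  obtain ls where ls: "mset ls = A0" using ex_mset ..
  have "(\<Prod>x\<in>#A0. [:-x, 1:]) = (\<Prod>l\<leftarrow>ls. [:- l, 1:])"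
    unfolding ls[symmetric] mset_map[symmetric] prod_mset_prod_list ..
  with A0 have p: "p = smult (lead_coeff p) (\<Prod>l\<leftarrow>ls. [:- l, 1:])"
    by (simp only:)
  have "lead_coeff p *s factor_product ?C ls (cvec x) = 0" for x
    using cvec0[of x] by (subst (asm) p) (simp only: poly_operator_smult poly_operator_prod_list)
  then have real_ann: "factor_product ?C ls (cvec x) = 0" for x
    using \<open>p \<noteq> 0\<close> by (metis leading_coeff_0_iff vector_mul_eq_0)
  have ann: "factor_product ?C ls v = 0" for v
    by (rule complex_vec_cases[of v]) (simp add: factor_product_add factor_product_scale real_ann)
  define ev where "ev l \<longleftrightarrow> (\<exists>v. v \<noteq> 0 \<and> ?C *v v = l *s v)" for l
  have "factor_product ?C ks v = 0 \<Longrightarrow> factor_product ?C (filter ev ks) v = 0" for ks v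
  proof (induction ks arbitrary: v)
    case (Cons l ks)
    show ?case
    proof (cases "ev l")
      case True
      have "factor_product ?C ks (?C *v v - l *s v) = 0"
        using Cons.prems by (simp only: factor_product_Cons')
      then have "factor_product ?C (filter ev ks) (?C *v v - l *s v) = 0" by (rule Cons.IH)
      with True show ?thesis by (simp add: factor_product_Cons' del: factor_product.simps)
    next
      case False
      have "?C *v factor_product ?C ks v = l *s factor_product ?C ks v" using Cons.prems by simp
      then have "factor_product ?C ks v = 0" using False by (auto simp: ev_def)
      with False show ?thesis by (simp add: Cons.IH)
    qed
  qed simp
  then have "\<forall>v. factor_product ?C (filter ev ls) v = 0" using ann by blast
  then show thesis by (rule that) (simp add: ev_def)
qed

text \<open>An annihilating product of factors \<open>C - k\<close> acts on an eigenvector for \<open>l\<close> as the product of the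
numbers \<open>l - k\<close>, so \<open>l\<close> is one of the \<open>k\<close>.\<close>

lemma finite_real_eigenvalues:
  fixes M :: "real^'n^'n"
  shows "finite {l. \<exists>v. v \<noteq> 0 \<and> M *v v = l *\<^sub>R v}"
proof -
  obtain ls where ls: "\<forall>v. factor_product (cmat M) ls v = 0"
    by (rule real_matrix_annihilated_by_linear_factors[of M]) (rule that)
  have "{l. \<exists>v. v \<noteq> 0 \<and> M *v v = l *\<^sub>R v} \<subseteq> Re ` set ls"
  proof clarify
    fix l v assume v: "v \<noteq> 0" "M *v v = l *\<^sub>R v"
    have "\<exists>c. factor_product (cmat M) ks (cvec v) = c *s cvec v \<and> (complex_of_real l \<notin> set ks \<longrightarrow> c \<noteq> 0)" for ks
    proof (induction ks)
      case Nil
      show ?case by (intro exI[of _ 1]) simp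
    next
      case (Cons k ks)
      then obtain c where c: "factor_product (cmat M) ks (cvec v) = c *s cvec v"
        "complex_of_real l \<notin> set ks \<longrightarrow> c \<noteq> 0" by blast
      have "factor_product (cmat M) (k # ks) (cvec v) = ((complex_of_real l - k) * c) *s cvec v"
        by (simp add: c complex_matrix_scale cmat_cvec v cvec_scaleR vec_eq_iff algebra_simps)
      then show ?case using c(2) by (intro exI[of _ "(complex_of_real l - k) * c"]) auto
    qed
    then obtain c where "factor_product (cmat M) ls (cvec v) = c *s cvec v"
      "complex_of_real l \<notin> set ls \<longrightarrow> c \<noteq> 0" by blast
    then have "complex_of_real l \<in> set ls" using ls v by auto
    then show "l \<in> Re ` set ls" by force
  qed
  then show ?thesis using finite_surj by blast
qed

section \<open>Stable matrices and square summable solutions\<close>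

text \<open>Induction on the factors: the orbit of \<open>(C - l) v\<close> decays by hypothesis, and the orbit of \<open>v\<close> solves
the recursion with multiplier \<open>l\<close> that it drives. The slack between \<open>r\<close> and \<open>\<rho>\<close> absorbs the
polynomial factors of repeated eigenvalues.\<close>

lemma factor_product_power_bound:
  fixes C :: "complex^'n^'n"
  assumes r: "0 \<le> r" "r < \<rho>"
  shows "(\<And>l. l \<in> set ls \<Longrightarrow> cmod l \<le> r) \<Longrightarrow>
    \<exists>K\<ge>0. \<forall>k v. factor_product C ls v = 0 \<longrightarrow> norm ((((*v) C) ^^ k) v) \<le> K * \<rho> ^ k * norm v"
proof (induction ls)
  case Nil
  have "(((*v) C) ^^ k) 0 = 0" for k by (induction k) simp_all
  then show ?case by (intro exI[of _ 0]) auto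
next
  case (Cons l ls)
  obtain K where K: "K \<ge> 0" "\<And>k v. factor_product C ls v = 0 \<Longrightarrow>
      norm ((((*v) C) ^^ k) v) \<le> K * \<rho> ^ k * norm v"
    using Cons by auto
  have "bounded_linear (\<lambda>v. C *v v - l *s v)"
    by (intro bounded_linear_sub matrix_vector_mul_bounded_linear bounded_linear_vec_scale)
  then obtain c where c: "c \<ge> 0" "\<And>v. norm (C *v v - l *s v) \<le> norm v * c"
    using bounded_linear.nonneg_bounded by blast
  \<comment> \<open>\<open>D\<close> is chosen so that \<open>r D + K c \<le> \<rho> D\<close>, which closes the induction on \<open>k\<close>.\<close>
  define D where "D = max 1 (K * c / (\<rho> - r))"
  have D: "D \<ge> 1" "K * c \<le> D * (\<rho> - r)"
    using r by (auto simp: D_def pos_divide_le_eq[symmetric])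
  have "norm ((((*v) C) ^^ k) v) \<le> D * \<rho> ^ k * norm v" if v: "factor_product C (l # ls) v = 0" for k v
  proof (induction k)
    case 0
    show ?case using D(1) by (simp add: mult_le_cancel_right1)
  next
    case (Suc k)
    let ?x = "(((*v) C) ^^ k) v" and ?d = "C *v v - l *s v"
    have comm: "(((*v) C) ^^ k) ?d = C *v ?x - l *s ?x"
      by (induction k) (simp_all add: matrix_vector_mult_diff_distrib complex_matrix_scale)
    have "norm (C *v ?x) \<le> norm (l *s ?x) + norm ((((*v) C) ^^ k) ?d)"
      unfolding comm using norm_triangle_ineq[of "l *s ?x" "C *v ?x - l *s ?x"] by simp
    also have "norm (l *s ?x) \<le> r * (D * \<rho> ^ k * norm v)"
      unfolding norm_vec_scale using Cons.prems[of l] Suc r by (intro mult_mono) auto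
    also have "norm ((((*v) C) ^^ k) ?d) \<le> K * \<rho> ^ k * norm ?d"
      by (rule K(2)) (use v in \<open>simp only: factor_product_Cons'\<close>)
    also have "K * \<rho> ^ k * norm ?d \<le> K * \<rho> ^ k * (norm v * c)"
      using K(1) r by (intro mult_left_mono c) simp
    also have "K * \<rho> ^ k * (norm v * c) = (K * c) * (\<rho> ^ k * norm v)" by simp
    also have "\<dots> \<le> (D * (\<rho> - r)) * (\<rho> ^ k * norm v)"
      using D(2) r by (intro mult_right_mono) auto
    finally show ?case by (simp add: algebra_simps)
  qed
  then show ?case using D(1) by (intro exI[of _ D]) auto
qed

lemma schur_stable_power_bound:
  fixes A :: "real^'n^'n"
  assumes "schur_stable A"
  obtains K \<rho> where "K \<ge> 0" "0 < \<rho>" "\<rho> < 1" "\<And>k v. norm ((((*v) A) ^^ k) v) \<le> K * \<rho> ^ k * norm v"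
proof -
  obtain ls where ls: "\<forall>v. factor_product (cmat A) ls v = 0"
    "\<And>l. l \<in> set ls \<Longrightarrow> \<exists>v. v \<noteq> 0 \<and> cmat A *v v = l *s v"
    by (rule real_matrix_annihilated_by_linear_factors) blast
  define r where "r = Max (insert 0 (cmod ` set ls))"
  have "r \<in> insert 0 (cmod ` set ls)" unfolding r_def by (rule Max_in) auto
  moreover have "cmod l < 1" if "l \<in> set ls" for l
    using ls(2)[OF that] assms by (auto simp: schur_stable_def)
  ultimately have r1: "r < 1" by auto
  have r: "0 \<le> r" "\<And>l. l \<in> set ls \<Longrightarrow> cmod l \<le> r" by (auto simp: r_def)
  define \<rho> where "\<rho> = (r + 1) / 2"
  have \<rho>: "r < \<rho>" "0 < \<rho>" "\<rho> < 1" using r r1 by (auto simp: \<rho>_def)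
  obtain K where K: "K \<ge> 0" "\<forall>k v. factor_product (cmat A) ls v = 0 \<longrightarrow>
      norm ((((*v) (cmat A)) ^^ k) v) \<le> K * \<rho> ^ k * norm v"
    using factor_product_power_bound[OF r(1) \<rho>(1), of ls] r(2) by blast
  have "norm ((((*v) A) ^^ k) v) \<le> K * \<rho> ^ k * norm v" for k v
    using K(2)[rule_format, OF ls(1)[rule_format, of "cvec v"], of k]
    by (simp add: cmat_power_cvec norm_cvec)
  then show thesis using that K \<rho> by blast
qed

definition circle_free :: "real^'n^'n \<Rightarrow> bool" where
  "circle_free A \<longleftrightarrow> (\<forall>l v. v \<noteq> 0 \<and> cmat A *v v = l *s v \<longrightarrow> cmod l \<noteq> 1)"

lemma schur_stable_imp_circle_free: "schur_stable A \<Longrightarrow> circle_free A"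
  unfolding schur_stable_def circle_free_def by fastforce

text \<open>The residual \<open>r\<close> measures what is not yet solved. Solving one scalar recursion with multiplier \<open>l\<close>
moves the factor \<open>C - l\<close> into the residual; once the factors annihilate, nothing is left of it.\<close>

lemma factored_recursion_solvable:
  fixes v :: "int \<Rightarrow> complex^'n"
  assumes v: "v \<in> ell2"
  shows "(\<And>l. l \<in> set ls \<Longrightarrow> cmod l \<noteq> 1) \<Longrightarrow>
    \<exists>x\<in>ell2. \<exists>r\<in>ell2. \<forall>t. x (t + 1) = C *v x t + v t - factor_product C ls (r t)"
proof (induction ls)
  case Nil
  show ?case using v by (intro bexI[of _ "\<lambda>_. 0"] bexI[of _ v]) auto
next
  case (Cons l ls)
  then obtain x r where xr: "x \<in> ell2" "r \<in> ell2"
    "\<And>t. x (t + 1) = C *v x t + v t - factor_product C ls (r t)" by auto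
  obtain y where y: "y \<in> ell2" "\<And>t. y (t + 1) = l *s y t + r t"
    using scalar_recursion_solvable[of l r] Cons.prems xr by auto
  let ?x = "\<lambda>t. x t + factor_product C ls (y t)"
  have "?x \<in> ell2"
    by (intro ell2_add xr ell2_bounded_linear[OF factor_product_bounded_linear] y)
  moreover have "?x (t + 1) = C *v ?x t + v t - factor_product C (l # ls) (y t)" for t
    by (simp add: xr(3) y(2) factor_product_add factor_product_scale matrix_vector_right_distrib)
  ultimately show ?case using y(1) by (intro bexI[of _ ?x] bexI[of _ y] allI)
qed

lemma factored_recursion_unique:
  fixes d :: "int \<Rightarrow> complex^'n"
  assumes d: "d \<in> ell2" "\<And>t. d (t + 1) = C *v d t"
  shows "(\<And>l. l \<in> set ls \<Longrightarrow> cmod l \<noteq> 1) \<Longrightarrow> (\<And>t. factor_product C ls (d t) = 0) \<Longrightarrow> d t = 0"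
proof (induction ls)
  case (Cons l ls)
  have "factor_product C ls (d t) = 0" for t
  proof (rule scalar_recursion_unique[of l "\<lambda>t. factor_product C ls (d t)"])
    show "(\<lambda>t. factor_product C ls (d t)) \<in> ell2"
      by (rule ell2_bounded_linear[OF factor_product_bounded_linear d(1)])
    show "factor_product C ls (d (t + 1)) = l *s factor_product C ls (d t)" for t
      using Cons.prems(2)[of t] by (simp add: d(2) factor_product_commute)
  qed (use Cons.prems in simp)
  then show ?case using Cons by simp
qed simp

lemma ell2_solution_exists:
  fixes A :: "real^'n^'n"
  assumes "circle_free A" and v: "v \<in> ell2"
  obtains x where "x \<in> ell2" "\<And>t. x (t + 1) = A *v x t + v t"
proof -
  obtain ls where ls: "\<forall>v. factor_product (cmat A) ls v = 0"
    "\<And>l. l \<in> set ls \<Longrightarrow> \<exists>v. v \<noteq> 0 \<and> cmat A *v v = l *s v"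
    by (rule real_matrix_annihilated_by_linear_factors) blast
  have "(\<lambda>t. cvec (v t)) \<in> ell2" by (rule ell2_dominated[OF v, of _ 1]) (simp add: norm_cvec)
  then obtain z where z: "z \<in> ell2" "\<And>t. z (t + 1) = cmat A *v z t + cvec (v t)"
    using factored_recursion_solvable[of "\<lambda>t. cvec (v t)" ls "cmat A"] ls assms(1)
    by (auto simp: circle_free_def)
  have "(\<lambda>t. rvec (z t)) \<in> ell2" by (rule ell2_dominated[OF z(1), of _ 1]) (simp add: norm_rvec_le)
  then show thesis
    by (rule that) (simp add: z(2) rvec_add rvec_cmat)
qed

lemma ell2_solution_unique:
  fixes A :: "real^'n^'n"
  assumes "circle_free A" and x: "x \<in> ell2" "\<And>t. x (t + 1) = A *v x t + v t"
    and y: "y \<in> ell2" "\<And>t. y (t + 1) = A *v y t + v t"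
  shows "x = y"
proof
  fix t
  obtain ls where ls: "\<forall>v. factor_product (cmat A) ls v = 0"
    "\<And>l. l \<in> set ls \<Longrightarrow> \<exists>v. v \<noteq> 0 \<and> cmat A *v v = l *s v"
    by (rule real_matrix_annihilated_by_linear_factors) blast
  have "(\<lambda>t. x t - y t) \<in> ell2" by (rule ell2_diff[OF x(1) y(1)])
  then have "(\<lambda>t. cvec (x t - y t)) \<in> ell2" by (rule ell2_dominated[of _ _ 1]) (simp add: norm_cvec)
  then have "cvec (x t - y t) = 0"
    by (rule factored_recursion_unique[where C = "cmat A" and ls = ls])
      (use ls assms(1) in \<open>auto simp: circle_free_def cmat_cvec x(2) y(2) matrix_vector_mult_diff_distrib\<close>)
  then show "x t = y t" by simp
qed

lemma complex_mat_vector: "mat l *v w = l *s w" for w :: "complex^'n"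
  by (simp add: vec_eq_iff mat_def matrix_vector_mult_def if_distrib[where f="\<lambda>x. x * _"] cong: if_cong)

text \<open>Backward recursions run with the transposed matrix, so both eigenvalue conditions have to survive
transposition.\<close>

lemma eigenvalue_transpose:
  fixes A :: "real^'n^'n"
  assumes v: "v \<noteq> 0" "cmat (transpose A) *v v = l *s v"
  obtains w where "w \<noteq> 0" "cmat A *v w = l *s w"
proof -
  let ?D = "mat l - cmat A"
  have tr: "transpose ?D = mat l - cmat (transpose A)"
    by (simp add: vec_eq_iff transpose_def mat_def map_matrix_def)
  have "transpose ?D *v v = 0"
    by (simp add: tr matrix_vector_mult_diff_rdistrib complex_mat_vector v)
  then have "\<not> invertible (transpose ?D)"
    using v(1) by (metis invertible_def matrix_left_invertible_ker)
  then have "\<not> invertible ?D"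
    by (metis invertible_def invertible_left_inverse left_invertible_transpose)
  then obtain w where "w \<noteq> 0" "?D *v w = 0"
    by (metis invertible_left_inverse matrix_left_invertible_ker)
  then show thesis
    using that[of w] by (simp add: matrix_vector_mult_diff_rdistrib complex_mat_vector)
qed

lemma circle_free_transpose:
  fixes A :: "real^'n^'n"
  assumes "circle_free A"
  shows "circle_free (transpose A)"
  using assms unfolding circle_free_def by (metis eigenvalue_transpose)

lemma schur_stable_transpose:
  fixes A :: "real^'n^'n"
  assumes "schur_stable A"
  shows "schur_stable (transpose A)"
  using assms unfolding schur_stable_def by (metis eigenvalue_transpose)

section \<open>Summation by parts and causality\<close>

lemma ell2_inner_summable:
  assumes "x \<in> ell2" "y \<in> ell2"
  shows "(\<lambda>t. x t \<bullet> y t) summable_on UNIV"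
proof -
  have "(\<lambda>t. norm (x t \<bullet> y t)) summable_on UNIV"
  proof (rule summable_on_comparison_test)
    show "(\<lambda>t. (norm (x t))\<^sup>2 + (norm (y t))\<^sup>2) summable_on UNIV"
      using assms unfolding ell2_summable by (rule summable_on_add)
    show "norm (x t \<bullet> y t) \<le> (norm (x t))\<^sup>2 + (norm (y t))\<^sup>2" for t
    proof -
      have "norm (x t \<bullet> y t) \<le> norm (x t) * norm (y t)"
        by (simp add: Cauchy_Schwarz_ineq2)
      also have "\<dots> \<le> (norm (x t))\<^sup>2 + (norm (y t))\<^sup>2"
        using sum_squares_bound[of "norm (x t)" "norm (y t)"]
          mult_nonneg_nonneg[OF norm_ge_zero[of "x t"] norm_ge_zero[of "y t"]] by linarith
      finally show ?thesis .
    qed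
  qed simp
  then show ?thesis by (rule abs_summable_summable)
qed

lemma infsum_shift: "(\<Sum>\<^sub>\<infinity>t. h (t + k)) = (\<Sum>\<^sub>\<infinity>t::int. h t)" for h :: "int \<Rightarrow> real"
  by (rule infsum_reindex_bij_betw[OF bij_int_shift])

text \<open>All energy identities below are summed in this way: a pointwise identity up to the increment of a
storage function \<open>h\<close>.\<close>

lemma infsum_telescope:
  fixes c E h :: "int \<Rightarrow> real"
  assumes "E summable_on UNIV" "h summable_on UNIV" "\<And>t. c t = E t + (h (t + 1) - h t)"
  shows "infsum c UNIV = infsum E UNIV" "c summable_on UNIV"
proof -
  have h': "(\<lambda>t. h (t + 1)) summable_on UNIV"
    using assms(2) by (simp add: summable_on_reindex_bij_betw[OF bij_int_shift])
  have "((\<lambda>t. h (t + 1) + - h t) has_sum (infsum h UNIV + - infsum h UNIV)) UNIV"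
    using has_sum_infsum[OF h'] has_sum_infsum[OF assms(2)]
    by (intro has_sum_add) (simp_all add: has_sum_uminus infsum_shift)
  then have "((\<lambda>t. h (t + 1) - h t) has_sum 0) UNIV" by simp
  then have diff: "(\<lambda>t. h (t + 1) - h t) summable_on UNIV" "(\<Sum>\<^sub>\<infinity>t. h (t + 1) - h t) = 0"
    by (auto simp: summable_on_def infsumI)
  have c: "c = (\<lambda>t. E t + (h (t + 1) - h t))" using assms(3) by blast
  show "infsum c UNIV = infsum E UNIV"
    using infsum_add[OF assms(1) diff(1)] diff(2) by (simp add: c)
  show "c summable_on UNIV"
    using summable_on_add[OF assms(1) diff(1)] by (simp add: c)
qed

lemma ell2_response_eqI:
  assumes "circle_free A" "v \<in> ell2" "x \<in> ell2" "\<And>t. x (t + 1) = A *v x t + v t"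
  shows "ell2_response A v = x"
  unfolding ell2_response_def
  by (rule the_equality) (use assms ell2_solution_unique[OF assms(1)] in blast)+

lemma ell2_response:
  assumes "circle_free A" "v \<in> ell2"
  shows "ell2_response A v \<in> ell2" "ell2_response A v (t + 1) = A *v ell2_response A v t + v t"
proof -
  obtain x where "x \<in> ell2" "\<And>t. x (t + 1) = A *v x t + v t"
    using ell2_solution_exists[OF assms] by blast
  with ell2_response_eqI[OF assms this]
  show "ell2_response A v \<in> ell2" "ell2_response A v (t + 1) = A *v ell2_response A v t + v t"
    by auto
qed

lemma ell2_response_linear:
  assumes A: "circle_free A" and "v \<in> ell2" "w \<in> ell2"
  shows "ell2_response A (\<lambda>t. a *\<^sub>R v t + b *\<^sub>R w t) =
    (\<lambda>t. a *\<^sub>R ell2_response A v t + b *\<^sub>R ell2_response A w t)"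
  using assms
  by (intro ell2_response_eqI[OF A])
    (auto intro!: ell2_add ell2_scaleR
      simp: ell2_response matrix_vector_right_distrib matrix_vector_mult_scaleR algebra_simps)

text \<open>The difference of two solutions at \<open>t\<close> is \<open>A ^ k\<close> applied to a bounded difference \<open>k\<close> steps
earlier, for every \<open>k\<close>. This is the source of all causality statements: square summability replaces
the initial condition.\<close>

lemma stable_solutions_agree:
  fixes A :: "real^'n^'n"
  assumes A: "schur_stable A" and x: "x \<in> ell2" and y: "y \<in> ell2"
    and rec: "\<And>t. t < t0 \<Longrightarrow> x (t + 1) - y (t + 1) = A *v (x t - y t)"
  shows "t \<le> t0 \<Longrightarrow> x t = y t"
proof -
  assume t: "t \<le> t0"
  define d where "d t = x t - y t" for t
  have "d \<in> ell2" unfolding d_def by (rule ell2_diff[OF x y])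
  then obtain B where B: "B \<ge> 0" "\<And>t. norm (d t) \<le> B" using ell2_bounded by blast
  obtain K \<rho> where K: "K \<ge> 0" "0 < \<rho>" "\<rho> < 1"
    "\<And>k v. norm ((((*v) A) ^^ k) v) \<le> K * \<rho> ^ k * norm v"
    using schur_stable_power_bound[OF A] by blast
  have pow: "d t = (((*v) A) ^^ k) (d (t - int k))" for k
  proof -
    have "j \<le> k \<Longrightarrow> d (t - int k + int j) = (((*v) A) ^^ j) (d (t - int k))" for j
    proof (induction j)
      case (Suc j)
      then show ?case using rec[of "t - int k + int j"] t
        by (simp add: d_def algebra_simps)
    qed simp
    from this[of k] show ?thesis by simp
  qed
  have "norm (d t) \<le> K * B * \<rho> ^ k" for k
  proof -
    have "norm (d t) \<le> K * \<rho> ^ k * norm (d (t - int k))" by (subst pow[of k]) (rule K(4))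
    also have "\<dots> \<le> K * \<rho> ^ k * B" using K B by (intro mult_left_mono) auto
    finally show ?thesis by (simp add: mult_ac)
  qed
  moreover have "(\<lambda>k. K * B * \<rho> ^ k) \<longlonglongrightarrow> K * B * 0"
    using K by (intro tendsto_mult tendsto_const LIMSEQ_power_zero) simp
  ultimately have "norm (d t) \<le> 0" using LIMSEQ_le_const by force
  then show "x t = y t" by (simp add: d_def)
qed

lemma ell2_response_causal:
  fixes A :: "real^'n^'n"
  assumes A: "schur_stable A" and "v \<in> ell2" "w \<in> ell2" and eq: "\<And>i. i < t \<Longrightarrow> v i = w i"
  shows "ell2_response A v t = ell2_response A w t"
proof (rule stable_solutions_agree[OF A, where ?t0.0 = t])
  note cf = schur_stable_imp_circle_free[OF A]
  show "ell2_response A v \<in> ell2" "ell2_response A w \<in> ell2"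
    using ell2_response[OF cf] assms by auto
  fix s assume "s < t"
  then show "ell2_response A v (s + 1) - ell2_response A w (s + 1) =
    A *v (ell2_response A v s - ell2_response A w s)"
    using ell2_response(2)[OF cf] assms eq by (simp add: matrix_vector_mult_diff_distrib)
qed simp

text \<open>Costates and anticausal signals solve the transposed recursion in reversed time.\<close>

lemma backward_solution_exists:
  fixes A :: "real^'n^'n"
  assumes "circle_free A" and v: "v \<in> ell2"
  obtains s where "s \<in> ell2" "\<And>t. s t = transpose A *v s (t + 1) + v t"
proof -
  obtain z where z: "z \<in> ell2" "\<And>t. z (t + 1) = transpose A *v z t + v (-1 - t)"
    using ell2_solution_exists[OF circle_free_transpose[OF assms(1)] ell2_reflect[OF v]] by blast
  have "(\<lambda>t. z (0 - t)) \<in> ell2" by (rule ell2_reflect[OF z(1)])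
  moreover have "z (0 - t) = transpose A *v z (0 - (t + 1)) + v t" for t
    using z(2)[of "0 - (t + 1)"] by simp
  ultimately show thesis by (rule that)
qed

lemma backward_solution_unique:
  fixes A :: "real^'n^'n"
  assumes "circle_free A" and x: "x \<in> ell2" "\<And>t. x t = transpose A *v x (t + 1) + v t"
    and y: "y \<in> ell2" "\<And>t. y t = transpose A *v y (t + 1) + v t"
  shows "x = y"
proof -
  have shift: "(-1 - t) + 1 = 0 - t" "-1 - t = 0 - (t + 1)" for t :: int by simp_all
  have "(\<lambda>t. x (0 - t)) = (\<lambda>t. y (0 - t))"
  proof (rule ell2_solution_unique[OF circle_free_transpose[OF assms(1)], where v = "\<lambda>t. v (-1 - t)"])
    show "(\<lambda>t. x (0 - t)) \<in> ell2" "(\<lambda>t. y (0 - t)) \<in> ell2"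
      using x(1) y(1) by (simp_all only: ell2_reflect)
    show "x (0 - (t + 1)) = transpose A *v x (0 - t) + v (- 1 - t)" for t
      using x(2)[of "-1 - t"] by (simp only: shift(1) shift(2)[symmetric])
    show "y (0 - (t + 1)) = transpose A *v y (0 - t) + v (- 1 - t)" for t
      using y(2)[of "-1 - t"] by (simp only: shift(1) shift(2)[symmetric])
  qed
  then have "x (0 - (0 - t)) = y (0 - (0 - t))" for t by metis
  then show ?thesis by auto
qed

section \<open>Lyapunov equations\<close>

lemma schur_stable_quadratic_tendsto:
  fixes A M :: "real^'n^'n"
  assumes "schur_stable A"
  shows "(\<lambda>k. (((*v) A) ^^ k) x \<bullet> (M *v (((*v) A) ^^ k) y)) \<longlonglongrightarrow> 0"
proof -
  obtain K \<rho> where K: "K \<ge> 0" "0 < \<rho>" "\<rho> < 1"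
    "\<And>k v. norm ((((*v) A) ^^ k) v) \<le> K * \<rho> ^ k * norm v"
    using schur_stable_power_bound[OF assms] by blast
  have pow: "(\<lambda>k. (((*v) A) ^^ k) v) \<longlonglongrightarrow> 0" for v
  proof (rule Lim_null_comparison)
    show "\<forall>\<^sub>F k in sequentially. norm ((((*v) A) ^^ k) v) \<le> K * \<rho> ^ k * norm v"
      using K by simp
    have "(\<lambda>k. K * \<rho> ^ k * norm v) \<longlonglongrightarrow> K * 0 * norm v"
      using K by (intro tendsto_mult tendsto_const LIMSEQ_power_zero) simp
    then show "(\<lambda>k. K * \<rho> ^ k * norm v) \<longlonglongrightarrow> 0" by simp
  qed
  have "(\<lambda>k. M *v (((*v) A) ^^ k) y) \<longlonglongrightarrow> M *v 0"
    by (rule bounded_linear.tendsto[OF matrix_vector_mul_bounded_linear pow])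
  from tendsto_inner[OF pow this] show ?thesis by simp
qed

text \<open>The form of \<open>X - Y\<close> is invariant under \<open>A\<close>, and it tends to 0 along every orbit.\<close>

lemma lyapunov_unique:
  fixes A X Y :: "real^'n^'n"
  assumes A: "schur_stable A"
    and X: "X = transpose A ** X ** A + C" and Y: "Y = transpose A ** Y ** A + C"
  shows "X = Y"
proof (rule matrix_eqI)
  fix y
  have step: "x \<bullet> ((X - Y) *v y) = (A *v x) \<bullet> ((X - Y) *v (A *v y))" for x y
  proof -
    have "X - Y = transpose A ** (X - Y) ** A"
      by (subst X, subst Y) (simp add: matrix_eq matrix_vector_mul_assoc[symmetric]
          matrix_vector_mult_diff_rdistrib matrix_vector_mult_add_rdistrib matrix_vector_mult_diff_distrib)
    then have "x \<bullet> ((X - Y) *v y) = x \<bullet> (transpose A *v ((X - Y) *v (A *v y)))"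
      by (metis matrix_vector_mul_assoc)
    then show ?thesis by (simp add: inner_matrix_left)
  qed
  have "x \<bullet> ((X - Y) *v y) = 0" for x
  proof -
    have iter: "(((*v) A) ^^ k) x \<bullet> ((X - Y) *v (((*v) A) ^^ k) y) = x \<bullet> ((X - Y) *v y)" for k
      by (induction k) (simp_all add: step[symmetric])
    have "(\<lambda>k. x \<bullet> ((X - Y) *v y)) \<longlonglongrightarrow> 0"
      using schur_stable_quadratic_tendsto[OF A, of x "X - Y" y] unfolding iter .
    then show ?thesis by (simp add: LIMSEQ_const_iff)
  qed
  from this[of "(X - Y) *v y"] show "X *v y = Y *v y"
    by (simp add: matrix_vector_mult_diff_rdistrib)
qed

text \<open>Symmetry follows from uniqueness, as the transpose solves the same equation. The form decreases
along orbits, with limit 0.\<close>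

lemma lyapunov_pos_semidef:
  fixes A X C :: "real^'n^'n"
  assumes A: "schur_stable A" and X: "X = transpose A ** X ** A + C" and C: "pos_semidef C"
  shows "pos_semidef X"
proof -
  have "transpose X = transpose (transpose A ** X ** A + C)" using X by simp
  also have "\<dots> = transpose A ** transpose X ** A + C"
    using pos_semidefD(1)[OF C] by (simp add: transpose_add matrix_transpose_mul matrix_mul_assoc)
  finally have "transpose X = X" using lyapunov_unique[OF A _ X] by blast
  moreover have "0 \<le> x \<bullet> (X *v x)" for x
  proof -
    have step: "(A *v x) \<bullet> (X *v (A *v x)) \<le> x \<bullet> (X *v x)" for x
    proof -
      have "x \<bullet> (X *v x) = x \<bullet> (transpose A *v (X *v (A *v x))) + x \<bullet> (C *v x)"
        by (subst X) (simp add: matrix_vector_mul_assoc matrix_mul_assoc matrix_vector_mult_add_rdistrib inner_add_right)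
      then show ?thesis using pos_semidefD(2)[OF C, of x] by (simp add: inner_matrix_left)
    qed
    have "(((*v) A) ^^ k) x \<bullet> (X *v (((*v) A) ^^ k) x) \<le> x \<bullet> (X *v x)" for k
    proof (induction k)
      case (Suc k)
      then show ?case using step[of "(((*v) A) ^^ k) x"] by simp
    qed simp
    then show ?thesis
      using LIMSEQ_le_const2[OF schur_stable_quadratic_tendsto[OF A, of x X x]] by blast
  qed
  ultimately show ?thesis by (simp add: pos_semidef_def)
qed

section \<open>The largest eigenvalue of a product of semidefinite matrices\<close>

lemma pos_semidef_cauchy_schwarz:
  assumes M: "pos_semidef M"
  shows "(x \<bullet> (M *v y))\<^sup>2 \<le> (x \<bullet> (M *v x)) * (y \<bullet> (M *v y))"
proof (cases "y \<bullet> (M *v y) = 0")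
  case True
  then show ?thesis using pos_semidef_kernel[OF M True] by simp
next
  case False
  then have p: "y \<bullet> (M *v y) > 0" using pos_semidefD(2)[OF M, of y] by simp
  define t where "t = (x \<bullet> (M *v y)) / (y \<bullet> (M *v y))"
  have c: "y \<bullet> (M *v x) = x \<bullet> (M *v y)"
    using symmetric_inner[OF pos_semidefD(1)[OF M], of y x] by (simp add: inner_commute)
  have "0 \<le> (x - t *\<^sub>R y) \<bullet> (M *v (x - t *\<^sub>R y))" by (rule pos_semidefD(2)[OF M])
  also have "\<dots> = x \<bullet> (M *v x) - 2 * t * (x \<bullet> (M *v y)) + t * (t * (y \<bullet> (M *v y)))"
    by (simp add: inner_diff_left inner_diff_right matrix_vector_mult_diff_distrib
        matrix_vector_mult_scaleR c algebra_simps)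
  also have "t * (y \<bullet> (M *v y)) = x \<bullet> (M *v y)" using p by (simp add: t_def)
  finally have "t * (x \<bullet> (M *v y)) \<le> x \<bullet> (M *v x)" by simp
  then show ?thesis using p by (simp add: t_def power2_eq_square pos_divide_le_eq)
qed

text \<open>With \<open>S\<close> the square root of \<open>Z\<close>, the product \<open>Z P\<close> has the same nonzero eigenvalues as the symmetric
matrix \<open>S P S\<close>, whose Rayleigh maximum \<open>l\<close> yields the inequality \<open>Z P Z \<le> l Z\<close> by
congruence with \<open>S\<close>. The companion \<open>P Z P \<le> l P\<close> follows by the Cauchy-Schwarz inequality for the
form of \<open>P\<close>.\<close>

lemma lambda_max_product:
  fixes Z P :: "real^'n^'n"
  assumes Z: "pos_semidef Z" and P: "pos_semidef P"
  shows lambda_max_product_nonneg: "0 \<le> lambda_max (Z ** P)"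
    and lambda_max_product_eigenvector:
      "\<exists>\<eta>. \<eta> \<noteq> 0 \<and> Z *v (P *v \<eta>) = lambda_max (Z ** P) *\<^sub>R \<eta>"
    and lambda_max_product_bound:
      "(Z *v x) \<bullet> (P *v (Z *v x)) \<le> lambda_max (Z ** P) * (x \<bullet> (Z *v x))"
    and lambda_max_product_bound':
      "(P *v x) \<bullet> (Z *v (P *v x)) \<le> lambda_max (Z ** P) * (x \<bullet> (P *v x))"
proof -
  let ?S = "msqrt Z"
  note S = msqrt_properties[OF Z]
  have SS: "?S *v (?S *v x) = Z *v x" for x by (simp add: matrix_vector_mul_assoc S)
  let ?C = "?S ** P ** ?S"
  have C: "?C *v x = ?S *v (P *v (?S *v x))" for x
    by (simp add: matrix_vector_mul_assoc matrix_mul_assoc)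
  have Cq: "x \<bullet> (?C *v y) = (?S *v x) \<bullet> (P *v (?S *v y))" for x y
    by (simp add: C inner_matrix_left S)
  have "transpose ?C = ?C"
    by (simp add: matrix_transpose_mul S pos_semidefD(1)[OF P] matrix_mul_assoc)
  then obtain b l where b: "norm b = 1" "?C *v b = l *\<^sub>R b"
    and max: "\<And>x. x \<bullet> (?C *v x) \<le> l * (x \<bullet> x)"
    using rayleigh_maximum[of ?C UNIV] by (metis UNIV_I UNIV_not_singleton subspace_UNIV)
  have "b \<bullet> (?C *v b) = l" using b by (simp add: dot_square_norm)
  then have l: "l \<ge> 0" using Cq[of b b] pos_semidefD(2)[OF P, of "?S *v b"] by simp
  have bound: "(Z *v x) \<bullet> (P *v (Z *v x)) \<le> l * (x \<bullet> (Z *v x))" for x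
  proof -
    have "(Z *v x) \<bullet> (P *v (Z *v x)) = (?S *v x) \<bullet> (?C *v (?S *v x))"
      by (simp add: Cq SS)
    also have "\<dots> \<le> l * ((?S *v x) \<bullet> (?S *v x))" by (rule max)
    also have "(?S *v x) \<bullet> (?S *v x) = x \<bullet> (Z *v x)"
      by (simp add: inner_matrix_left S SS)
    finally show ?thesis .
  qed
  have bound': "(P *v x) \<bullet> (Z *v (P *v x)) \<le> l * (x \<bullet> (P *v x))" for x
  proof -
    define u where "u = (P *v x) \<bullet> (Z *v (P *v x))"
    have u: "u \<ge> 0" unfolding u_def by (rule pos_semidefD(2)[OF Z])
    have "u = x \<bullet> (P *v (Z *v (P *v x)))"
      by (simp add: u_def inner_matrix_left pos_semidefD(1)[OF P])
    then have "u\<^sup>2 \<le> (x \<bullet> (P *v x)) * ((Z *v (P *v x)) \<bullet> (P *v (Z *v (P *v x))))"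
      using pos_semidef_cauchy_schwarz[OF P] by simp
    also have "\<dots> \<le> (x \<bullet> (P *v x)) * (l * u)"
      unfolding u_def by (intro mult_left_mono bound pos_semidefD(2)[OF P])
    finally have "u * u \<le> (l * (x \<bullet> (P *v x))) * u" by (simp add: power2_eq_square mult_ac)
    then have "u \<le> l * (x \<bullet> (P *v x))"
      using u l pos_semidefD(2)[OF P, of x]
      by (cases "u = 0") (auto simp: mult_le_cancel_right)
    then show ?thesis by (simp add: u_def)
  qed
  have ev: "\<exists>\<eta>. \<eta> \<noteq> 0 \<and> Z *v (P *v \<eta>) = l *\<^sub>R \<eta>"
  proof (cases "l = 0")
    case False
    have "Z *v (P *v (?S *v b)) = ?S *v (?C *v b)" by (simp add: C SS)
    then have "Z *v (P *v (?S *v b)) = l *\<^sub>R (?S *v b)" by (simp add: b matrix_vector_mult_scaleR)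
    moreover have "?S *v b \<noteq> 0"
    proof
      assume "?S *v b = 0"
      then have "?C *v b = 0" by (simp add: C)
      then show False using b False by auto
    qed
    ultimately show ?thesis by blast
  next
    \<comment> \<open>For \<open>l = 0\<close> the vector \<open>S b\<close> may vanish, but then \<open>P Z = 0\<close>, and any vector in the range of
      \<open>Z\<close> (or any vector at all, if \<open>Z = 0\<close>) is an eigenvector.\<close>
    case True
    have ZPZ: "P *v (Z *v x) = 0" for x
      using bound[of x] pos_semidefD(2)[OF P, of "Z *v x"] True pos_semidef_kernel[OF P] by simp
    show ?thesis
    proof (cases "\<exists>x. Z *v x \<noteq> 0")
      case True
      then obtain x where "Z *v x \<noteq> 0" ..
      then show ?thesis using ZPZ \<open>l = 0\<close> by (intro exI[of _ "Z *v x"]) simp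
    next
      case False
      then show ?thesis using b \<open>l = 0\<close> by (intro exI[of _ b]) auto
    qed
  qed
  have "lambda_max (Z ** P) = l"
    unfolding lambda_max_def
  proof (rule Max_eqI)
    show "finite {l. \<exists>v. v \<noteq> 0 \<and> (Z ** P) *v v = l *\<^sub>R v}" by (rule finite_real_eigenvalues)
    show "l \<in> {l. \<exists>v. v \<noteq> 0 \<and> (Z ** P) *v v = l *\<^sub>R v}"
      using ev by (simp add: matrix_vector_mul_assoc[symmetric])
    fix m assume "m \<in> {l. \<exists>v. v \<noteq> 0 \<and> (Z ** P) *v v = l *\<^sub>R v}"
    then obtain v where v: "v \<noteq> 0" "Z *v (P *v v) = m *\<^sub>R v"
      by (auto simp: matrix_vector_mul_assoc[symmetric])
    show "m \<le> l"
    proof (cases "m \<le> 0")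
      case False
      have "v \<bullet> (P *v v) \<noteq> 0"
      proof
        assume "v \<bullet> (P *v v) = 0"
        then have "P *v v = 0" by (rule pos_semidef_kernel[OF P])
        then show False using v False by auto
      qed
      then have "v \<bullet> (P *v v) > 0" using pos_semidefD(2)[OF P, of v] by simp
      moreover have "m * (v \<bullet> (P *v v)) \<le> l * (v \<bullet> (P *v v))"
        using bound'[of v] by (simp add: v inner_commute)
      ultimately show ?thesis by simp
    qed (use l in simp)
  qed
  then show "0 \<le> lambda_max (Z ** P)"
    "\<exists>\<eta>. \<eta> \<noteq> 0 \<and> Z *v (P *v \<eta>) = lambda_max (Z ** P) *\<^sub>R \<eta>"
    "(Z *v x) \<bullet> (P *v (Z *v x)) \<le> lambda_max (Z ** P) * (x \<bullet> (Z *v x))"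
    "(P *v x) \<bullet> (Z *v (P *v x)) \<le> lambda_max (Z ** P) * (x \<bullet> (P *v x))"
    using l ev bound bound' by simp_all
qed

section \<open>Inverses and congruences\<close>

lemma matrix_inv_mult:
  fixes M :: "real^'n^'n"
  assumes "invertible M"
  shows "M ** matrix_inv M = mat 1" "matrix_inv M ** M = mat 1"
  using someI_ex[OF assms[unfolded invertible_def]] by (auto simp: matrix_inv_def)

lemma matrix_inv_vector:
  fixes M :: "real^'n^'n"
  assumes "invertible M"
  shows "M *v (matrix_inv M *v x) = x" "matrix_inv M *v (M *v x) = x"
  by (simp_all add: matrix_vector_mul_assoc matrix_inv_mult[OF assms])

lemma invertibleI_kernel:
  fixes M :: "real^'n^'n"
  assumes "\<And>x. M *v x = 0 \<Longrightarrow> x = 0"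
  shows "invertible M"
  using assms by (metis invertible_left_inverse matrix_left_invertible_ker)

lemma pos_def_invertible: "pos_def W \<Longrightarrow> invertible W"
  unfolding pos_def_def by (rule invertibleI_kernel) (metis inner_zero_right less_irrefl)

lemma symmetric_matrix_inv:
  fixes M :: "real^'n^'n"
  assumes "transpose M = M" "invertible M"
  shows "transpose (matrix_inv M) = matrix_inv M"
proof (rule transpose_eqI)
  fix x y
  have "(matrix_inv M *v x) \<bullet> y = (matrix_inv M *v x) \<bullet> (M *v (matrix_inv M *v y))"
    by (simp add: matrix_inv_vector[OF assms(2)])
  also have "\<dots> = (M *v (matrix_inv M *v x)) \<bullet> (matrix_inv M *v y)"
    by (simp only: symmetric_inner[OF assms(1)])
  finally show "(matrix_inv M *v x) \<bullet> y = x \<bullet> (matrix_inv M *v y)"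
    by (simp add: matrix_inv_vector[OF assms(2)])
qed

lemma pos_def_matrix_inv_pos_semidef:
  assumes "pos_def W"
  shows "pos_semidef (matrix_inv W)"
proof -
  note inv = pos_def_invertible[OF assms]
  have "0 \<le> x \<bullet> (matrix_inv W *v x)" for x
  proof -
    have "x \<bullet> (matrix_inv W *v x) = (matrix_inv W *v x) \<bullet> (W *v (matrix_inv W *v x))"
      by (simp add: matrix_inv_vector[OF inv] inner_commute)
    then show ?thesis
      using pos_semidefD(2)[OF pos_def_imp_pos_semidef[OF assms], of "matrix_inv W *v x"] by simp
  qed
  then show ?thesis
    using symmetric_matrix_inv[OF _ inv] assms by (simp add: pos_semidef_def pos_def_def)
qed

lemma pos_semidef_congruence:
  fixes N :: "real^'m^'n"
  assumes "pos_semidef M"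
  shows "pos_semidef (N ** M ** transpose N)"
  unfolding pos_semidef_def
proof
  show "transpose (N ** M ** transpose N) = N ** M ** transpose N"
    by (simp add: matrix_transpose_mul pos_semidefD(1)[OF assms] matrix_mul_assoc)
  show "\<forall>x. 0 \<le> x \<bullet> (N ** M ** transpose N *v x)"
  proof
    fix x
    have "x \<bullet> (N ** M ** transpose N *v x) = (transpose N *v x) \<bullet> (M *v (transpose N *v x))"
      by (simp add: inner_matrix_left matrix_vector_mul_assoc matrix_mul_assoc)
    then show "0 \<le> x \<bullet> (N ** M ** transpose N *v x)"
      using pos_semidefD(2)[OF assms] by simp
  qed
qed

lemma ell2_single: "(\<lambda>t. if t = k then c else 0) \<in> ell2"
proof -
  have "(\<lambda>t. (norm (if t = k then c else 0))\<^sup>2) summable_on {k}" by simp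
  then show ?thesis
    unfolding ell2_summable
    by (rule summable_on_cong_neutral[THEN iffD1, rotated -1]) auto
qed

lemma has_sum_single: "((\<lambda>t. if t = k then c else 0) has_sum c) (UNIV::int set)" for c :: real
proof -
  have "((\<lambda>t. if t = k then c else 0) has_sum (\<Sum>t\<in>{k}. if t = k then c else 0)) {k}"
    by (rule has_sum_finite) simp
  then show ?thesis
    by (subst has_sum_cong_neutral[where T = "{k}" and g = "\<lambda>t. if t = k then c else 0"]) auto
qed

section \<open>The Nehari problem: Hankel operator and lower bound\<close>

text \<open>The anticausal system \<open>s t = a' s (t + 1) + N (e t)\<close> maps an input \<open>e\<close>, weighted by \<open>W\<close>, to an
output that is measured by the form of \<open>B0\<close>. \<open>Pi\<close> is the Gramian of the states \<open>s 0\<close> that are reachable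
from inputs on \<open>t \<ge> 0\<close>, and \<open>Z1\<close> is the Gramian of the output on \<open>t \<le> 0\<close> produced by \<open>s 0\<close>.\<close>

locale nehari =
  fixes a B0 Pi Z1 :: "real^'n^'n" and N :: "real^'m^'n" and W :: "real^'m^'m"
  assumes stable: "schur_stable a"
    and B0: "pos_semidef B0"
    and W: "pos_def W"
    and Pi_eq: "Pi = transpose a ** Pi ** a + N ** matrix_inv W ** transpose N"
    and Z1_eq: "Z1 = a ** Z1 ** transpose a + B0"
begin

abbreviation "a' \<equiv> transpose a"
abbreviation "N' \<equiv> transpose N"
abbreviation "Wi \<equiv> matrix_inv W"
abbreviation "lam \<equiv> lambda_max (Z1 ** Pi)"

lemmas circle_free = schur_stable_imp_circle_free[OF stable]
lemmas W_inv = matrix_inv_vector[OF pos_def_invertible[OF W]]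
lemmas W_psd = pos_def_imp_pos_semidef[OF W]
lemmas Wi_psd = pos_def_matrix_inv_pos_semidef[OF W]

lemma Pi_psd: "pos_semidef Pi"
  by (rule lyapunov_pos_semidef[OF stable Pi_eq]) (rule pos_semidef_congruence[OF Wi_psd])

lemma Z1_psd: "pos_semidef Z1"
  by (rule lyapunov_pos_semidef[OF schur_stable_transpose[OF stable] _ B0]) (use Z1_eq in simp)

lemma Pi_vec: "Pi *v x = a' *v (Pi *v (a *v x)) + N *v (Wi *v (N' *v x))"
  by (subst Pi_eq)
    (simp add: matrix_vector_mult_add_rdistrib matrix_vector_mul_assoc matrix_mul_assoc)

lemma Z1_vec: "Z1 *v x = a *v (Z1 *v (a' *v x)) + B0 *v x"
  by (subst Z1_eq)
    (simp add: matrix_vector_mult_add_rdistrib matrix_vector_mul_assoc matrix_mul_assoc)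

lemma Pi_energy: "x \<bullet> (Pi *v y) = (a *v x) \<bullet> (Pi *v (a *v y)) + (N' *v x) \<bullet> (Wi *v (N' *v y))"
  by (subst Pi_vec) (simp add: inner_add_right inner_matrix_left)

lemma Z1_energy: "x \<bullet> (Z1 *v y) = (a' *v x) \<bullet> (Z1 *v (a' *v y)) + x \<bullet> (B0 *v y)"
  by (subst Z1_vec) (simp add: inner_add_right inner_matrix_left)

text \<open>The input of least energy that reaches \<open>s 0 = Pi \<eta>\<close> is \<open>e t = W\<^sup>-\<^sup>1 N' a\<^sup>t \<eta>\<close> for \<open>t \<ge> 0\<close>, with
energy \<open>\<eta> \<bullet> Pi \<eta>\<close>. The output energy up to time 0 is \<open>Pi \<eta> \<bullet> Z1 (Pi \<eta>)\<close>, which is \<open>lam\<close> times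
the input energy if \<open>\<eta>\<close> is an eigenvector of \<open>Z1 Pi\<close>.\<close>

lemma hankel_norm_attained:
  obtains e s where "e \<in> ell2" "s \<in> ell2" "\<And>t. t < 0 \<Longrightarrow> e t = 0"
    "\<And>t. s t = a' *v s (t + 1) + N *v e t"
    "(\<lambda>t. if t \<le> 0 then s t \<bullet> (B0 *v s t) else 0) summable_on UNIV"
    "(\<Sum>\<^sub>\<infinity>t. if t \<le> 0 then s t \<bullet> (B0 *v s t) else 0) = lam * (\<Sum>\<^sub>\<infinity>t. e t \<bullet> (W *v e t))"
    "0 < lam \<Longrightarrow> \<exists>t. e t \<noteq> 0"
proof -
  obtain \<eta> where \<eta>: "\<eta> \<noteq> 0" "Z1 *v (Pi *v \<eta>) = lam *\<^sub>R \<eta>"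
    using lambda_max_product_eigenvector[OF Z1_psd Pi_psd] by blast
  have cf': "circle_free a'" by (rule circle_free_transpose[OF circle_free])
  \<comment> \<open>Impulse responses: \<open>z t = a ^ t \<eta>\<close> and \<open>y t = (a') ^ t (Pi \<eta>)\<close> for \<open>t \<ge> 0\<close>.\<close>
  define z where "z = ell2_response a (\<lambda>t. if t = -1 then \<eta> else 0)"
  define y where "y = ell2_response a' (\<lambda>t. if t = -1 then Pi *v \<eta> else 0)"
  have z: "z \<in> ell2" "\<And>t. z (t + 1) = a *v z t + (if t = -1 then \<eta> else 0)"
    unfolding z_def using ell2_response[OF circle_free ell2_single] by auto
  have y: "y \<in> ell2" "\<And>t. y (t + 1) = a' *v y t + (if t = -1 then Pi *v \<eta> else 0)"
    unfolding y_def using ell2_response[OF cf' ell2_single] by auto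
  have z_neg: "z t = 0" if "t < 0" for t
    using stable_solutions_agree[OF stable z(1) ell2_zero, of "-1" t] z(2) that by simp
  have y_neg: "y t = 0" if "t < 0" for t
    using stable_solutions_agree[OF schur_stable_transpose[OF stable] y(1) ell2_zero, of "-1" t] y(2) that
    by simp
  have z0: "z 0 = \<eta>" and y0: "y 0 = Pi *v \<eta>"
    using z(2)[of "-1"] y(2)[of "-1"] z_neg[of "-1"] y_neg[of "-1"] by simp_all
  have z_step: "z (t + 1) = a *v z t" and y_step: "y (t + 1) = a' *v y t" if "t \<ge> 0" for t
    using z(2) y(2) that by simp_all
  define e where "e t = Wi *v (N' *v z t)" for t
  \<comment> \<open>The future and the past of \<open>s\<close> are glued at time 0, where both summands equal \<open>Pi \<eta>\<close>.\<close>
  define s where "s t = Pi *v z t + y (0 - t) - (if t = 0 then Pi *v \<eta> else 0)" for t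
  have s_pos: "s t = Pi *v z t" if "t \<ge> 0" for t
    using that y_neg[of "- t"] y0 by (cases "t = 0") (auto simp: s_def)
  have s_neg: "s t = y (- t)" if "t \<le> 0" for t
    using that z_neg[of t] z0 by (cases "t = 0") (auto simp: s_def)
  have e: "e \<in> ell2" unfolding e_def by (intro ell2_matrix z)
  have s: "s \<in> ell2" unfolding s_def
    by (intro ell2_diff ell2_add ell2_matrix z ell2_reflect y ell2_single)
  have e_neg: "e t = 0" if "t < 0" for t using z_neg[OF that] by (simp add: e_def)
  have s_rec: "s t = a' *v s (t + 1) + N *v e t" for t
  proof (cases "t \<ge> 0")
    case True
    then show ?thesis using Pi_vec[of "z t"] by (simp add: s_pos z_step e_def)
  next
    case False
    then show ?thesis using y_step[of "- t - 1"] by (simp add: s_neg e_neg)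
  qed
  have z_quad: "(\<lambda>t. z t \<bullet> (Pi *v z t)) summable_on UNIV"
    by (intro ell2_inner_summable ell2_matrix z)
  have energy: "(\<Sum>\<^sub>\<infinity>t. e t \<bullet> (W *v e t)) = \<eta> \<bullet> (Pi *v \<eta>)"
  proof -
    have "(\<Sum>\<^sub>\<infinity>t. e t \<bullet> (W *v e t)) = (\<Sum>\<^sub>\<infinity>t::int. if t = -1 then \<eta> \<bullet> (Pi *v \<eta>) else 0)"
    proof (rule infsum_telescope(1)[where h = "\<lambda>t. - (z t \<bullet> (Pi *v z t))"])
      show "e t \<bullet> (W *v e t) = (if t = - 1 then \<eta> \<bullet> (Pi *v \<eta>) else 0) +
        (- (z (t + 1) \<bullet> (Pi *v z (t + 1))) - - (z t \<bullet> (Pi *v z t)))" for t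
      proof (cases "t \<ge> 0")
        case True
        then show ?thesis
          using Pi_energy[of "z t" "z t"] by (simp add: e_def W_inv z_step inner_commute)
      next
        case False
        then show ?thesis
          using z_neg[of t] z_neg[of "t + 1"] z0 by (cases "t = -1") (auto simp: e_neg)
      qed
    qed (use has_sum_single z_quad in \<open>auto simp: summable_on_def summable_on_uminus intro: has_sum_uminusI\<close>)
    then show ?thesis using infsumI[OF has_sum_single] by metis
  qed
  define g where "g t = (if t \<le> 0 then (a' *v s t) \<bullet> (Z1 *v (a' *v s t)) else 0)" for t
  have g: "g summable_on UNIV"
  proof (rule summable_on_comparison_test)
    show "(\<lambda>t. (a' *v s t) \<bullet> (Z1 *v (a' *v s t))) summable_on UNIV"
      by (intro ell2_inner_summable ell2_matrix s)
  qed (use pos_semidefD(2)[OF Z1_psd] in \<open>auto simp: g_def\<close>)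
  let ?v = "(Pi *v \<eta>) \<bullet> (Z1 *v (Pi *v \<eta>))"
  have tel: "(if t \<le> 0 then s t \<bullet> (B0 *v s t) else 0) = (if t = 0 then ?v else 0) + (g (t + 1) - g t)" for t
  proof -
    consider "t > 0" | "t = 0" | "t < 0" by linarith
    then show ?thesis
    proof cases
      case 2
      then show ?thesis using Z1_energy[of "s 0" "s 0"] y0 by (simp add: g_def s_neg)
    next
      case 3
      then have "a' *v s (t + 1) = s t" using s_rec[of t] e_neg by simp
      then show ?thesis using 3 Z1_energy[of "s t" "s t"] by (simp add: g_def)
    qed (simp add: g_def)
  qed
  have single: "(\<lambda>t::int. if t = 0 then ?v else 0) summable_on UNIV"
    using has_sum_single summable_on_def by blast
  note sums = infsum_telescope[OF single g tel]
  have "(\<Sum>\<^sub>\<infinity>t. if t \<le> 0 then s t \<bullet> (B0 *v s t) else 0) = ?v"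
    using sums(1) infsumI[OF has_sum_single] by metis
  also have "\<dots> = lam * (\<eta> \<bullet> (Pi *v \<eta>))" by (simp add: \<eta> inner_commute)
  also have "\<eta> \<bullet> (Pi *v \<eta>) = (\<Sum>\<^sub>\<infinity>t. e t \<bullet> (W *v e t))" by (simp add: energy)
  finally have attained: "(\<Sum>\<^sub>\<infinity>t. if t \<le> 0 then s t \<bullet> (B0 *v s t) else 0) =
    lam * (\<Sum>\<^sub>\<infinity>t. e t \<bullet> (W *v e t))" .
  have nonzero: "\<exists>t. e t \<noteq> 0" if "lam > 0"
  proof (rule ccontr)
    assume "\<not> ?thesis"
    then have "\<eta> \<bullet> (Pi *v \<eta>) = 0" using energy by simp
    then have "Pi *v \<eta> = 0" by (rule pos_semidef_kernel[OF Pi_psd])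
    then show False using \<eta> that by auto
  qed
  show thesis by (rule that[OF e s e_neg s_rec sums(2) attained nonzero])
qed

end

section \<open>The Nehari problem: central controller\<close>

text \<open>A complex eigenvector \<open>x + \<i> y\<close> with eigenvalue \<open>\<alpha> + \<i> \<beta>\<close>, written in real terms, so that real
quadratic forms can be evaluated on it.\<close>

lemma schur_stableI_real_pairs:
  fixes A :: "real^'n^'n"
  assumes "\<And>\<alpha> \<beta> x y. A *v x = \<alpha> *\<^sub>R x - \<beta> *\<^sub>R y \<Longrightarrow> A *v y = \<beta> *\<^sub>R x + \<alpha> *\<^sub>R y \<Longrightarrow>
    1 \<le> \<alpha>\<^sup>2 + \<beta>\<^sup>2 \<Longrightarrow> x = 0 \<and> y = 0"
  shows "schur_stable A"
  unfolding schur_stable_def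
proof clarify
  fix l :: complex and v :: "complex^'n"
  assume v: "v \<noteq> 0" "cmat A *v v = l *s v"
  obtain x y where xy: "v = cvec x + \<i> *s cvec y" by (rule complex_vec_cases)
  have "cmat A *v v = cvec (A *v x) + \<i> *s cvec (A *v y)"
    by (simp add: xy matrix_vector_right_distrib complex_matrix_scale cmat_cvec)
  then have "A *v x = Re l *\<^sub>R x - Im l *\<^sub>R y" "A *v y = Im l *\<^sub>R x + Re l *\<^sub>R y"
    using v(2) by (auto simp: xy vec_eq_iff cvec_def complex_eq_iff)
  moreover have "\<not> (x = 0 \<and> y = 0)" using v(1) xy by (auto simp: vec_eq_iff cvec_def)
  ultimately have "(Re l)\<^sup>2 + (Im l)\<^sup>2 < 1" using assms by (meson not_le)
  then have "(cmod l)\<^sup>2 < 1" by (simp add: cmod_power2)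
  then show "cmod l < 1" by (metis norm_ge_zero power2_less_imp_less one_power2 zero_le_one)
qed

lemma schur_stable_real_pairs:
  fixes A :: "real^'n^'n"
  assumes "schur_stable A" "A *v x = \<alpha> *\<^sub>R x - \<beta> *\<^sub>R y" "A *v y = \<beta> *\<^sub>R x + \<alpha> *\<^sub>R y"
    "1 \<le> \<alpha>\<^sup>2 + \<beta>\<^sup>2"
  shows "x = 0 \<and> y = 0"
proof -
  let ?v = "cvec x + \<i> *s cvec y" and ?l = "Complex \<alpha> \<beta>"
  have "cmat A *v ?v = cvec (A *v x) + \<i> *s cvec (A *v y)"
    by (simp add: matrix_vector_right_distrib complex_matrix_scale cmat_cvec)
  also have "\<dots> = ?l *s ?v"
    by (simp add: assms vec_eq_iff cvec_def complex_eq_iff)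
  finally have "cmat A *v ?v = ?l *s ?v" .
  moreover have "\<not> cmod ?l < 1"
    using assms(4) by (simp add: complex_norm real_less_lsqrt)
  ultimately have "?v = 0" using assms(1) unfolding schur_stable_def by blast
  then show ?thesis by (auto simp: vec_eq_iff cvec_def complex_eq_iff)
qed

text \<open>The level \<open>g\<close> is the square of \<open>\<gamma>\<close>. The last assumption makes the gain of the controller well
defined; it follows from the others when \<open>g\<close> exceeds the largest eigenvalue (lemma
\<open>level_invertible_above\<close>) and is a genuine restriction when \<open>g\<close> is the largest eigenvalue.\<close>

locale nehari_level = nehari +
  fixes g :: real
  assumes g_pos: "0 < g" and g_ge: "lambda_max (Z1 ** Pi) \<le> g"
    and inv: "invertible (mat 1 - a ** ((1 / g) *\<^sub>R Z1) ** transpose a ** Pi)"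
begin

definition "Z = (1 / g) *\<^sub>R Z1"
definition "K = matrix_inv (mat 1 - a ** Z ** a' ** Pi) ** a ** Z ** N"
text \<open>\<open>K\<close> solves the fixed point equation \<open>K = a Z L\<close>, and \<open>L\<close> is the coefficient with which
\<open>f = e - W\<^sup>-\<^sup>1 N' z\<close> drives the error state \<open>d = s - Pi z\<close>, namely \<open>d t = a' d (t + 1) + L (f t)\<close>.
\<open>Om\<close> is the quadratic form of \<open>f\<close> by which the central controller stays below the level.\<close>

definition "L = N + a' ** Pi ** K"
definition "F = a - K ** Wi ** N'"
definition "Om = W + transpose K ** Pi ** K - transpose L ** Z ** L"
definition "storage d z = (a' *v d) \<bullet> (Z *v (a' *v d)) + 2 * (d \<bullet> z) + z \<bullet> (Pi *v z)"

lemma Z_vec: "Z *v x = (1 / g) *\<^sub>R (Z1 *v x)"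
  by (simp add: Z_def scaleR_matrix_vector_assoc)

lemma Z_psd: "pos_semidef Z"
  using Z1_psd g_pos by (simp add: Z_vec pos_semidef_def) (simp add: Z_def transpose_scalar)

lemma Z_energy: "x \<bullet> (B0 *v y) = g * (x \<bullet> (Z *v y) - (a' *v x) \<bullet> (Z *v (a' *v y)))"
  using Z1_energy[of x y] g_pos by (simp add: Z_vec right_diff_distrib)

lemma K_vec: "K *v f = a *v (Z *v (L *v f))"
proof -
  let ?D = "mat 1 - a ** Z ** a' ** Pi"
  have "?D *v (K *v f) = a *v (Z *v (N *v f))"
    using matrix_inv_vector(1)[OF inv[folded Z_def]]
    by (simp add: K_def matrix_vector_mul_assoc[symmetric] matrix_mul_assoc[symmetric])
  then have "K *v f = a *v (Z *v (a' *v (Pi *v (K *v f)))) + a *v (Z *v (N *v f))"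
    by (simp add: matrix_vector_mult_diff_rdistrib matrix_vector_mul_assoc[symmetric] algebra_simps)
  then show ?thesis
    by (simp add: L_def matrix_vector_mult_add_rdistrib matrix_vector_right_distrib
        matrix_vector_mul_assoc[symmetric] add.commute)
qed

lemma L_vec: "L *v f = N *v f + a' *v (Pi *v (K *v f))"
  by (simp add: L_def matrix_vector_mult_add_rdistrib matrix_vector_mul_assoc[symmetric])

lemma F_vec: "F *v z = a *v z - K *v (Wi *v (N' *v z))"
  by (simp add: F_def matrix_vector_mult_diff_rdistrib matrix_vector_mul_assoc[symmetric])

lemma Om_form: "x \<bullet> (Om *v y) = x \<bullet> (W *v y) + (K *v x) \<bullet> (Pi *v (K *v y)) - (L *v x) \<bullet> (Z *v (L *v y))"
  by (simp add: Om_def matrix_vector_mult_add_rdistrib matrix_vector_mult_diff_rdistrib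
      inner_add_right inner_diff_right inner_matrix_left matrix_vector_mul_assoc[symmetric])

lemma Om_form': "x \<bullet> (Om *v y) = x \<bullet> (W *v y) - (N *v x) \<bullet> (Z *v (L *v y))"
proof -
  have "(L *v x) \<bullet> (Z *v (L *v y)) = (N *v x) \<bullet> (Z *v (L *v y)) + (a' *v (Pi *v (K *v x))) \<bullet> (Z *v (L *v y))"
    by (simp only: L_vec[of x] inner_add_left)
  also have "(a' *v (Pi *v (K *v x))) \<bullet> (Z *v (L *v y)) = (Pi *v (K *v x)) \<bullet> (K *v y)"
    by (simp add: inner_matrix_left[of a'] K_vec)
  also have "\<dots> = (K *v x) \<bullet> (Pi *v (K *v y))"
    by (rule symmetric_inner[OF pos_semidefD(1)[OF Pi_psd]])
  finally show ?thesis by (simp add: Om_form)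
qed

lemma Om_symmetric: "transpose Om = Om"
proof (rule transpose_eqI)
  fix x y
  have "y \<bullet> (Om *v x) = x \<bullet> (Om *v y)"
    using symmetric_inner[OF pos_semidefD(1)[OF W_psd], of y x]
      symmetric_inner[OF pos_semidefD(1)[OF Pi_psd], of "K *v y" "K *v x"]
      symmetric_inner[OF pos_semidefD(1)[OF Z_psd], of "L *v y" "L *v x"]
    by (simp add: Om_form inner_commute)
  then show "(Om *v x) \<bullet> y = x \<bullet> (Om *v y)" by (simp add: inner_commute)
qed

text \<open>At a level not below the largest eigenvalue the Hankel operator is a contraction, in terms of
either Gramian.\<close>

lemma Z_Pi_bound: "(Z *v k) \<bullet> (Pi *v (Z *v k)) \<le> k \<bullet> (Z *v k)"
proof -
  have nonneg: "0 \<le> k \<bullet> (Z1 *v k)" by (rule pos_semidefD(2)[OF Z1_psd])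
  have "(Z1 *v k) \<bullet> (Pi *v (Z1 *v k)) \<le> lam * (k \<bullet> (Z1 *v k))"
    by (rule lambda_max_product_bound[OF Z1_psd Pi_psd])
  also have "\<dots> \<le> g * (k \<bullet> (Z1 *v k))" by (intro mult_right_mono g_ge nonneg)
  finally show ?thesis
    using g_pos by (simp add: Z_vec matrix_vector_mult_scaleR divide_simps power2_eq_square mult.commute)
qed

lemma Pi_Z_bound: "(Pi *v z) \<bullet> (Z *v (Pi *v z)) \<le> z \<bullet> (Pi *v z)"
proof -
  have "(Pi *v z) \<bullet> (Z1 *v (Pi *v z)) \<le> lam * (z \<bullet> (Pi *v z))"
    by (rule lambda_max_product_bound'[OF Z1_psd Pi_psd])
  also have "\<dots> \<le> g * (z \<bullet> (Pi *v z))"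
    by (intro mult_right_mono g_ge pos_semidefD(2)[OF Pi_psd])
  finally show ?thesis using g_pos by (simp add: Z_vec pos_divide_le_eq mult.commute)
qed

text \<open>For invertible matrices this is the Schur complement form of \<open>Z\<^sup>-\<^sup>1 \<ge> Pi\<close>. In general, put
\<open>k = L f\<close> and \<open>h = Z k\<close>. Then \<open>f \<bullet> Om f = f \<bullet> W f - c\<close> with \<open>c = N f \<bullet> h\<close>, the contraction
\<open>h \<bullet> Pi h \<le> k \<bullet> h\<close> says \<open>N' h \<bullet> W\<^sup>-\<^sup>1 N' h \<le> c\<close>, and the Cauchy-Schwarz inequality gives
\<open>c\<^sup>2 \<le> (f \<bullet> W f) c\<close>.\<close>

lemma Om_psd: "pos_semidef Om"
  unfolding pos_semidef_def
proof (intro conjI allI)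
  show "transpose Om = Om" by (rule Om_symmetric)
  fix f
  define k where "k = L *v f"
  define h where "h = Z *v k"
  define c where "c = (N *v f) \<bullet> h"
  define q where "q = (N' *v h) \<bullet> (Wi *v (N' *v h))"
  have Kf: "K *v f = a *v h" by (simp add: K_vec h_def k_def)
  have k: "k = N *v f + a' *v (Pi *v (a *v h))" unfolding k_def by (simp add: L_vec Kf)
  have "k \<bullet> h = c + (a *v h) \<bullet> (Pi *v (a *v h))"
    by (subst k) (simp add: c_def inner_add_left inner_add_right inner_matrix_left inner_commute)
  moreover have "h \<bullet> (Pi *v h) \<le> k \<bullet> h" unfolding h_def by (rule Z_Pi_bound)
  ultimately have cq: "q \<le> c" using Pi_energy[of h h] by (simp add: q_def)
  have q: "0 \<le> q" unfolding q_def by (rule pos_semidefD(2)[OF Wi_psd])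
  have c: "c = f \<bullet> (W *v (Wi *v (N' *v h)))" by (simp add: c_def W_inv inner_matrix_left)
  have "c\<^sup>2 \<le> (f \<bullet> (W *v f)) * ((Wi *v (N' *v h)) \<bullet> (W *v (Wi *v (N' *v h))))"
    unfolding c by (rule pos_semidef_cauchy_schwarz[OF W_psd])
  also have "(Wi *v (N' *v h)) \<bullet> (W *v (Wi *v (N' *v h))) = q"
    by (simp add: W_inv q_def inner_commute)
  also have "(f \<bullet> (W *v f)) * q \<le> (f \<bullet> (W *v f)) * c"
    by (intro mult_left_mono cq pos_semidefD(2)[OF W_psd])
  finally have "c * c \<le> (f \<bullet> (W *v f)) * c" by (simp add: power2_eq_square)
  then have "c \<le> f \<bullet> (W *v f)"
    using q cq pos_semidefD(2)[OF W_psd, of f] by (cases "c = 0") (auto simp: mult_le_cancel_right)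
  then show "0 \<le> f \<bullet> (Om *v f)" by (simp add: Om_form' c_def h_def k_def)
qed

text \<open>The Gramian equation of \<open>Z\<close> turns the output energy of \<open>d\<close> into an increment plus the product of
\<open>f\<close> and \<open>d1\<close>, which is \<open>d1 \<bullet> K f\<close> because \<open>K = a Z L\<close>. The increment of \<open>d \<bullet> z\<close> absorbs it and leaves
products of \<open>f\<close> and \<open>z\<close>, and the Gramian equation of \<open>Pi\<close> converts these into the energies of \<open>e\<close>
and \<open>f\<close>.\<close>

lemma dissipation:
  assumes d: "d = a' *v d1 + L *v f" and z1: "z1 = a *v z + K *v f"
    and e: "e = f + Wi *v (N' *v z)"
  shows "d \<bullet> (B0 *v d) = g * ((storage d1 z1 - storage d z) + e \<bullet> (W *v e) - f \<bullet> (Om *v f))"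
proof -
  note sZ = symmetric_inner[OF pos_semidefD(1)[OF Z_psd]]
  note sP = symmetric_inner[OF pos_semidefD(1)[OF Pi_psd]]
  note sW = symmetric_inner[OF pos_semidefD(1)[OF W_psd]]
  have c1: "(a' *v d1) \<bullet> (Z *v (L *v f)) = d1 \<bullet> (K *v f)"
    by (simp add: K_vec inner_matrix_left)
  moreover have "(L *v f) \<bullet> (Z *v (a' *v d1)) = (a' *v d1) \<bullet> (Z *v (L *v f))"
    using sZ[of "L *v f" "a' *v d1"] by (simp add: inner_commute)
  ultimately have h2: "d \<bullet> (Z *v d) = (a' *v d1) \<bullet> (Z *v (a' *v d1)) + 2 * (d1 \<bullet> (K *v f))
      + (L *v f) \<bullet> (Z *v (L *v f))"
    by (simp add: d matrix_vector_right_distrib inner_add_left inner_add_right)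
  have h3: "d1 \<bullet> (K *v f) = d1 \<bullet> z1 - d \<bullet> z + (L *v f) \<bullet> z"
    by (simp add: d z1 inner_add_left inner_add_right inner_matrix_left)
  have h4: "(L *v f) \<bullet> z = f \<bullet> (N' *v z) + (K *v f) \<bullet> (Pi *v (a *v z))"
    by (simp add: L_vec inner_add_left inner_matrix_left[of N] inner_matrix_left[of a'] sP)
  have "(a *v z) \<bullet> (Pi *v (K *v f)) = (K *v f) \<bullet> (Pi *v (a *v z))"
    using sP[of "a *v z" "K *v f"] by (simp add: inner_commute)
  then have h5: "z1 \<bullet> (Pi *v z1) = (a *v z) \<bullet> (Pi *v (a *v z)) + 2 * ((K *v f) \<bullet> (Pi *v (a *v z)))
      + (K *v f) \<bullet> (Pi *v (K *v f))"
    by (simp add: z1 matrix_vector_right_distrib inner_add_left inner_add_right)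
  have h6: "z \<bullet> (Pi *v z) = (a *v z) \<bullet> (Pi *v (a *v z)) + (N' *v z) \<bullet> (Wi *v (N' *v z))"
    by (rule Pi_energy)
  have "(Wi *v (N' *v z)) \<bullet> (W *v f) = f \<bullet> (N' *v z)"
    using sW[of "Wi *v (N' *v z)" f] by (simp add: W_inv inner_commute)
  then have h7: "e \<bullet> (W *v e) = f \<bullet> (W *v f) + 2 * (f \<bullet> (N' *v z)) + (N' *v z) \<bullet> (Wi *v (N' *v z))"
    by (simp add: e matrix_vector_right_distrib inner_add_left inner_add_right W_inv inner_commute)
  have "d \<bullet> (Z *v d) - (a' *v d) \<bullet> (Z *v (a' *v d)) =
      storage d1 z1 - storage d z + e \<bullet> (W *v e) - f \<bullet> (Om *v f)"
    unfolding storage_def Om_form using h2 h3 h4 h5 h6 h7 by linarith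
  then show ?thesis by (simp add: Z_energy)
qed

text \<open>The controller state \<open>z\<close> was chosen such that the error state \<open>d = s - Pi z\<close> solves the recursion of
\<open>dissipation\<close> with \<open>f = e - W\<^sup>-\<^sup>1 N' z\<close>.\<close>

lemma central_controller_bound:
  assumes e: "e \<in> ell2" and s: "s \<in> ell2" and z: "z \<in> ell2"
    and s_rec: "\<And>t. s t = a' *v s (t + 1) + N *v e t"
    and z_rec: "\<And>t. z (t + 1) = F *v z t + K *v e t"
  shows "(\<Sum>\<^sub>\<infinity>t. (s t - Pi *v z t) \<bullet> (B0 *v (s t - Pi *v z t))) \<le> g * (\<Sum>\<^sub>\<infinity>t. e t \<bullet> (W *v e t))"
proof -
  define d where "d t = s t - Pi *v z t" for t
  define f where "f t = e t - Wi *v (N' *v z t)" for t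
  have d: "d \<in> ell2" unfolding d_def by (intro ell2_diff ell2_matrix s z)
  have f: "f \<in> ell2" unfolding f_def by (intro ell2_diff ell2_matrix e z)
  have z_step: "z (t + 1) = a *v z t + K *v f t" for t
    by (simp add: z_rec F_vec f_def matrix_vector_mult_diff_distrib)
  have d_step: "d t = a' *v d (t + 1) + L *v f t" for t
    unfolding d_def by (subst s_rec, subst Pi_vec[of "z t"])
      (simp add: z_step L_vec matrix_vector_right_distrib matrix_vector_mult_diff_distrib,
       simp add: f_def matrix_vector_mult_diff_distrib)
  have eW: "(\<lambda>t. e t \<bullet> (W *v e t)) summable_on UNIV"
    by (intro ell2_inner_summable ell2_matrix e)
  have fOm: "(\<lambda>t. f t \<bullet> (Om *v f t)) summable_on UNIV"
    by (intro ell2_inner_summable ell2_matrix f)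
  have "(\<lambda>t. g * (e t \<bullet> (W *v e t)) + - g * (f t \<bullet> (Om *v f t))) summable_on UNIV"
    by (intro summable_on_add summable_on_cmult_right eW fOm)
  moreover have "(\<lambda>t. g * storage (d t) (z t)) summable_on UNIV"
    unfolding storage_def
    by (intro summable_on_add summable_on_cmult_right ell2_inner_summable ell2_matrix d z)
  moreover have "d t \<bullet> (B0 *v d t) = (g * (e t \<bullet> (W *v e t)) + - g * (f t \<bullet> (Om *v f t)))
      + (g * storage (d (t + 1)) (z (t + 1)) - g * storage (d t) (z t))" for t
    using dissipation[OF d_step z_step, of "e t" t] by (simp add: f_def algebra_simps)
  ultimately have "(\<Sum>\<^sub>\<infinity>t. d t \<bullet> (B0 *v d t)) =
      (\<Sum>\<^sub>\<infinity>t. g * (e t \<bullet> (W *v e t)) + - g * (f t \<bullet> (Om *v f t)))"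
    by (rule infsum_telescope(1))
  also have "\<dots> \<le> (\<Sum>\<^sub>\<infinity>t. g * (e t \<bullet> (W *v e t)))"
  proof (rule infsum_mono)
    show "(\<lambda>t. g * (e t \<bullet> (W *v e t)) + - g * (f t \<bullet> (Om *v f t))) summable_on UNIV"
      by (intro summable_on_add summable_on_cmult_right eW fOm)
    show "(\<lambda>t. g * (e t \<bullet> (W *v e t))) summable_on UNIV"
      by (intro summable_on_cmult_right eW)
    show "g * (e t \<bullet> (W *v e t)) + - g * (f t \<bullet> (Om *v f t)) \<le> g * (e t \<bullet> (W *v e t))" for t
      using pos_semidefD(2)[OF Om_psd, of "f t"] g_pos by simp
  qed
  also have "\<dots> = g * (\<Sum>\<^sub>\<infinity>t. e t \<bullet> (W *v e t))"
    by (rule infsum_cmult_right') 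
  finally show ?thesis by (simp add: d_def)
qed

text \<open>With \<open>e = 0\<close> and \<open>s = 0\<close> the dissipation identity says that the form \<open>Y\<close> of
\<open>Pi - Pi a Z a' Pi \<ge> 0\<close> decreases along \<open>F\<close> by \<open>c \<ge> 0\<close>. On an unstable eigenspace, spanned by
\<open>x\<close> and \<open>y\<close>, it cannot decrease, so \<open>c\<close> vanishes there: \<open>B0 Pi u = 0\<close> and \<open>Om (f u) = 0\<close>. These two
facts make \<open>D = I - Z Pi\<close> intertwine \<open>F\<close> on the eigenspace with the stable matrix \<open>a\<close>, so \<open>D\<close>
vanishes there. Since \<open>a Z a'\<close> and \<open>Z\<close> agree on the kernel of \<open>B0\<close>, a nonzero \<open>u\<close> would be in the
kernel of \<open>I - a Z a' Pi\<close>, which is invertible.\<close>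

lemma central_controller_stable: "schur_stable F"
proof (rule schur_stableI_real_pairs)
  fix \<alpha> \<beta> :: real and x y
  assume Fx: "F *v x = \<alpha> *\<^sub>R x - \<beta> *\<^sub>R y" and Fy: "F *v y = \<beta> *\<^sub>R x + \<alpha> *\<^sub>R y"
    and l: "1 \<le> \<alpha>\<^sup>2 + \<beta>\<^sup>2"
  note sP = symmetric_inner[OF pos_semidefD(1)[OF Pi_psd]]
  define f where "f u = - (Wi *v (N' *v u))" for u
  define Y where "Y u v = u \<bullet> (Pi *v v) - (a' *v (Pi *v u)) \<bullet> (Z *v (a' *v (Pi *v v)))" for u v
  define c where "c u = (Pi *v u) \<bullet> (B0 *v (Pi *v u)) / g + f u \<bullet> (Om *v f u)" for u
  have Y_nonneg: "0 \<le> Y u u" for u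
  proof -
    have "(a' *v (Pi *v u)) \<bullet> (Z *v (a' *v (Pi *v u))) \<le> (Pi *v u) \<bullet> (Z *v (Pi *v u))"
      using Z_energy[of "Pi *v u" "Pi *v u"] pos_semidefD(2)[OF B0, of "Pi *v u"] g_pos
      by (simp add: zero_le_mult_iff)
    then show ?thesis using Pi_Z_bound[of u] by (simp add: Y_def)
  qed
  have Y_sym: "Y u v = Y v u" for u v
    using sP[of u v] symmetric_inner[OF pos_semidefD(1)[OF Z_psd], of "a' *v (Pi *v u)" "a' *v (Pi *v v)"]
    by (simp add: Y_def inner_commute)
  have c_nonneg: "0 \<le> (Pi *v u) \<bullet> (B0 *v (Pi *v u))" "0 \<le> f u \<bullet> (Om *v f u)" for u
    by (rule pos_semidefD(2)[OF B0], rule pos_semidefD(2)[OF Om_psd])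
  have F_step: "F *v u = a *v u + K *v f u" for u
    using matrix_vector_mult_diff_distrib[of K 0 "Wi *v (N' *v u)"] by (simp add: F_vec f_def)
  have Pi_step: "- (Pi *v u) = a' *v (- (Pi *v (F *v u))) + L *v f u" for u
  proof -
    have neg: "M *v (- w) = - (M *v w)" for M :: "real^'c^'d" and w
      using matrix_vector_mult_diff_distrib[of M 0 w] by simp
    have "Pi *v u = a' *v (Pi *v (a *v u)) - N *v f u"
      by (subst Pi_vec) (simp add: f_def neg)
    then show ?thesis by (simp add: F_step L_vec neg matrix_vector_right_distrib matrix_vector_mult_diff_distrib)
  qed
  have neg: "M *v (- w) = - (M *v w)" for M :: "real^'n^'n" and w
    using matrix_vector_mult_diff_distrib[of M 0 w] by simp
  have Y_step: "Y (F *v u) (F *v u) = Y u u - c u" for u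
  proof -
    have st: "storage (- (Pi *v w)) w = - Y w w" for w
      by (simp add: storage_def Y_def neg inner_commute)
    have "0 = f u + Wi *v (N' *v u)" by (simp add: f_def)
    from dissipation[OF Pi_step F_step this]
    have "(Pi *v u) \<bullet> (B0 *v (Pi *v u)) = g * (Y u u - Y (F *v u) (F *v u) - f u \<bullet> (Om *v f u))"
      by (simp add: st neg)
    then show ?thesis using g_pos by (simp add: c_def)
  qed
  have "Y (F *v x) (F *v x) + Y (F *v y) (F *v y) = (\<alpha>\<^sup>2 + \<beta>\<^sup>2) * (Y x x + Y y y)"
    using Y_sym[of y x] unfolding Fx Fy
    by (simp add: Y_def matrix_vector_right_distrib matrix_vector_mult_diff_distrib
        matrix_vector_mult_scaleR inner_add_left inner_add_right inner_diff_left inner_diff_right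
        power2_eq_square algebra_simps)
  moreover have "1 * (Y x x + Y y y) \<le> (\<alpha>\<^sup>2 + \<beta>\<^sup>2) * (Y x x + Y y y)"
    by (intro mult_right_mono l add_nonneg_nonneg Y_nonneg)
  ultimately have "c x + c y \<le> 0" by (simp add: Y_step)
  moreover have "0 \<le> c u" for u using c_nonneg g_pos by (simp add: c_def)
  ultimately have "c x = 0" "c y = 0" by (smt (verit))+
  then have c0: "(Pi *v u) \<bullet> (B0 *v (Pi *v u)) = 0 \<and> f u \<bullet> (Om *v f u) = 0" if "u \<in> {x, y}" for u
    using that c_nonneg[of u] g_pos unfolding c_def
    by (metis add_nonneg_eq_0_iff divide_eq_0_iff divide_nonneg_pos insertE less_irrefl singletonD)
  have B0_zero: "B0 *v (Pi *v u) = 0" if "u \<in> {x, y}" for u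
    using pos_semidef_kernel[OF B0] c0[OF that] by blast
  have B0_F: "B0 *v (Pi *v (F *v u)) = 0" if "u \<in> {x, y}" for u
    using that B0_zero[of x] B0_zero[of y]
    by (auto simp: Fx Fy matrix_vector_right_distrib matrix_vector_mult_diff_distrib matrix_vector_mult_scaleR)
  have ZaZ: "Z *v w = a *v (Z *v (a' *v w))" if "B0 *v w = 0" for w
    using Z1_vec[of w] that by (simp add: Z_vec matrix_vector_mult_scaleR)
  define D where "D u = u - Z *v (Pi *v u)" for u
  have D_step: "D (F *v u) = a *v D u" if u: "u \<in> {x, y}" for u
  proof -
    define h where "h = Z *v (L *v f u)"
    have "Om *v f u = 0" using pos_semidef_kernel[OF Om_psd] c0[OF u] by blast
    then have "w \<bullet> (W *v f u) = w \<bullet> (N' *v h)" for w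
      using Om_form'[of w "f u"] by (simp add: h_def inner_matrix_left)
    then have "W *v f u = N' *v h" by (metis vector_eq_ldot)
    then have f: "f u = Wi *v (N' *v h)" by (metis W_inv(2))
    have Kf: "K *v f u = a *v h" by (simp add: K_vec h_def)
    \<comment> \<open>Equality in the proof of \<open>Om \<ge> 0\<close>: the state \<open>h\<close> is a fixed point of \<open>Z Pi\<close>.\<close>
    have "Pi *v h = L *v f u" by (subst Pi_vec) (simp add: L_vec Kf f[symmetric])
    then have Zh: "Z *v (Pi *v h) = h" by (simp add: h_def)
    have "N *v (Wi *v (N' *v u)) = - (N *v f u)" by (simp add: f_def)
      (metis diff_0 matrix_vector_mult_0_right matrix_vector_mult_diff_distrib minus_minus)
    then have "Pi *v (u + h) = a' *v (Pi *v (a *v (u + h)))"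
      by (subst matrix_vector_right_distrib, subst Pi_vec, subst (2) Pi_vec)
        (simp add: f[symmetric] matrix_vector_right_distrib)
    then have PF: "a' *v (Pi *v (F *v u)) = Pi *v u + Pi *v h"
      by (simp add: F_step Kf matrix_vector_right_distrib)
    have "Z *v (Pi *v (F *v u)) = a *v (Z *v (Pi *v u)) + a *v h"
      by (subst ZaZ[OF B0_F[OF u]]) (simp add: PF matrix_vector_right_distrib Zh)
    then show ?thesis by (simp add: D_def F_step Kf matrix_vector_mult_diff_distrib)
  qed
  have "D x = 0 \<and> D y = 0"
  proof (rule schur_stable_real_pairs[OF stable _ _ l])
    show "a *v D x = \<alpha> *\<^sub>R D x - \<beta> *\<^sub>R D y"
      unfolding D_step[OF insertI1, symmetric] Fx
      by (simp add: D_def matrix_vector_mult_diff_distrib matrix_vector_mult_scaleR algebra_simps)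
    have "a *v D y = D (F *v y)" using D_step[of y] by simp
    then show "a *v D y = \<beta> *\<^sub>R D x + \<alpha> *\<^sub>R D y"
      unfolding Fy by (simp add: D_def matrix_vector_right_distrib matrix_vector_mult_scaleR algebra_simps)
  qed
  then have fixed: "Z *v (Pi *v u) = u" if "u \<in> {x, y}" for u using that by (auto simp: D_def)
  have "u = 0" if u: "u \<in> {x, y}" for u
  proof -
    have "(mat 1 - a ** Z ** a' ** Pi) *v u = u - a *v (Z *v (a' *v (Pi *v u)))"
      by (simp add: matrix_vector_mult_diff_rdistrib matrix_vector_mul_assoc[symmetric])
    also have "\<dots> = 0" using ZaZ[OF B0_zero[OF u]] fixed[OF u] by simp
    finally show ?thesis
      using inv[folded Z_def] by (metis matrix_inv_vector(2) matrix_vector_mult_0_right)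
  qed
  then show "x = 0 \<and> y = 0" by blast
qed

end

context nehari
begin

text \<open>A kernel vector \<open>x\<close> would satisfy \<open>x \<bullet> Pi x \<le> (lam / g) (x \<bullet> Pi x)\<close>.\<close>

lemma level_invertible_above:
  assumes "lam < g"
  shows "invertible (mat 1 - a ** ((1 / g) *\<^sub>R Z1) ** a' ** Pi)"
proof (rule invertibleI_kernel)
  have g: "g > 0" using assms lambda_max_product_nonneg[OF Z1_psd Pi_psd] by simp
  fix x assume "(mat 1 - a ** ((1 / g) *\<^sub>R Z1) ** a' ** Pi) *v x = 0"
  then have x: "x = (1 / g) *\<^sub>R (a *v (Z1 *v (a' *v (Pi *v x))))"
    by (simp add: matrix_vector_mult_diff_rdistrib matrix_vector_mul_assoc[symmetric]
        scaleR_matrix_vector_assoc[symmetric] matrix_vector_mult_scaleR)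
  have "x \<bullet> (Pi *v x) = (1 / g) * ((a' *v (Pi *v x)) \<bullet> (Z1 *v (a' *v (Pi *v x))))"
    by (subst x) (simp add: inner_matrix_left inner_commute)
  also have "(a' *v (Pi *v x)) \<bullet> (Z1 *v (a' *v (Pi *v x))) \<le> (Pi *v x) \<bullet> (Z1 *v (Pi *v x))"
    using Z1_energy[of "Pi *v x" "Pi *v x"] pos_semidefD(2)[OF B0, of "Pi *v x"] by simp
  also have "(Pi *v x) \<bullet> (Z1 *v (Pi *v x)) \<le> lam * (x \<bullet> (Pi *v x))"
    by (rule lambda_max_product_bound'[OF Z1_psd Pi_psd])
  finally have "(g - lam) * (x \<bullet> (Pi *v x)) \<le> 0" using g by (simp add: field_simps)
  then have "x \<bullet> (Pi *v x) = 0"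
    using assms pos_semidefD(2)[OF Pi_psd, of x] by (simp add: mult_le_0_iff)
  then have "Pi *v x = 0" by (rule pos_semidef_kernel[OF Pi_psd])
  then show "x = 0" using x by simp
qed

text \<open>If the Hankel operator vanishes, then so does \<open>Pi Z1\<close>, and \<open>N W\<^sup>-\<^sup>1 N' \<le> Pi\<close> carries this over to
\<open>N' Z1\<close>. Hence the gain of the central controller is zero at every level.\<close>

lemma zero_level_gain:
  assumes "lam = 0"
  shows "a ** Z1 ** N = 0"
proof -
  have Pi_Z1: "Pi *v (Z1 *v x) = 0" for x
    using lambda_max_product_bound[OF Z1_psd Pi_psd, of x] pos_semidefD(2)[OF Pi_psd, of "Z1 *v x"]
      pos_semidef_kernel[OF Pi_psd] assms by simp
  have "N' *v (Z1 *v x) = 0" for x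
  proof -
    let ?y = "Z1 *v x"
    have "0 = (a *v ?y) \<bullet> (Pi *v (a *v ?y)) + (N' *v ?y) \<bullet> (Wi *v (N' *v ?y))"
      using Pi_energy[of ?y ?y] Pi_Z1[of x] by simp
    then have "(N' *v ?y) \<bullet> (Wi *v (N' *v ?y)) = 0"
      using pos_semidefD(2)[OF Pi_psd, of "a *v ?y"] pos_semidefD(2)[OF Wi_psd, of "N' *v ?y"] by linarith
    then have "Wi *v (N' *v ?y) = 0" by (rule pos_semidef_kernel[OF Wi_psd])
    then show ?thesis using W_inv(1)[of "N' *v ?y"] by simp
  qed
  then have "(N *v f) \<bullet> (Z1 *v x) = 0" for x f by (simp add: inner_matrix_left)
  then have "x \<bullet> (Z1 *v (N *v f)) = 0" for x f
    using symmetric_inner[OF pos_semidefD(1)[OF Z1_psd], of x "N *v f"] by (simp add: inner_commute)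
  then have "Z1 *v (N *v f) = 0" for f by (metis inner_eq_zero_iff)
  then show ?thesis
    by (intro matrix_eqI) (simp add: matrix_vector_mul_assoc[symmetric])
qed

lemma level_gramian_unique:
  assumes "Z = a ** Z ** a' + c *\<^sub>R B0"
  shows "Z = c *\<^sub>R Z1"
proof (rule lyapunov_unique[OF schur_stable_transpose[OF stable]])
  show "Z = transpose a' ** Z ** a' + c *\<^sub>R B0" using assms by simp
  show "c *\<^sub>R Z1 = transpose a' ** c *\<^sub>R Z1 ** a' + c *\<^sub>R B0"
  proof (rule matrix_eqI)
    fix x
    show "c *\<^sub>R Z1 *v x = (transpose a' ** c *\<^sub>R Z1 ** a' + c *\<^sub>R B0) *v x"
      by (simp add: scaleR_matrix_vector_assoc[symmetric] matrix_vector_mul_assoc[symmetric]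
          matrix_vector_mult_add_rdistrib matrix_vector_mult_scaleR scaleR_right_distrib[symmetric]
          Z1_vec[of x, symmetric])
  qed
qed

end

section \<open>The clairvoyant controller\<close>

lemma ell2_inner_diff_left:
  assumes "x \<in> ell2" "y \<in> ell2" "z \<in> ell2"
  shows "ell2_inner (\<lambda>t. x t - y t) z = ell2_inner x z - ell2_inner y z"
proof -
  have "((\<lambda>t. x t \<bullet> z t + - (y t \<bullet> z t)) has_sum (ell2_inner x z + - ell2_inner y z)) UNIV"
    unfolding ell2_inner_def
    by (intro has_sum_add has_sum_uminusI has_sum_infsum ell2_inner_summable assms)
  then show ?thesis by (simp add: ell2_inner_def inner_diff_left infsumI)
qed

lemma ell2_inner_commute: "ell2_inner x y = ell2_inner y x"
  by (simp add: ell2_inner_def inner_commute)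

lemma ell2_inner_diff_right:
  assumes "x \<in> ell2" "y \<in> ell2" "z \<in> ell2"
  shows "ell2_inner z (\<lambda>t. x t - y t) = ell2_inner z x - ell2_inner z y"
  using ell2_inner_diff_left[OF assms] by (simp add: ell2_inner_commute[of z])

lemma ell2_inner_self_nonneg: "0 \<le> ell2_inner x x"
  unfolding ell2_inner_def by (rule infsum_nonneg) simp

lemma ell2_inner_self_zero:
  assumes "x \<in> ell2" "ell2_inner x x \<le> 0"
  shows "x = (\<lambda>_. 0)"
proof
  fix t
  have "x t \<bullet> x t \<le> ell2_inner x x"
    unfolding ell2_inner_def
    using finite_sum_le_infsum[of "\<lambda>t. x t \<bullet> x t" UNIV "{t}"] ell2_inner_summable[OF assms(1,1)] by simp
  then show "x t = 0" using assms(2) by (metis inner_gt_zero_iff not_less order_trans)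
qed

lemma ell2_adjoint_eqI:
  assumes "z \<in> ell2" "\<And>u. u \<in> ell2 \<Longrightarrow> ell2_inner (L u) y = ell2_inner u z"
  shows "ell2_adjoint L y = z"
  unfolding ell2_adjoint_def
proof (rule the_equality)
  show "z \<in> ell2 \<and> (\<forall>u\<in>ell2. ell2_inner (L u) y = ell2_inner u z)" using assms by blast
  fix z' assume z': "z' \<in> ell2 \<and> (\<forall>u\<in>ell2. ell2_inner (L u) y = ell2_inner u z')"
  let ?d = "\<lambda>t. z' t - z t"
  have d: "?d \<in> ell2" using z' assms(1) by (intro ell2_diff) auto
  have "ell2_inner ?d ?d = ell2_inner ?d z' - ell2_inner ?d z"
    by (rule ell2_inner_diff_right) (use z' assms(1) d in auto)
  also have "\<dots> = 0" using z' assms(2)[OF d] d by auto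
  finally have "?d = (\<lambda>_. 0)" using ell2_inner_self_zero[OF d] by simp
  then show "z' = z" by (metis eq_iff_diff_eq_0 ext)
qed

lemma toeplitz_op_ell2: "circle_free A \<Longrightarrow> u \<in> ell2 \<Longrightarrow> toeplitz_op A B Q u \<in> ell2"
  unfolding toeplitz_op_def by (intro ell2_matrix ell2_response(1))

lemma toeplitz_op_diff:
  assumes A: "circle_free A" and "u \<in> ell2" "v \<in> ell2"
  shows "toeplitz_op A B Q (\<lambda>t. u t - v t) = (\<lambda>t. toeplitz_op A B Q u t - toeplitz_op A B Q v t)"
  using ell2_response_linear[OF A ell2_matrix[OF assms(2), of B] ell2_matrix[OF assms(3), of B], of 1 "-1"]
  by (simp add: toeplitz_op_def matrix_vector_mult_diff_distrib)

text \<open>The adjoint of the response is the costate recursion; the product \<open>x \<bullet> \<mu>\<close> telescopes.\<close>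

lemma toeplitz_op_duality:
  fixes A :: "real^'n^'n" and B :: "real^'p^'n"
  assumes A: "circle_free A" and S: "transpose (msqrt Q) = msqrt Q" and u: "u \<in> ell2" and y: "y \<in> ell2"
    and \<mu>: "\<mu> \<in> ell2" "\<And>t. \<mu> t = transpose A *v \<mu> (t + 1) + msqrt Q *v y t"
  shows "ell2_inner (toeplitz_op A B Q u) y = ell2_inner u (\<lambda>t. transpose B *v \<mu> (t + 1))"
proof -
  define x where "x = ell2_response A (\<lambda>t. B *v u t)"
  have x: "x \<in> ell2" "\<And>t. x (t + 1) = A *v x t + B *v u t"
    unfolding x_def using ell2_response[OF A ell2_matrix[OF u]] by auto
  show "ell2_inner (toeplitz_op A B Q u) y = ell2_inner u (\<lambda>t. transpose B *v \<mu> (t + 1))"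
    unfolding ell2_inner_def
  proof (rule infsum_telescope(1)[where h = "\<lambda>t. - (x t \<bullet> \<mu> t)"])
    show "(\<lambda>t. u t \<bullet> (transpose B *v \<mu> (t + 1))) summable_on UNIV"
      by (intro ell2_inner_summable ell2_matrix ell2_shift u \<mu>)
    show "(\<lambda>t. - (x t \<bullet> \<mu> t)) summable_on UNIV"
      using ell2_inner_summable[OF x(1) \<mu>(1)] by (simp add: summable_on_uminus)
    fix t
    have "toeplitz_op A B Q u t \<bullet> y t = x t \<bullet> (msqrt Q *v y t)"
      by (simp add: toeplitz_op_def x_def[symmetric] inner_matrix_left S)
    also have "\<dots> = x t \<bullet> \<mu> t - x t \<bullet> (transpose A *v \<mu> (t + 1))"
      by (subst \<mu>(2)[of t]) (simp add: inner_add_right)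
    finally show "toeplitz_op A B Q u t \<bullet> y t = u t \<bullet> (transpose B *v \<mu> (t + 1)) +
        (- (x (t + 1) \<bullet> \<mu> (t + 1)) - - (x t \<bullet> \<mu> t))"
      by (simp add: x(2) inner_add_left inner_matrix_left)
  qed
qed

lemma toeplitz_op_adjoint:
  fixes A :: "real^'n^'n" and B :: "real^'p^'n"
  assumes A: "circle_free A" and S: "transpose (msqrt Q) = msqrt Q" and y: "y \<in> ell2"
    and \<mu>: "\<mu> \<in> ell2" "\<And>t. \<mu> t = transpose A *v \<mu> (t + 1) + msqrt Q *v y t"
  shows "ell2_adjoint (toeplitz_op A B Q) y = (\<lambda>t. transpose B *v \<mu> (t + 1))"
  by (intro ell2_adjoint_eqI toeplitz_op_duality assms ell2_matrix ell2_shift)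

text \<open>The normal equation \<open>(I + F\<^sup>* F) v = F\<^sup>* (G w)\<close> has the solution \<open>- u\<close> exactly if
\<open>u = - F\<^sup>* (F u + G w)\<close>, and the right-hand side is the costate form of the optimality condition,
because \<open>F u + G w\<close> is the weighted state of the trajectory. The operator \<open>I + F\<^sup>* F\<close> is injective,
which makes the solution unique.\<close>

lemma noncausal_controller_eqI:
  fixes A :: "real^'n^'n" and Bu :: "real^'p^'n" and Bw :: "real^'m^'n"
  assumes A: "circle_free A" and Q: "pos_semidef Q" and w: "w \<in> ell2"
    and u: "u \<in> ell2" and x: "x \<in> ell2" "\<And>t. x (t + 1) = A *v x t + Bu *v u t + Bw *v w t"
    and \<kappa>: "\<kappa> \<in> ell2" "\<And>t. \<kappa> t = transpose A *v \<kappa> (t + 1) + Q *v x t"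
    and opt: "\<And>t. u t = - (transpose Bu *v \<kappa> (t + 1))"
  shows "noncausal_controller A Bu Bw Q w = u"
proof -
  note S = msqrt_properties[OF Q]
  let ?F = "toeplitz_op A Bu Q" and ?G = "toeplitz_op A Bw Q"
  note FE = toeplitz_op_ell2[OF A, where B = Bu and Q = Q]
  note GE = toeplitz_op_ell2[OF A, where B = Bw and Q = Q]
  have adj: "\<exists>z\<in>ell2. ell2_adjoint ?F y = z \<and> (\<forall>v\<in>ell2. ell2_inner (?F v) y = ell2_inner v z)"
    if y: "y \<in> ell2" for y
  proof -
    obtain \<mu> where \<mu>: "\<mu> \<in> ell2" "\<And>t. \<mu> t = transpose A *v \<mu> (t + 1) + msqrt Q *v y t"
      using backward_solution_exists[OF A ell2_matrix[OF y]] by blast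
    then show ?thesis
      using toeplitz_op_adjoint[OF A S(1) y \<mu>] toeplitz_op_duality[OF A S(1) _ y \<mu>]
        ell2_matrix[OF ell2_shift[OF \<mu>(1)]] by blast
  qed
  define u0 where "u0 t = - u t" for t
  have u0: "u0 \<in> ell2" unfolding u0_def by (rule ell2_minus[OF u])
  obtain \<mu>F where \<mu>F: "\<mu>F \<in> ell2" "\<And>t. \<mu>F t = transpose A *v \<mu>F (t + 1) + msqrt Q *v ?F u0 t"
    using backward_solution_exists[OF A ell2_matrix[OF FE[OF u0]]] by blast
  obtain \<mu>G where \<mu>G: "\<mu>G \<in> ell2" "\<And>t. \<mu>G t = transpose A *v \<mu>G (t + 1) + msqrt Q *v ?G w t"
    using backward_solution_exists[OF A ell2_matrix[OF GE[OF w]]] by blast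
  have FF: "ell2_adjoint ?F (?F u0) = (\<lambda>t. transpose Bu *v \<mu>F (t + 1))"
    by (rule toeplitz_op_adjoint[OF A S(1) FE[OF u0] \<mu>F])
  have FG: "ell2_adjoint ?F (?G w) = (\<lambda>t. transpose Bu *v \<mu>G (t + 1))"
    by (rule toeplitz_op_adjoint[OF A S(1) GE[OF w] \<mu>G])
  have "ell2_response A (\<lambda>t. Bw *v w t) = (\<lambda>t. x t + ell2_response A (\<lambda>t. Bu *v u0 t) t)"
  proof (rule ell2_response_eqI[OF A ell2_matrix[OF w]])
    show "(\<lambda>t. x t + ell2_response A (\<lambda>t. Bu *v u0 t) t) \<in> ell2"
      by (intro ell2_add x ell2_response(1)[OF A] ell2_matrix u0)
    have neg: "Bu *v u0 t = - (Bu *v u t)" for t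
      using matrix_vector_mult_diff_distrib[of Bu 0 "u t"] by (simp add: u0_def)
    show "x (t + 1) + ell2_response A (\<lambda>t. Bu *v u0 t) (t + 1) =
        A *v (x t + ell2_response A (\<lambda>t. Bu *v u0 t) t) + Bw *v w t" for t
      by (subst ell2_response(2)[OF A ell2_matrix[OF u0]])
        (simp add: x(2) neg matrix_vector_right_distrib)
  qed
  then have GF: "msqrt Q *v ?G w t = Q *v x t + msqrt Q *v ?F u0 t" for t
    by (simp add: toeplitz_op_def matrix_vector_right_distrib) (simp add: matrix_vector_mul_assoc S)
  have "\<mu>G = (\<lambda>t. \<kappa> t + \<mu>F t)"
  proof (rule backward_solution_unique[OF A \<mu>G(1) \<mu>G(2)])
    show "(\<lambda>t. \<kappa> t + \<mu>F t) \<in> ell2" by (intro ell2_add \<kappa> \<mu>F)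
    show "\<kappa> t + \<mu>F t = transpose A *v (\<kappa> (t + 1) + \<mu>F (t + 1)) + msqrt Q *v ?G w t" for t
      by (subst \<kappa>(2), subst \<mu>F(2)) (simp add: GF matrix_vector_right_distrib)
  qed
  then have sol: "u0 t + ell2_adjoint ?F (?F u0) t = ell2_adjoint ?F (?G w) t" for t
    by (simp add: FF FG matrix_vector_right_distrib u0_def opt)
  have "(THE u. u \<in> ell2 \<and> (\<forall>s. u s + ell2_adjoint ?F (?F u) s = ell2_adjoint ?F (?G w) s)) = u0"
  proof (rule the_equality)
    show "u0 \<in> ell2 \<and> (\<forall>s. u0 s + ell2_adjoint ?F (?F u0) s = ell2_adjoint ?F (?G w) s)"
      using u0 sol by blast
    fix v assume v: "v \<in> ell2 \<and> (\<forall>s. v s + ell2_adjoint ?F (?F v) s = ell2_adjoint ?F (?G w) s)"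
    define d where "d t = v t - u0 t" for t
    have d: "d \<in> ell2" unfolding d_def using v u0 by (intro ell2_diff) auto
    obtain p where p: "p \<in> ell2" "ell2_adjoint ?F (?F v) = p" "ell2_inner (?F d) (?F v) = ell2_inner d p"
      using adj[OF FE, of v] v d by blast
    obtain p0 where p0: "p0 \<in> ell2" "ell2_adjoint ?F (?F u0) = p0" "ell2_inner (?F d) (?F u0) = ell2_inner d p0"
      using adj[OF FE, of u0] u0 d by blast
    have "v t + p t = u0 t + p0 t" for t
      using v sol p(2) p0(2) by metis
    then have dp: "d = (\<lambda>t. p0 t - p t)" by (auto simp: d_def algebra_simps)
    have Fd: "?F d = (\<lambda>t. ?F v t - ?F u0 t)"
      unfolding d_def using toeplitz_op_diff[OF A _ u0] v by blast
    have "ell2_inner d d = ell2_inner d p0 - ell2_inner d p"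
      by (subst (2) dp) (rule ell2_inner_diff_right[OF p0(1) p(1) d])
    also have "\<dots> = - ell2_inner (?F d) (\<lambda>t. ?F v t - ?F u0 t)"
      using ell2_inner_diff_right[OF FE FE FE[OF d], of v u0] v u0 p(3) p0(3) by simp
    also have "\<dots> \<le> 0" unfolding Fd[symmetric] by (simp add: ell2_inner_self_nonneg)
    finally have "d = (\<lambda>_. 0)" by (rule ell2_inner_self_zero[OF d])
    then show "v = u0" unfolding d_def by (metis eq_iff_diff_eq_0 ext)
  qed
  then show ?thesis by (simp add: noncausal_controller_def u0_def)
qed

section \<open>Costs as extended real numbers\<close>

lemma infsum_ennreal:
  fixes f :: "'a \<Rightarrow> real"
  assumes "f summable_on UNIV" "\<And>t. 0 \<le> f t"
  shows "(\<Sum>\<^sub>\<infinity>t. ennreal (f t)) = ennreal (infsum f UNIV)"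
proof -
  have "(\<Sum>\<^sub>\<infinity>t. ennreal (f t)) = (SUP F\<in>{F. finite F \<and> F \<subseteq> UNIV}. sum (\<lambda>t. ennreal (f t)) F)"
    by (rule nonneg_infsum_complete) simp
  also have "\<dots> = (SUP F\<in>{F. finite F \<and> F \<subseteq> UNIV}. ennreal (sum f F))"
    using assms(2) by (simp add: sum_ennreal)
  also have "\<dots> = ennreal (infsum f UNIV)"
    by (rule infsum_nonneg_is_SUPREMUM_ennreal[symmetric]) (use assms in auto)
  finally show ?thesis .
qed

lemma infsum_ennreal_finite_imp_summable:
  fixes f :: "'a \<Rightarrow> real"
  assumes "(\<Sum>\<^sub>\<infinity>t. ennreal (f t)) < \<infinity>" "\<And>t. 0 \<le> f t"
  shows "f summable_on UNIV"
proof (rule nonneg_bounded_partial_sums_imp_summable_on)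
  define C where "C = (\<Sum>\<^sub>\<infinity>t. ennreal (f t))"
  have "sum f F \<le> enn2real C" if "finite F" for F
  proof -
    have "ennreal (sum f F) = (\<Sum>t\<in>F. ennreal (f t))" using assms(2) by (simp add: sum_ennreal)
    also have "\<dots> \<le> C"
      unfolding C_def by (subst nonneg_infsum_complete) (use that in \<open>auto intro: SUP_upper\<close>)
    finally show ?thesis
      using assms(1) by (metis C_def enn2real_ennreal enn2real_mono infinity_ennreal_def assms(2) sum_nonneg)
  qed
  then show "\<forall>\<^sub>F F in finite_subsets_at_top UNIV. sum f F \<le> enn2real C"
    by (intro eventually_finite_subsets_at_top_weakI) auto
qed (rule assms(2))

lemma cost_ell2:
  assumes Q: "pos_semidef Q" and "x \<in> ell2" "u \<in> ell2"
  shows "cost Q x u = ennreal (\<Sum>\<^sub>\<infinity>t. x t \<bullet> (Q *v x t) + u t \<bullet> u t)"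
  unfolding cost_def using assms pos_semidefD(2)[OF Q]
  by (intro infsum_ennreal summable_on_add ell2_inner_summable ell2_matrix) auto

lemma pos_def_coercive:
  fixes Q :: "real^'n^'n"
  assumes "pos_def Q"
  obtains c where "\<And>x. (norm x)\<^sup>2 \<le> c * (x \<bullet> (Q *v x))"
proof -
  note S = msqrt_properties[OF pos_def_imp_pos_semidef[OF assms]]
  let ?M = "matrix_inv Q ** msqrt Q"
  obtain c where c: "\<And>x. norm (?M *v x) \<le> norm x * c"
    using bounded_linear.bounded[OF matrix_vector_mul_bounded_linear[of ?M]] by blast
  have "(norm x)\<^sup>2 \<le> c\<^sup>2 * (x \<bullet> (Q *v x))" for x
  proof -
    have "?M *v (msqrt Q *v x) = x"
      by (metis S(3) matrix_inv_vector(2) matrix_vector_mul_assoc pos_def_invertible[OF assms])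
    then have "norm x \<le> norm (msqrt Q *v x) * c" using c[of "msqrt Q *v x"] by simp
    then have "(norm x)\<^sup>2 \<le> (norm (msqrt Q *v x) * c)\<^sup>2" by (simp add: power_mono)
    also have "(norm (msqrt Q *v x))\<^sup>2 = x \<bullet> (Q *v x)"
      by (simp add: dot_square_norm[symmetric] inner_matrix_left S(1) matrix_vector_mul_assoc S(3))
    then have "(norm (msqrt Q *v x) * c)\<^sup>2 = c\<^sup>2 * (x \<bullet> (Q *v x))"
      by (simp add: power_mult_distrib)
    finally show ?thesis .
  qed
  then show thesis by (rule that)
qed

text \<open>A trajectory of finite cost is square summable. This is where positive definiteness of \<open>Q\<close> enters, and
it lets the energy identities be applied to an arbitrary controller with finite ratio.\<close>

lemma cost_finite_imp_ell2:
  assumes Q: "pos_def Q" and fin: "cost Q x u < \<infinity>"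
  shows "x \<in> ell2" "u \<in> ell2"
proof -
  have nonneg: "0 \<le> x t \<bullet> (Q *v x t)" for t
    by (rule pos_semidefD(2)[OF pos_def_imp_pos_semidef[OF Q]])
  have sum: "(\<lambda>t. x t \<bullet> (Q *v x t) + u t \<bullet> u t) summable_on UNIV"
    by (rule infsum_ennreal_finite_imp_summable) (use fin nonneg in \<open>auto simp: cost_def\<close>)
  show "u \<in> ell2"
    unfolding ell2_summable
    by (rule summable_on_comparison_test[OF sum]) (use nonneg in \<open>auto simp: dot_square_norm\<close>)
  obtain c where c: "\<And>y. (norm y)\<^sup>2 \<le> c * (y \<bullet> (Q *v y))" using pos_def_coercive[OF Q] by blast
  show "x \<in> ell2"
    unfolding ell2_summable
  proof (rule summable_on_comparison_test)
    show "(\<lambda>t. \<bar>c\<bar> * (x t \<bullet> (Q *v x t) + u t \<bullet> u t)) summable_on UNIV"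
      by (rule summable_on_cmult_right[OF sum])
    show "(norm (x t))\<^sup>2 \<le> \<bar>c\<bar> * (x t \<bullet> (Q *v x t) + u t \<bullet> u t)" for t
    proof -
      have "(norm (x t))\<^sup>2 \<le> c * (x t \<bullet> (Q *v x t))" by (rule c)
      also have "\<dots> \<le> \<bar>c\<bar> * (x t \<bullet> (Q *v x t) + u t \<bullet> u t)"
        using nonneg by (intro mult_mono) auto
      finally show ?thesis .
    qed
  qed simp
qed

section \<open>Linear quadratic regulation\<close>

lemma matrix_vector_mult_minus_right: "M *v (- w) = - (M *v w)" for M :: "real^'a^'b"
  using matrix_vector_mult_diff_distrib[of M 0 w] by simp

lemma pos_semidef_invertible_imp_pos_def:
  assumes M: "pos_semidef M" and inv: "invertible M"
  shows "pos_def M"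
  unfolding pos_def_def
proof (intro conjI allI impI)
  show "transpose M = M" by (rule pos_semidefD(1)[OF M])
  fix x :: "real^'a" assume "x \<noteq> 0"
  then have "M *v x \<noteq> 0" using matrix_inv_vector(2)[OF inv, of x] by auto
  then have "x \<bullet> (M *v x) \<noteq> 0" using pos_semidef_kernel[OF M] by blast
  then show "0 < x \<bullet> (M *v x)" using pos_semidefD(2)[OF M, of x] by simp
qed

lemma full_rank_on_circle_imp_circle_free:
  assumes "full_rank_on_circle A B Q"
  shows "circle_free A"
  unfolding circle_free_def
proof (intro allI impI notI)
  fix l :: complex and v :: "complex^'a"
  assume v: "v \<noteq> 0 \<and> cmat A *v v = l *s v" and l: "cmod l = 1"
  have "cis (Arg l) = l" using l rcis_cmod_Arg[of l] by (simp add: rcis_def)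
  then have "invertible (mat l - cmat A)"
    using assms unfolding full_rank_on_circle_def by metis
  moreover have "(mat l - cmat A) *v v = 0"
    using v by (simp add: matrix_vector_mult_diff_rdistrib complex_mat_vector)
  ultimately show False
    using v by (metis invertible_def matrix_left_invertible_ker)
qed

locale lqr =
  fixes A :: "real^'n^'n" and Bu :: "real^'p^'n" and Q P :: "real^'n^'n"
  assumes Q: "pos_def Q" and P: "stabilizing_P A Bu Q P"
begin

abbreviation "R \<equiv> R_lqr Bu P"
abbreviation "Ri \<equiv> matrix_inv R"
abbreviation "Kl \<equiv> K_lqr A Bu P"
abbreviation "AK \<equiv> A_K A Bu P"

lemma P_sym: "transpose P = P" and R_inv: "invertible R" and AK_stable: "schur_stable AK"
  and P_eq: "P = transpose A ** P ** A + Q - transpose Kl ** R ** Kl"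
  using P by (auto simp: stabilizing_P_def)

lemmas P_inner = symmetric_inner[OF P_sym]
lemmas Q_psd = pos_def_imp_pos_semidef[OF Q]
lemmas Q_inner = symmetric_inner[OF pos_semidefD(1)[OF Q_psd]]

lemma R_vec: "R *v x = x + transpose Bu *v (P *v (Bu *v x))"
  by (simp add: R_lqr_def matrix_vector_mult_add_rdistrib matrix_vector_mul_assoc matrix_mul_assoc)

lemma R_sym: "transpose R = R"
  by (rule transpose_eqI)
    (simp add: R_vec inner_add_left inner_add_right inner_matrix_left P_sym)

lemma R_Kl: "R *v (Kl *v x) = transpose Bu *v (P *v (A *v x))"
  by (simp add: K_lqr_def matrix_vector_mul_assoc[symmetric] matrix_inv_vector[OF R_inv])

lemma AK_vec: "AK *v x = A *v x - Bu *v (Kl *v x)"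
  by (simp add: A_K_def matrix_vector_mult_diff_rdistrib matrix_vector_mul_assoc)

lemma Kl_AK: "transpose Bu *v (P *v (AK *v x)) = Kl *v x"
proof -
  have "transpose Bu *v (P *v (AK *v x)) = R *v (Kl *v x) - transpose Bu *v (P *v (Bu *v (Kl *v x)))"
    by (simp add: AK_vec matrix_vector_mult_diff_distrib R_Kl)
  then show ?thesis by (simp add: R_vec)
qed

lemma AK_transpose_P_Bu: "transpose AK *v (P *v (Bu *v y)) = transpose Kl *v y"
proof -
  have "x \<bullet> (transpose AK *v (P *v (Bu *v y))) = x \<bullet> (transpose Kl *v y)" for x
  proof -
    have "x \<bullet> (transpose AK *v (P *v (Bu *v y))) = (P *v (AK *v x)) \<bullet> (Bu *v y)"
      by (simp add: inner_matrix_left[symmetric] P_inner)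
    also have "\<dots> = (transpose Bu *v (P *v (AK *v x))) \<bullet> y"
      by (simp add: inner_matrix_left)
    finally show ?thesis by (simp add: Kl_AK inner_matrix_left)
  qed
  then show ?thesis by (metis vector_eq_ldot)
qed

lemma A_transpose: "transpose A *v x = transpose AK *v x + transpose Kl *v (transpose Bu *v x)"
proof -
  have "y \<bullet> (transpose A *v x) = y \<bullet> (transpose AK *v x + transpose Kl *v (transpose Bu *v x))" for y
    by (simp add: inner_add_right inner_matrix_left[symmetric] AK_vec inner_diff_left)
  then show ?thesis by (metis vector_eq_ldot)
qed

text \<open>The Joseph form of the Riccati equation, in which every term is a square.\<close>

lemma P_joseph: "P *v x = transpose AK *v (P *v (AK *v x)) + transpose Kl *v (Kl *v x) + Q *v x"
proof -
  have "P *v x = transpose A *v (P *v (A *v x)) + Q *v x - transpose Kl *v (R *v (Kl *v x))"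
    by (subst P_eq) (simp add: matrix_vector_mult_add_rdistrib matrix_vector_mult_diff_rdistrib
        matrix_vector_mul_assoc matrix_mul_assoc)
  also have "transpose A *v (P *v (A *v x)) =
      transpose AK *v (P *v (AK *v x)) + transpose Kl *v (Kl *v x) + transpose Kl *v (R *v (Kl *v x))"
    (is "?l = _")
  proof -
    have "A *v x = AK *v x + Bu *v (Kl *v x)" by (simp add: AK_vec)
    then have "transpose AK *v (P *v (A *v x)) = transpose AK *v (P *v (AK *v x)) + transpose Kl *v (Kl *v x)"
      by (simp add: matrix_vector_right_distrib AK_transpose_P_Bu)
    then show ?thesis by (simp add: A_transpose[of "P *v (A *v x)"] R_Kl)
  qed
  finally show ?thesis by simp
qed

text \<open>In terms of \<open>v = u + Kl x\<close> the next state is \<open>AK x + Bu v\<close>, and all mixed terms cancel because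
\<open>Bu\<^sup>* P AK = Kl\<close>.\<close>

lemma completion_of_squares:
  "x \<bullet> (Q *v x) + u \<bullet> u = (u + Kl *v x) \<bullet> (R *v (u + Kl *v x)) +
    (x \<bullet> (P *v x) - (A *v x + Bu *v u) \<bullet> (P *v (A *v x + Bu *v u)))"
proof -
  define v where "v = u + Kl *v x"
  have u: "u = v - Kl *v x" by (simp add: v_def)
  have x1: "A *v x + Bu *v u = AK *v x + Bu *v v"
    by (simp add: u AK_vec matrix_vector_mult_diff_distrib)
  have "(AK *v x) \<bullet> (P *v (Bu *v v)) = v \<bullet> (Kl *v x)"
    using P_inner[of "AK *v x" "Bu *v v"]
    by (simp add: Kl_AK[symmetric] inner_commute[of v] inner_matrix_left[symmetric])
      (simp add: inner_matrix_left P_sym inner_commute)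
  moreover have "(Bu *v v) \<bullet> (P *v (AK *v x)) = v \<bullet> (Kl *v x)"
    by (simp add: inner_matrix_left Kl_AK)
  moreover have "(Bu *v v) \<bullet> (P *v (Bu *v v)) = v \<bullet> (R *v v) - v \<bullet> v"
    by (simp add: inner_matrix_left R_vec inner_add_right)
  ultimately have "(A *v x + Bu *v u) \<bullet> (P *v (A *v x + Bu *v u)) =
      (AK *v x) \<bullet> (P *v (AK *v x)) + 2 * (v \<bullet> (Kl *v x)) + v \<bullet> (R *v v) - v \<bullet> v"
    by (simp add: x1 matrix_vector_right_distrib inner_add_left inner_add_right)
  moreover have "x \<bullet> (P *v x) = (AK *v x) \<bullet> (P *v (AK *v x)) + (Kl *v x) \<bullet> (Kl *v x) + x \<bullet> (Q *v x)"
    by (subst P_joseph) (simp add: inner_add_right inner_matrix_left)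
  moreover have "u \<bullet> u = v \<bullet> v - 2 * (v \<bullet> (Kl *v x)) + (Kl *v x) \<bullet> (Kl *v x)"
    by (simp add: u inner_diff_left inner_diff_right inner_commute)
  ultimately show ?thesis by (simp add: v_def[symmetric])
qed

lemma cost_nonneg: "0 \<le> (\<Sum>\<^sub>\<infinity>t. x t \<bullet> (Q *v x t) + u t \<bullet> u t)"
  by (intro infsum_nonneg add_nonneg_nonneg pos_semidefD(2)[OF Q_psd] inner_ge_zero)

text \<open>An impulse \<open>b\<close> in \<open>u + Kl x\<close> costs \<open>b \<bullet> R b\<close>, so \<open>R\<close> inherits its sign from the cost.\<close>

lemma R_pos_def: "pos_def R"
proof (rule pos_semidef_invertible_imp_pos_def[OF _ R_inv])
  have "0 \<le> b \<bullet> (R *v b)" for b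
  proof -
    define v where "v t = (if t = 0 then b else 0)" for t :: int
    have v: "v \<in> ell2" unfolding v_def by (rule ell2_single)
    define x where "x = ell2_response AK (\<lambda>t. Bu *v v t)"
    have x: "x \<in> ell2" "\<And>t. x (t + 1) = AK *v x t + Bu *v v t"
      unfolding x_def using ell2_response[OF schur_stable_imp_circle_free[OF AK_stable] ell2_matrix[OF v]]
      by auto
    define u where "u t = v t - Kl *v x t" for t
    have x1: "x (t + 1) = A *v x t + Bu *v u t" for t
      by (simp add: x(2) u_def AK_vec matrix_vector_mult_diff_distrib)
    have "(\<Sum>\<^sub>\<infinity>t. x t \<bullet> (Q *v x t) + u t \<bullet> u t) = (\<Sum>\<^sub>\<infinity>t. v t \<bullet> (R *v v t))"
    proof (rule infsum_telescope(1)[where h = "\<lambda>t. - (x t \<bullet> (P *v x t))"])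
      show "(\<lambda>t. v t \<bullet> (R *v v t)) summable_on UNIV"
        by (intro ell2_inner_summable ell2_matrix v)
      show "(\<lambda>t. - (x t \<bullet> (P *v x t))) summable_on UNIV"
        using ell2_inner_summable[OF x(1) ell2_matrix[OF x(1)]] by (simp add: summable_on_uminus)
      show "x t \<bullet> (Q *v x t) + u t \<bullet> u t = v t \<bullet> (R *v v t) +
          (- (x (t + 1) \<bullet> (P *v x (t + 1))) - - (x t \<bullet> (P *v x t)))" for t
        using completion_of_squares[of "x t" "u t"] by (simp add: x1 u_def)
    qed
    also have "(\<lambda>t. v t \<bullet> (R *v v t)) = (\<lambda>t. if t = 0 then b \<bullet> (R *v b) else 0)"
      by (auto simp: v_def)
    also have "infsum (\<lambda>t::int. if t = 0 then b \<bullet> (R *v b) else 0) UNIV = b \<bullet> (R *v b)"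
      by (rule infsumI[OF has_sum_single])
    finally show ?thesis using cost_nonneg by metis
  qed
  then show "pos_semidef R" using R_sym by (simp add: pos_semidef_def)
qed

end

section \<open>The clairvoyant cost and the excess cost\<close>

locale clairvoyant = lqr A Bu Q P
  for A :: "real^'n^'n" and Bu :: "real^'p^'n" and Q P +
  fixes Bw :: "real^'m^'n" and T M U :: "real^'n^'n"
  assumes A_circle_free: "circle_free A"
    and T: "stabilizing_T A Bu Q T"
    and M: "stabilizing_M A Bw Q T M"
    and U: "solves_U A Bu Bw Q P T M U"
begin

abbreviation "AT \<equiv> A_T A Q T"
abbreviation "RM \<equiv> R_M Bw Q T M"
abbreviation "KM \<equiv> K_M A Bw Q T M"
abbreviation "AM \<equiv> A_M A Bw Q T M"

text \<open>\<open>H\<close> is the inverse of \<open>Q\<^sup>-\<^sup>1 + T\<close>, the weight with which the innovation state enters the clairvoyant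
cost. \<open>N\<close> is the input matrix of the anticausal part of the optimal control.\<close>

definition "H = msqrt Q ** matrix_inv (R_T Q T) ** msqrt Q"
definition "N = (P - transpose AK ** U) ** Bw"

lemma T_sym: "transpose T = T" and AT_stable: "schur_stable AT"
  and T_inv: "invertible (R_T Q T)" "invertible (matrix_inv Q + T)"
  and T_eq: "T = A ** T ** transpose A + Bu ** transpose Bu
         - A ** T ** msqrt Q ** matrix_inv (R_T Q T) ** msqrt Q ** T ** transpose A"
  using T by (auto simp: stabilizing_T_def)

lemma M_sym: "transpose M = M" and RM_inv: "invertible RM" and AM_stable: "schur_stable AM"
  and M_eq: "M = transpose AT ** M ** AT
         + transpose AT ** msqrt Q ** matrix_inv (R_T Q T) ** msqrt Q ** AT
         - transpose KM ** RM ** KM"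
  using M by (auto simp: stabilizing_M_def)

lemmas S = msqrt_properties[OF Q_psd]

lemma S_S: "msqrt Q *v (msqrt Q *v x) = Q *v x"
  by (simp add: matrix_vector_mul_assoc S)

lemma R_T_vec: "R_T Q T *v x = x + msqrt Q *v (T *v (msqrt Q *v x))"
  by (simp add: R_T_def matrix_vector_mult_add_rdistrib matrix_vector_mul_assoc matrix_mul_assoc)

lemma H_vec: "H *v x = msqrt Q *v (matrix_inv (R_T Q T) *v (msqrt Q *v x))"
  by (simp add: H_def matrix_vector_mul_assoc matrix_mul_assoc)

lemma H_sym: "transpose H = H"
proof -
  have "transpose (R_T Q T) = R_T Q T"
    by (rule transpose_eqI)
      (simp add: R_T_vec inner_add_left inner_add_right inner_matrix_left S T_sym)
  then have "transpose (matrix_inv (R_T Q T)) = matrix_inv (R_T Q T)"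
    by (rule symmetric_matrix_inv[OF _ T_inv(1)])
  then show ?thesis by (simp add: H_def matrix_transpose_mul S matrix_mul_assoc)
qed

lemma H_eq_inverse: "H = matrix_inv (matrix_inv Q + T)"
proof (rule matrix_eqI)
  fix x
  note Qi = matrix_inv_vector[OF pos_def_invertible[OF Q]]
  have S_inj: "y = z" if "msqrt Q *v y = msqrt Q *v z" for y z
    using arg_cong[OF that, of "\<lambda>v. matrix_inv Q *v (msqrt Q *v v)"] by (simp add: S_S Qi)
  define y where "y = matrix_inv (R_T Q T) *v (msqrt Q *v x)"
  have y: "y + msqrt Q *v (T *v (msqrt Q *v y)) = msqrt Q *v x"
    using matrix_inv_vector(1)[OF T_inv(1), of "msqrt Q *v x"] by (simp add: y_def R_T_vec)
  have SQiS: "msqrt Q *v (matrix_inv Q *v (msqrt Q *v y)) = y"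
    by (rule S_inj) (simp add: S_S Qi)
  have "(matrix_inv Q + T) *v (H *v x) = x"
    by (rule S_inj) (simp add: SQiS H_vec y_def[symmetric] matrix_vector_mult_add_rdistrib
        matrix_vector_right_distrib y)
  then show "H *v x = matrix_inv (matrix_inv Q + T) *v x"
    using matrix_inv_vector(2)[OF T_inv(2), of "H *v x"] by simp
qed

text \<open>\<open>H (Q\<^sup>-\<^sup>1 + T) = I\<close>, applied to \<open>Q x\<close>.\<close>

lemma H_Q: "Q *v x = H *v x + H *v (T *v (Q *v x))"
  using matrix_inv_vector(2)[OF T_inv(2), of "Q *v x"]
  by (simp add: H_eq_inverse[symmetric] matrix_vector_mult_add_rdistrib matrix_vector_right_distrib
      matrix_inv_vector[OF pos_def_invertible[OF Q]])

lemma AT_vec: "AT *v x = A *v x - A *v (T *v (H *v x))"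
  by (simp add: A_T_def H_eq_inverse[symmetric] matrix_vector_mult_diff_rdistrib
      matrix_vector_mul_assoc matrix_mul_assoc)

lemma AT_transpose: "transpose AT *v x = transpose A *v x - H *v (T *v (transpose A *v x))"
proof -
  have "y \<bullet> (transpose AT *v x) = y \<bullet> (transpose A *v x - H *v (T *v (transpose A *v x)))" for y
  proof -
    have "y \<bullet> (transpose AT *v x) = (A *v y - A *v (T *v (H *v y))) \<bullet> x"
      by (simp add: inner_matrix_left[symmetric] AT_vec)
    then show ?thesis
      by (simp add: inner_diff_left inner_diff_right inner_matrix_left T_sym H_sym)
  qed
  then show ?thesis by (metis vector_eq_ldot)
qed

lemma T_vec: "T *v x = AT *v (T *v (transpose A *v x)) + Bu *v (transpose Bu *v x)"
proof -
  have "T *v x = A *v (T *v (transpose A *v x)) + Bu *v (transpose Bu *v x)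
      - A *v (T *v (H *v (T *v (transpose A *v x))))"
    by (subst T_eq) (simp add: H_def matrix_vector_mult_add_rdistrib matrix_vector_mult_diff_rdistrib
        matrix_vector_mul_assoc matrix_mul_assoc)
  then show ?thesis by (simp add: AT_vec)
qed

text \<open>The filter Riccati equation decouples the two-point boundary value problem of the clairvoyant
optimum: in the variables \<open>x + T k\<close> and \<open>k\<close> the state recursion runs forward with \<open>AT\<close> and does not
involve the costate, while the costate runs backward with the transpose of \<open>AT\<close>.\<close>

lemma innovation_state_step:
  assumes x1: "x1 = A *v x - Bu *v (transpose Bu *v k1) + Bw *v w"
    and k: "k = transpose A *v k1 + Q *v x"
  shows "x1 + T *v k1 = AT *v (x + T *v k) + Bw *v w"
    and "k = transpose AT *v k1 + H *v (x + T *v k)"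
proof -
  have "AT *v (T *v (Q *v x)) = A *v (T *v (Q *v x - H *v (T *v (Q *v x))))"
    by (simp add: AT_vec matrix_vector_mult_diff_distrib)
  also have "Q *v x - H *v (T *v (Q *v x)) = H *v x"
    unfolding diff_eq_eq by (rule H_Q)
  finally have "AT *v x + AT *v (T *v (Q *v x)) = A *v x" by (simp add: AT_vec)
  then show "x1 + T *v k1 = AT *v (x + T *v k) + Bw *v w"
    by (simp add: x1 k T_vec[of k1] matrix_vector_right_distrib algebra_simps)
  show "k = transpose AT *v k1 + H *v (x + T *v k)"
    using H_Q[of x] by (simp add: k AT_transpose matrix_vector_right_distrib)
qed

lemma RM_vec: "RM *v x = transpose Bw *v ((M + H) *v (Bw *v x))"
  by (simp add: R_M_def H_def matrix_vector_mult_add_rdistrib matrix_vector_right_distrib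
      matrix_vector_mul_assoc[symmetric] add.commute)

lemma RM_KM: "RM *v (KM *v x) = transpose Bw *v ((M + H) *v (AT *v x))"
proof -
  have "KM *v x = matrix_inv RM *v (transpose Bw *v ((M + H) *v (AT *v x)))"
    by (simp add: K_M_def H_def matrix_vector_mult_add_rdistrib matrix_vector_right_distrib
        matrix_vector_mul_assoc[symmetric])
  then show ?thesis by (simp add: matrix_inv_vector[OF RM_inv])
qed

lemma MH_sym: "transpose (M + H) = M + H"
  by (simp add: transpose_add M_sym H_sym)

lemma RM_sym: "transpose RM = RM"
  by (rule transpose_eqI) (simp add: RM_vec inner_matrix_left MH_sym)

lemma AM_vec: "AM *v x = AT *v x - Bw *v (KM *v x)"
  by (simp add: A_M_def matrix_vector_mult_diff_rdistrib matrix_vector_mul_assoc)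

text \<open>Completion of squares with \<open>M\<close>, which turns the weight \<open>H\<close> on the innovation state into the weight
\<open>RM\<close> on the innovation.\<close>

lemma innovation_energy:
  assumes x1: "x1 = AT *v x + Bw *v w"
  shows "x1 \<bullet> ((M + H) *v x1) = x \<bullet> (M *v x) + (w + KM *v x) \<bullet> (RM *v (w + KM *v x))"
proof -
  let ?G = "M + H"
  have "M *v x = transpose AT *v (?G *v (AT *v x)) - transpose KM *v (RM *v (KM *v x))"
    by (subst M_eq) (simp add: H_def matrix_vector_mult_add_rdistrib matrix_vector_mult_diff_rdistrib
        matrix_vector_right_distrib matrix_vector_mul_assoc[symmetric])
  then have "x \<bullet> (M *v x) = (AT *v x) \<bullet> (?G *v (AT *v x)) - (KM *v x) \<bullet> (RM *v (KM *v x))"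
    by (simp add: inner_diff_right inner_matrix_left)
  moreover have "(Bw *v w) \<bullet> (?G *v (AT *v x)) = w \<bullet> (RM *v (KM *v x))"
    by (simp add: inner_matrix_left RM_KM)
  moreover have "(AT *v x) \<bullet> (?G *v (Bw *v w)) = w \<bullet> (RM *v (KM *v x))"
    using symmetric_inner[OF MH_sym, of "AT *v x" "Bw *v w"]
    by (metis calculation(2) inner_commute)
  moreover have "(Bw *v w) \<bullet> (?G *v (Bw *v w)) = w \<bullet> (RM *v w)"
    by (simp add: inner_matrix_left RM_vec)
  moreover have "(KM *v x) \<bullet> (RM *v w) = w \<bullet> (RM *v (KM *v x))"
    using symmetric_inner[OF RM_sym, of "KM *v x" w] by (simp add: inner_commute)
  ultimately show ?thesis
    by (simp add: x1 matrix_vector_right_distrib inner_add_left inner_add_right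
        del: matrix_vector_mult_add_rdistrib)
qed

text \<open>The clairvoyant optimum \<open>(x, u)\<close> with its costate \<open>k\<close>, the innovation state \<open>\<xi>\<close> and the anticausal
signal \<open>s\<close>. The last equation splits the optimal \<open>u + Kl x\<close> into a causal and an anticausal part.\<close>

definition optimal_signals ::
  "(int \<Rightarrow> real^'m) \<Rightarrow> (int \<Rightarrow> real^'n) \<Rightarrow> (int \<Rightarrow> real^'p) \<Rightarrow> (int \<Rightarrow> real^'n) \<Rightarrow> (int \<Rightarrow> real^'n)
    \<Rightarrow> (int \<Rightarrow> real^'n) \<Rightarrow> bool" where
  "optimal_signals w x u k \<xi> s \<longleftrightarrow>
    x \<in> ell2 \<and> u \<in> ell2 \<and> k \<in> ell2 \<and> \<xi> \<in> ell2 \<and> s \<in> ell2 \<and>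
    (\<forall>t. x (t + 1) = A *v x t + Bu *v u t + Bw *v w t \<and>
         u t = - (transpose Bu *v k (t + 1)) \<and>
         k t = transpose A *v k (t + 1) + Q *v x t \<and>
         \<xi> t = x t + T *v k t \<and>
         \<xi> (t + 1) = AT *v \<xi> t + Bw *v w t \<and>
         k t = transpose AT *v k (t + 1) + H *v \<xi> t \<and>
         s t = transpose AK *v s (t + 1) + N *v (w t + KM *v \<xi> t) \<and>
         u t + Kl *v x t = Ri *v (transpose Bu *v (U *v \<xi> t - s t)))"

text \<open>The backward recursion for \<open>q = k - P x\<close> does not involve the state, so \<open>q\<close> comes first and the
trajectory follows forward in closed loop. The equation of \<open>U\<close> is the one for which adding
\<open>U \<xi>\<close> to \<open>m t = q (t + 1) + P Bw (w t)\<close> leaves a signal driven by the innovation alone.\<close>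

lemma optimal_signals_exist:
  assumes w: "w \<in> ell2"
  obtains x u k \<xi> s where "optimal_signals w x u k \<xi> s"
proof -
  note cf = schur_stable_imp_circle_free[OF AK_stable]
  obtain q where q: "q \<in> ell2" "\<And>t. q t = transpose AK *v q (t + 1) + transpose AK *v (P *v (Bw *v w t))"
    using backward_solution_exists[OF cf, of "\<lambda>t. transpose AK *v (P *v (Bw *v w t))"]
      ell2_matrix[OF ell2_matrix[OF ell2_matrix[OF w]]] by blast
  define m where "m t = q (t + 1) + P *v (Bw *v w t)" for t
  define v where "v t = - (Ri *v (transpose Bu *v m t))" for t
  have m: "m \<in> ell2" unfolding m_def by (intro ell2_add ell2_shift ell2_matrix q w)
  have v: "v \<in> ell2" unfolding v_def by (intro ell2_minus ell2_matrix m)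
  have qm: "q t = transpose AK *v m t" for t
    by (subst q(2)) (simp add: m_def matrix_vector_right_distrib)
  have Rv: "R *v v t = - (transpose Bu *v m t)" for t
    by (simp add: v_def matrix_vector_mult_minus_right matrix_inv_vector[OF R_inv])
  define x where "x = ell2_response AK (\<lambda>t. Bu *v v t + Bw *v w t)"
  have x: "x \<in> ell2" "\<And>t. x (t + 1) = AK *v x t + (Bu *v v t + Bw *v w t)"
    unfolding x_def using ell2_response[OF cf ell2_add[OF ell2_matrix[OF v] ell2_matrix[OF w]]] by auto
  define u where "u t = v t - Kl *v x t" for t
  define k where "k t = P *v x t + q t" for t
  define \<xi> where "\<xi> t = x t + T *v k t" for t
  define s where "s t = m t + U *v \<xi> t" for t
  have u: "u \<in> ell2" unfolding u_def by (intro ell2_diff ell2_matrix v x)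
  have k: "k \<in> ell2" unfolding k_def by (intro ell2_add ell2_matrix q x)
  have \<xi>: "\<xi> \<in> ell2" unfolding \<xi>_def by (intro ell2_add ell2_matrix k x)
  have s: "s \<in> ell2" unfolding s_def by (intro ell2_add ell2_matrix m \<xi>)
  have x1: "x (t + 1) = A *v x t + Bu *v u t + Bw *v w t" for t
    by (simp add: x(2) u_def AK_vec matrix_vector_mult_diff_distrib)
  have k1: "k (t + 1) = P *v (AK *v x t) + P *v (Bu *v v t) + m t" for t
    by (simp add: k_def x(2) m_def matrix_vector_right_distrib)
  have Buk: "transpose Bu *v k (t + 1) = Kl *v x t - v t" for t
  proof -
    have "transpose Bu *v (P *v (Bu *v v t)) = - (transpose Bu *v m t) - v t"
      using Rv[of t] unfolding R_vec by (metis add_diff_cancel_left')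
    then show ?thesis by (simp add: k1 matrix_vector_right_distrib Kl_AK)
  qed
  have uk: "u t = - (transpose Bu *v k (t + 1))" for t
    by (simp add: Buk u_def)
  have kt: "k t = transpose A *v k (t + 1) + Q *v x t" for t
  proof -
    have "transpose A *v k (t + 1) = transpose AK *v k (t + 1) + transpose Kl *v (Kl *v x t) - transpose Kl *v v t"
      by (simp add: A_transpose Buk matrix_vector_mult_diff_distrib)
    also have "transpose AK *v k (t + 1) = transpose AK *v (P *v (AK *v x t)) + transpose Kl *v v t + q t"
      by (simp add: k1 matrix_vector_right_distrib AK_transpose_P_Bu qm)
    finally show ?thesis using P_joseph[of "x t"] by (simp add: k_def)
  qed
  have x1k: "x (t + 1) = A *v x t - Bu *v (transpose Bu *v k (t + 1)) + Bw *v w t" for t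
    by (simp add: x1 uk matrix_vector_mult_minus_right)
  have \<xi>1: "\<xi> (t + 1) = AT *v \<xi> t + Bw *v w t" and kH: "k t = transpose AT *v k (t + 1) + H *v \<xi> t" for t
    using innovation_state_step[OF x1k kt, of t] by (simp_all add: \<xi>_def)
  have s_rec: "s t = transpose AK *v s (t + 1) + N *v (w t + KM *v \<xi> t)" for t
  proof -
    define e where "e = w t + KM *v \<xi> t"
    have "\<xi> (t + 1) = AM *v \<xi> t + Bw *v e"
      by (simp add: \<xi>1 AM_vec e_def matrix_vector_right_distrib)
    moreover have "U *v \<xi> t = transpose AK *v (U *v (AM *v \<xi> t)) + P *v (Bw *v (KM *v \<xi> t))"
      using arg_cong[OF U[unfolded solves_U_def], of "\<lambda>X. X *v \<xi> t"]
      by (simp add: matrix_vector_mult_add_rdistrib matrix_vector_mul_assoc matrix_mul_assoc)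
    moreover have "N *v e = P *v (Bw *v e) - transpose AK *v (U *v (Bw *v e))"
      by (simp add: N_def matrix_vector_mult_diff_rdistrib matrix_vector_mul_assoc[symmetric])
    moreover have "P *v (Bw *v e) = P *v (Bw *v w t) + P *v (Bw *v (KM *v \<xi> t))"
      by (simp add: e_def matrix_vector_right_distrib)
    moreover have "transpose AK *v m (t + 1) = q (t + 1)" by (simp add: qm)
    ultimately show ?thesis
      by (simp add: s_def m_def[of t] matrix_vector_right_distrib e_def[symmetric])
  qed
  have vs: "u t + Kl *v x t = Ri *v (transpose Bu *v (U *v \<xi> t - s t))" for t
    by (simp add: u_def v_def s_def matrix_vector_mult_minus_right)
  have "optimal_signals w x u k \<xi> s"
    unfolding optimal_signals_def
    by (intro conjI allI x(1) u k \<xi> s x1 uk kt \<xi>_def \<xi>1 kH s_rec vs)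
  then show thesis by (rule that)
qed

lemma optimal_signalsD:
  assumes "optimal_signals w x u k \<xi> s"
  shows "x \<in> ell2" "u \<in> ell2" "k \<in> ell2" "\<xi> \<in> ell2" "s \<in> ell2"
    "x (t + 1) = A *v x t + Bu *v u t + Bw *v w t"
    "u t = - (transpose Bu *v k (t + 1))"
    "k t = transpose A *v k (t + 1) + Q *v x t"
    "\<xi> t = x t + T *v k t"
    "\<xi> (t + 1) = AT *v \<xi> t + Bw *v w t"
    "k t = transpose AT *v k (t + 1) + H *v \<xi> t"
    "s t = transpose AK *v s (t + 1) + N *v (w t + KM *v \<xi> t)"
    "u t + Kl *v x t = Ri *v (transpose Bu *v (U *v \<xi> t - s t))"
  using assms unfolding optimal_signals_def by blast+

text \<open>The difference from the optimum is orthogonal to the optimum, by the costate equation, and its own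
cost is that of its regulator residual \<open>r\<close>. The cost of the optimum is first rewritten in terms of
\<open>H\<close> and then in terms of \<open>RM\<close>. All steps are telescoping, with the storage function \<open>h\<close>
collecting the five increments.\<close>

lemma cost_decomposition:
  assumes opt: "optimal_signals w xo uo k \<xi> s" and w: "w \<in> ell2"
    and x: "x \<in> ell2" and u: "u \<in> ell2"
    and x1: "\<And>t. x (t + 1) = A *v x t + Bu *v u t + Bw *v w t"
  defines "e \<equiv> \<lambda>t. w t + KM *v \<xi> t"
    and "r \<equiv> \<lambda>t. u t + Kl *v x t - Ri *v (transpose Bu *v (U *v \<xi> t - s t))"
  shows "(\<Sum>\<^sub>\<infinity>t. x t \<bullet> (Q *v x t) + u t \<bullet> u t) =
    (\<Sum>\<^sub>\<infinity>t. e t \<bullet> (RM *v e t)) + (\<Sum>\<^sub>\<infinity>t. r t \<bullet> (R *v r t))"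
proof -
  note o = optimal_signalsD[OF opt]
  define y where "y t = x t - xo t" for t
  define v where "v t = u t - uo t" for t
  have y: "y \<in> ell2" unfolding y_def by (intro ell2_diff x o)
  have e: "e \<in> ell2" unfolding e_def by (intro ell2_add ell2_matrix w o)
  have r: "r \<in> ell2" unfolding r_def by (intro ell2_add ell2_diff ell2_matrix x u o)
  have y1: "y (t + 1) = A *v y t + Bu *v v t" for t
    by (simp add: y_def v_def x1 o(6) matrix_vector_mult_diff_distrib)
  have rt: "r t = v t + Kl *v y t" for t
    unfolding r_def o(13)[symmetric] by (simp add: v_def y_def matrix_vector_mult_diff_distrib)
  define h where "h t = k t \<bullet> \<xi> t - xo t \<bullet> k t - \<xi> t \<bullet> ((M + H) *v \<xi> t)
    - y t \<bullet> (P *v y t) - 2 * (y t \<bullet> k t)" for t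
  have h: "h summable_on UNIV"
  proof -
    have "(\<lambda>t. k t \<bullet> \<xi> t + - 1 * (xo t \<bullet> k t) + - 1 * (\<xi> t \<bullet> ((M + H) *v \<xi> t))
      + - 1 * (y t \<bullet> (P *v y t)) + - 2 * (y t \<bullet> k t)) summable_on UNIV"
      by (intro summable_on_add summable_on_cmult_right ell2_inner_summable ell2_matrix y o)
    then show ?thesis by (simp add: h_def[abs_def])
  qed
  have eR: "(\<lambda>t. e t \<bullet> (RM *v e t)) summable_on UNIV" and rR: "(\<lambda>t. r t \<bullet> (R *v r t)) summable_on UNIV"
    by (intro ell2_inner_summable ell2_matrix e r)+
  have step: "x t \<bullet> (Q *v x t) + u t \<bullet> u t =
      (e t \<bullet> (RM *v e t) + r t \<bullet> (R *v r t)) + (h (t + 1) - h t)" for t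
  proof -
    let ?k1 = "k (t + 1)"
    have "x t \<bullet> (Q *v x t) + u t \<bullet> u t = (y t \<bullet> (Q *v y t) + v t \<bullet> v t)
        + (xo t \<bullet> (Q *v xo t) + uo t \<bullet> uo t) + 2 * (y t \<bullet> (Q *v xo t) + v t \<bullet> uo t)"
    proof -
      have "x t = y t + xo t" "u t = v t + uo t" by (simp_all add: y_def v_def)
      moreover have "xo t \<bullet> (Q *v y t) = y t \<bullet> (Q *v xo t)"
        using Q_inner[of "xo t" "y t"] by (simp add: inner_commute)
      ultimately show ?thesis
        by (simp add: matrix_vector_right_distrib inner_add_left inner_add_right inner_commute)
    qed
    moreover have "y t \<bullet> (Q *v y t) + v t \<bullet> v t =
        r t \<bullet> (R *v r t) + (y t \<bullet> (P *v y t) - y (t + 1) \<bullet> (P *v y (t + 1)))"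
      unfolding rt y1 by (rule completion_of_squares)
    moreover have "y t \<bullet> (Q *v xo t) + v t \<bullet> uo t = y t \<bullet> k t - y (t + 1) \<bullet> ?k1"
    proof -
      have "y t \<bullet> (Q *v xo t) = y t \<bullet> k t - (A *v y t) \<bullet> ?k1"
        by (subst o(8)[of t]) (simp add: inner_add_right inner_matrix_left)
      moreover have "v t \<bullet> uo t = - ((Bu *v v t) \<bullet> ?k1)"
        by (simp add: o(7) inner_matrix_left)
      ultimately show ?thesis by (simp add: y1 inner_add_left)
    qed
    moreover have "xo t \<bullet> (Q *v xo t) + uo t \<bullet> uo t =
        \<xi> t \<bullet> (H *v \<xi> t) + (?k1 \<bullet> \<xi> (t + 1) - k t \<bullet> \<xi> t) - (xo (t + 1) \<bullet> ?k1 - xo t \<bullet> k t)"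
    proof -
      have "xo t \<bullet> (Q *v xo t) = xo t \<bullet> k t - (A *v xo t) \<bullet> ?k1"
        by (subst o(8)[of t]) (simp add: inner_add_right inner_matrix_left)
      moreover have "uo t \<bullet> uo t = - ((Bu *v uo t) \<bullet> ?k1)"
        by (subst (2) o(7)[of t]) (simp add: inner_matrix_left)
      moreover have "xo (t + 1) \<bullet> ?k1 = (A *v xo t) \<bullet> ?k1 + (Bu *v uo t) \<bullet> ?k1 + (Bw *v w t) \<bullet> ?k1"
        by (simp add: o(6) inner_add_left)
      moreover have "?k1 \<bullet> \<xi> (t + 1) = (AT *v \<xi> t) \<bullet> ?k1 + (Bw *v w t) \<bullet> ?k1"
        by (simp add: o(10) inner_add_right inner_commute)
      moreover have "k t \<bullet> \<xi> t = (AT *v \<xi> t) \<bullet> ?k1 + \<xi> t \<bullet> (H *v \<xi> t)"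
        by (subst inner_commute, subst o(11)[of t]) (simp add: inner_add_right inner_matrix_left)
      ultimately show ?thesis by linarith
    qed
    moreover have "\<xi> (t + 1) \<bullet> ((M + H) *v \<xi> (t + 1)) = \<xi> t \<bullet> (M *v \<xi> t) + e t \<bullet> (RM *v e t)"
      unfolding e_def by (rule innovation_energy[OF o(10)])
    moreover have "\<xi> t \<bullet> ((M + H) *v \<xi> t) = \<xi> t \<bullet> (M *v \<xi> t) + \<xi> t \<bullet> (H *v \<xi> t)"
      by (simp add: matrix_vector_mult_add_rdistrib inner_add_right)
    \<comment> \<open>The linear combination of the preceding facts, with all inner products generalized to reals.\<close>
    moreover have "X = (b + r) + ((kx1 - xk1 - G1 - p1 - 2 * c1) - (kx - xk - G - p - 2 * c))"
      if "X = Y + O' + 2 * C" "Y = r + (p - p1)" "C = c - c1" "O' = h + (kx1 - kx) - (xk1 - xk)"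
        "G1 = m + b" "G = m + h"
      for X Y O' C r p p1 c c1 h kx kx1 xk xk1 G G1 m b :: real
      using that by linarith
    ultimately show ?thesis unfolding h_def by blast
  qed
  show ?thesis
    using infsum_telescope(1)[OF summable_on_add[OF eR rR] h step] infsum_add[OF eR rR] by simp
qed

lemma clairvoyant_energy:
  assumes opt: "optimal_signals w xo uo k \<xi> s" and w: "w \<in> ell2"
  shows "(\<Sum>\<^sub>\<infinity>t. xo t \<bullet> (Q *v xo t) + uo t \<bullet> uo t) =
    (\<Sum>\<^sub>\<infinity>t. (w t + KM *v \<xi> t) \<bullet> (RM *v (w t + KM *v \<xi> t)))"
proof -
  note o = optimal_signalsD[OF opt]
  show ?thesis
    using cost_decomposition[OF opt w o(1,2,6)] by (simp add: o(13))
qed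

lemma noncausal_cost_eq:
  assumes opt: "optimal_signals w xo uo k \<xi> s" and w: "w \<in> ell2"
  shows "noncausal_cost A Bu Bw Q w =
    ennreal (\<Sum>\<^sub>\<infinity>t. (w t + KM *v \<xi> t) \<bullet> (RM *v (w t + KM *v \<xi> t)))"
proof -
  note o = optimal_signalsD[OF opt]
  have nc: "noncausal_controller A Bu Bw Q w = uo"
    by (rule noncausal_controller_eqI[OF A_circle_free Q_psd w o(2,1,6,3,8,7)])
  have "ell2_response A (\<lambda>t. Bu *v uo t + Bw *v w t) = xo"
    by (rule ell2_response_eqI[OF A_circle_free])
      (auto intro!: ell2_add ell2_matrix o(1,2) w simp: o(6))
  then show ?thesis
    using cost_ell2[OF Q_psd o(1,2)] clairvoyant_energy[OF opt w]
    by (simp add: noncausal_cost_def nc)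
qed

text \<open>The map from disturbance to innovation is causally invertible, as \<open>AM\<close> is stable.\<close>

lemma innovation_realizable:
  assumes e: "e \<in> ell2"
  obtains w \<xi> where "w \<in> ell2" "\<xi> \<in> ell2" "\<And>t. \<xi> (t + 1) = AT *v \<xi> t + Bw *v w t"
    "\<And>t. w t + KM *v \<xi> t = e t" "\<And>t. (\<And>i. i < t \<Longrightarrow> e i = 0) \<Longrightarrow> \<xi> t = 0"
proof -
  note cf = schur_stable_imp_circle_free[OF AM_stable]
  define \<xi> where "\<xi> = ell2_response AM (\<lambda>t. Bw *v e t)"
  define w where "w t = e t - KM *v \<xi> t" for t
  have \<xi>: "\<xi> \<in> ell2" "\<And>t. \<xi> (t + 1) = AM *v \<xi> t + Bw *v e t"
    unfolding \<xi>_def using ell2_response[OF cf ell2_matrix[OF e]] by auto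
  have "w \<in> ell2" unfolding w_def by (intro ell2_diff ell2_matrix e \<xi>)
  moreover have "\<xi> (t + 1) = AT *v \<xi> t + Bw *v w t" for t
    by (simp add: \<xi>(2) AM_vec w_def matrix_vector_mult_diff_distrib)
  moreover have "\<xi> t = 0" if "\<And>i. i < t \<Longrightarrow> e i = 0" for t
    by (rule stable_solutions_agree[OF AM_stable \<xi>(1) ell2_zero, of t]) (simp_all add: \<xi>(2) that)
  ultimately show thesis using \<xi>(1) by (intro that[of w \<xi>]) (simp_all add: w_def)
qed

lemma innovation_state_unique:
  assumes "w \<in> ell2" "\<xi> \<in> ell2" "\<And>t. \<xi> (t + 1) = AT *v \<xi> t + Bw *v w t"
    and "\<zeta> \<in> ell2" "\<And>t. \<zeta> (t + 1) = AT *v \<zeta> t + Bw *v w t"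
  shows "\<xi> = \<zeta>"
  by (rule ell2_solution_unique[OF schur_stable_imp_circle_free[OF AT_stable] assms(2-5)])

text \<open>A disturbance whose innovation is an impulse \<open>b\<close> has the clairvoyant cost \<open>b \<bullet> RM b\<close>, so \<open>RM\<close>
inherits its sign from the cost.\<close>

lemma RM_pos_def: "pos_def RM"
proof (rule pos_semidef_invertible_imp_pos_def[OF _ RM_inv])
  have "0 \<le> b \<bullet> (RM *v b)" for b
  proof -
    define e where "e t = (if t = 0 then b else 0)" for t :: int
    have "e \<in> ell2" unfolding e_def by (rule ell2_single)
    then obtain w \<xi> where w: "w \<in> ell2" and \<xi>: "\<xi> \<in> ell2" "\<And>t. \<xi> (t + 1) = AT *v \<xi> t + Bw *v w t"
      and we: "\<And>t. w t + KM *v \<xi> t = e t"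
      using innovation_realizable by metis
    obtain xo uo k \<zeta> s where opt: "optimal_signals w xo uo k \<zeta> s"
      using optimal_signals_exist[OF w] by blast
    have "\<zeta> = \<xi>"
      using innovation_state_unique[OF w optimal_signalsD(4,10)[OF opt] \<xi>] .
    then have "(\<Sum>\<^sub>\<infinity>t. e t \<bullet> (RM *v e t)) = (\<Sum>\<^sub>\<infinity>t. xo t \<bullet> (Q *v xo t) + uo t \<bullet> uo t)"
      using clairvoyant_energy[OF opt w] by (simp add: we)
    moreover have "(\<lambda>t. e t \<bullet> (RM *v e t)) = (\<lambda>t. if t = 0 then b \<bullet> (RM *v b) else 0)"
      by (auto simp: e_def)
    moreover have "infsum (\<lambda>t::int. if t = 0 then b \<bullet> (RM *v b) else 0) UNIV = b \<bullet> (RM *v b)"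
      by (rule infsumI[OF has_sum_single])
    ultimately show ?thesis using cost_nonneg[of xo uo] by simp
  qed
  then show "pos_semidef RM" using RM_sym by (simp add: pos_semidef_def)
qed

lemma innovation_energy_pos:
  assumes w: "w \<in> ell2" and "w \<noteq> (\<lambda>_. 0)" and \<xi>: "\<xi> \<in> ell2" "\<And>t. \<xi> (t + 1) = AT *v \<xi> t + Bw *v w t"
  shows "0 < (\<Sum>\<^sub>\<infinity>t. (w t + KM *v \<xi> t) \<bullet> (RM *v (w t + KM *v \<xi> t)))"
proof -
  define e where "e t = w t + KM *v \<xi> t" for t
  have e: "e \<in> ell2" unfolding e_def by (intro ell2_add ell2_matrix w \<xi>)
  have nonneg: "0 \<le> e t \<bullet> (RM *v e t)" for t
    by (rule pos_semidefD(2)[OF pos_def_imp_pos_semidef[OF RM_pos_def]])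
  have "\<exists>t. e t \<noteq> 0"
  proof (rule ccontr)
    assume e0: "\<not> ?thesis"
    then have wt: "w t = - (KM *v \<xi> t)" for t by (simp add: e_def add_eq_0_iff)
    then have "\<xi> (t + 1) = AM *v \<xi> t + 0" for t
      by (simp add: \<xi>(2) AM_vec matrix_vector_mult_minus_right)
    then have "\<xi> = (\<lambda>_. 0)"
      by (rule ell2_solution_unique[OF schur_stable_imp_circle_free[OF AM_stable] \<xi>(1)]) simp_all
    then show False using wt \<open>w \<noteq> (\<lambda>_. 0)\<close> by auto
  qed
  then obtain t where "e t \<noteq> 0" by blast
  then have "0 < e t \<bullet> (RM *v e t)" using RM_pos_def by (simp add: pos_def_def)
  also have "\<dots> \<le> (\<Sum>\<^sub>\<infinity>t. e t \<bullet> (RM *v e t))"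
    using finite_sum_le_infsum[of "\<lambda>t. e t \<bullet> (RM *v e t)" UNIV "{t}"] nonneg
      ell2_inner_summable[OF e ell2_matrix[OF e]] by simp
  finally show ?thesis by (simp add: e_def)
qed

end

section \<open>Strictly causal maps\<close>

text \<open>Nonstrict causality, with square summable values. Signals of this kind drive the state equations,
whose responses are then strictly causal.\<close>

definition causal_linear :: "((int \<Rightarrow> 'a::real_inner) \<Rightarrow> (int \<Rightarrow> 'b::real_inner)) \<Rightarrow> bool" where
  "causal_linear f \<longleftrightarrow>
     (\<forall>v\<in>ell2. f v \<in> ell2) \<and>
     (\<forall>v\<in>ell2. \<forall>w\<in>ell2. \<forall>a b t. f (\<lambda>s. a *\<^sub>R v s + b *\<^sub>R w s) t = a *\<^sub>R f v t + b *\<^sub>R f w t) \<and>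
     (\<forall>v\<in>ell2. \<forall>w\<in>ell2. \<forall>t. (\<forall>i\<le>t. v i = w i) \<longrightarrow> f v t = f w t)"

lemma causal_linearD:
  assumes "causal_linear f" "v \<in> ell2" "w \<in> ell2"
  shows "f v \<in> ell2" "f (\<lambda>s. a *\<^sub>R v s + b *\<^sub>R w s) t = a *\<^sub>R f v t + b *\<^sub>R f w t"
    "(\<And>i. i \<le> t \<Longrightarrow> v i = w i) \<Longrightarrow> f v t = f w t"
  using assms unfolding causal_linear_def by blast+

lemma strictly_causalD:
  assumes "strictly_causal f" "v \<in> ell2" "w \<in> ell2"
  shows "f (\<lambda>s. a *\<^sub>R v s + b *\<^sub>R w s) t = a *\<^sub>R f v t + b *\<^sub>R f w t"
    "(\<And>i. i < t \<Longrightarrow> v i = w i) \<Longrightarrow> f v t = f w t"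
  using assms unfolding strictly_causal_def by blast+

lemma causal_linear_id: "causal_linear (\<lambda>w. w)"
  by (simp add: causal_linear_def)

lemma causal_linear_matrix:
  fixes M :: "real^'a^'b"
  assumes f: "causal_linear f"
  shows "causal_linear (\<lambda>w t. M *v f w t)"
  unfolding causal_linear_def
proof (intro conjI ballI allI impI)
  fix v w :: "int \<Rightarrow> 'c" assume vw: "v \<in> ell2" "w \<in> ell2"
  note D = causal_linearD[OF f vw]
  show "(\<lambda>t. M *v f v t) \<in> ell2" by (rule ell2_matrix[OF D(1)])
  show "M *v f (\<lambda>s. a *\<^sub>R v s + b *\<^sub>R w s) t = a *\<^sub>R (M *v f v t) + b *\<^sub>R (M *v f w t)" for a b t
    by (simp only: D(2) matrix_vector_right_distrib matrix_vector_mult_scaleR)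
  show "M *v f v t = M *v f w t" if "\<forall>i\<le>t. v i = w i" for t
    using D(3) that by metis
qed

lemma causal_linear_add:
  assumes f: "causal_linear f" and g: "causal_linear g"
  shows "causal_linear (\<lambda>w t. f w t + g w t)"
  unfolding causal_linear_def
proof (intro conjI ballI allI impI)
  fix v w :: "int \<Rightarrow> 'a" assume vw: "v \<in> ell2" "w \<in> ell2"
  note D = causal_linearD[OF f vw] and E = causal_linearD[OF g vw]
  show "(\<lambda>t. f v t + g v t) \<in> ell2" by (rule ell2_add[OF D(1) E(1)])
  show "f (\<lambda>s. a *\<^sub>R v s + b *\<^sub>R w s) t + g (\<lambda>s. a *\<^sub>R v s + b *\<^sub>R w s) t =
      a *\<^sub>R (f v t + g v t) + b *\<^sub>R (f w t + g w t)" for a b t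
    by (simp add: D(2) E(2) scaleR_right_distrib)
  show "f v t + g v t = f w t + g w t" if "\<forall>i\<le>t. v i = w i" for t
    using D(3) E(3) that by metis
qed

lemma strictly_causal_matrix:
  fixes M :: "real^'a^'b"
  assumes f: "strictly_causal f"
  shows "strictly_causal (\<lambda>w t. M *v f w t)"
  unfolding strictly_causal_def
proof (intro conjI ballI allI impI)
  fix v w :: "int \<Rightarrow> 'c" assume vw: "v \<in> ell2" "w \<in> ell2"
  note D = strictly_causalD[OF f vw]
  show "M *v f (\<lambda>s. a *\<^sub>R v s + b *\<^sub>R w s) t = a *\<^sub>R (M *v f v t) + b *\<^sub>R (M *v f w t)" for a b t
    by (simp only: D(1) matrix_vector_right_distrib matrix_vector_mult_scaleR)
  show "M *v f v t = M *v f w t" if "\<forall>i<t. v i = w i" for t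
    using D(2) that by metis
qed

lemma strictly_causal_add:
  assumes f: "strictly_causal f" and g: "strictly_causal g"
  shows "strictly_causal (\<lambda>w t. f w t + g w t)"
  unfolding strictly_causal_def
proof (intro conjI ballI allI impI)
  fix v w :: "int \<Rightarrow> 'a" assume vw: "v \<in> ell2" "w \<in> ell2"
  note D = strictly_causalD[OF f vw] and E = strictly_causalD[OF g vw]
  show "f (\<lambda>s. a *\<^sub>R v s + b *\<^sub>R w s) t + g (\<lambda>s. a *\<^sub>R v s + b *\<^sub>R w s) t =
      a *\<^sub>R (f v t + g v t) + b *\<^sub>R (f w t + g w t)" for a b t
    by (simp add: D(1) E(1) scaleR_right_distrib)
  show "f v t + g v t = f w t + g w t" if "\<forall>i<t. v i = w i" for t
    using D(2) E(2) that by metis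
qed

lemma strictly_causal_response:
  fixes A :: "real^'n^'n"
  assumes A: "schur_stable A" and f: "causal_linear f"
  shows "strictly_causal (\<lambda>w. ell2_response A (f w))"
  unfolding strictly_causal_def
proof (intro conjI ballI allI impI)
  note cf = schur_stable_imp_circle_free[OF A]
  fix v w :: "int \<Rightarrow> 'a" assume vw: "v \<in> ell2" "w \<in> ell2"
  note D = causal_linearD[OF f vw] and fw = causal_linearD(1)[OF f vw(2) vw(2)]
  fix t
  show "ell2_response A (f (\<lambda>s. a *\<^sub>R v s + b *\<^sub>R w s)) t =
      a *\<^sub>R ell2_response A (f v) t + b *\<^sub>R ell2_response A (f w) t" for a b
  proof -
    have "f (\<lambda>s. a *\<^sub>R v s + b *\<^sub>R w s) = (\<lambda>t. a *\<^sub>R f v t + b *\<^sub>R f w t)"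
      by (intro ext) (rule D(2))
    then show ?thesis using ell2_response_linear[OF cf D(1) fw, of a b] by simp
  qed
  assume eq: "\<forall>i<t. v i = w i"
  have "f v i = f w i" if "i < t" for i
    using eq that by (intro D(3)) simp
  then show "ell2_response A (f v) t = ell2_response A (f w) t"
    by (rule ell2_response_causal[OF A D(1) fw])
qed

lemma causal_linear_response:
  fixes A :: "real^'n^'n"
  assumes A: "schur_stable A" and f: "causal_linear f"
  shows "causal_linear (\<lambda>w. ell2_response A (f w))"
  unfolding causal_linear_def
proof (intro conjI ballI allI impI)
  fix v w :: "int \<Rightarrow> 'a" assume vw: "v \<in> ell2" "w \<in> ell2"
  note D = strictly_causalD[OF strictly_causal_response[OF A f] vw]
  show "ell2_response A (f v) \<in> ell2"
    by (rule ell2_response(1)[OF schur_stable_imp_circle_free[OF A] causal_linearD(1)[OF f vw(1) vw(1)]])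
  show "ell2_response A (f (\<lambda>s. a *\<^sub>R v s + b *\<^sub>R w s)) t =
    a *\<^sub>R ell2_response A (f v) t + b *\<^sub>R ell2_response A (f w) t" for a b t
    by (rule D(1))
  show "ell2_response A (f v) t = ell2_response A (f w) t" if "\<forall>i\<le>t. v i = w i" for t
    using that by (intro D(2)) simp
qed

lemma strictly_causal_zero:
  assumes f: "strictly_causal f" and w: "w \<in> ell2" and zero: "\<And>i. i < t \<Longrightarrow> w i = 0"
  shows "f w t = 0"
proof -
  have "f w t = f (\<lambda>_. 0) t"
    by (rule strictly_causalD(2)[OF f w ell2_zero]) (rule zero)
  also have "f (\<lambda>_. 0) t = f (\<lambda>s. 0 *\<^sub>R w s + 0 *\<^sub>R w s) t" by simp
  also have "\<dots> = 0 *\<^sub>R f w t + 0 *\<^sub>R f w t"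
    by (rule strictly_causalD(1)[OF f w w])
  finally show ?thesis by simp
qed

section \<open>The competitive ratio\<close>

locale competitive = clairvoyant A Bu Q P Bw T M U
  for A :: "real^'n^'n" and Bu :: "real^'p^'n" and Q P :: "real^'n^'n" and Bw :: "real^'m^'n"
    and T M U :: "real^'n^'n" +
  fixes Pi0 Z1 :: "real^'n^'n"
  assumes Pi0: "solves_Pi A Bu Bw Q P T M U Pi0" and Z1: "solves_Z A Bu P 1 Z1"
begin

definition "B0 = Bu ** Ri ** transpose Bu"

sublocale hankel: nehari AK B0 Pi0 Z1 N RM
proof
  show "schur_stable AK" by (rule AK_stable)
  show "pos_semidef B0"
    unfolding B0_def by (intro pos_semidef_congruence pos_def_matrix_inv_pos_semidef R_pos_def)
  show "pos_def RM" by (rule RM_pos_def)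
  show "Pi0 = transpose AK ** Pi0 ** AK + N ** matrix_inv RM ** transpose N"
    using Pi0 by (simp add: solves_Pi_def N_def matrix_transpose_mul matrix_mul_assoc)
  show "Z1 = AK ** Z1 ** transpose AK + B0"
    using Z1 by (simp add: solves_Z_def B0_def)
qed

lemma B0_vec: "B0 *v x = Bu *v (Ri *v (transpose Bu *v x))"
  by (simp add: B0_def matrix_vector_mul_assoc matrix_mul_assoc)

text \<open>The residual of a controller enters the cost through \<open>R\<close>; expressed by the approximation error \<open>y\<close>
of the anticausal signal, its energy is that of the output form \<open>B0\<close> of the Nehari problem.\<close>

lemma feedback_energy: "(Ri *v (transpose Bu *v y)) \<bullet> (R *v (Ri *v (transpose Bu *v y))) = y \<bullet> (B0 *v y)"
proof -
  have "(Ri *v (transpose Bu *v y)) \<bullet> (R *v (Ri *v (transpose Bu *v y))) =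
      (transpose Bu *v y) \<bullet> (Ri *v (transpose Bu *v y))"
    by (simp add: matrix_inv_vector[OF R_inv] inner_commute)
  also have "\<dots> = y \<bullet> (B0 *v y)" by (simp add: inner_matrix_left B0_vec)
  finally show ?thesis .
qed

text \<open>The clairvoyant cost \<open>E\<close> is finite and positive, which lets the extended real quotient be computed
in the reals.\<close>

lemma competitive_cost_ratio:
  assumes w: "w \<in> ell2" "w \<noteq> (\<lambda>_. 0)" and opt: "optimal_signals w xo uo k \<xi> s"
    and x: "x \<in> ell2" and u: "u \<in> ell2"
    and x1: "\<And>t. x (t + 1) = A *v x t + Bu *v u t + Bw *v w t"
  defines "E \<equiv> \<Sum>\<^sub>\<infinity>t. (w t + KM *v \<xi> t) \<bullet> (RM *v (w t + KM *v \<xi> t))"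
    and "r \<equiv> \<lambda>t. u t + Kl *v x t - Ri *v (transpose Bu *v (U *v \<xi> t - s t))"
  shows "cost Q x u / noncausal_cost A Bu Bw Q w = ennreal (1 + (\<Sum>\<^sub>\<infinity>t. r t \<bullet> (R *v r t)) / E)"
    and "0 < E" and "(\<lambda>t. r t \<bullet> (R *v r t)) summable_on UNIV"
proof -
  note o = optimal_signalsD[OF opt]
  have r: "r \<in> ell2" unfolding r_def by (intro ell2_add ell2_diff ell2_matrix x u o)
  show E: "0 < E" unfolding E_def by (rule innovation_energy_pos[OF w o(4,10)])
  show "(\<lambda>t. r t \<bullet> (R *v r t)) summable_on UNIV" by (intro ell2_inner_summable ell2_matrix r)
  let ?\<rho> = "\<Sum>\<^sub>\<infinity>t. r t \<bullet> (R *v r t)"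
  have \<rho>: "0 \<le> ?\<rho>"
    by (intro infsum_nonneg pos_semidefD(2)[OF pos_def_imp_pos_semidef[OF R_pos_def]])
  have "cost Q x u = ennreal (E + ?\<rho>)"
    using cost_decomposition[OF opt w(1) x u x1] cost_ell2[OF Q_psd x u]
    by (simp add: E_def r_def)
  then have "cost Q x u / noncausal_cost A Bu Bw Q w = ennreal ((E + ?\<rho>) / E)"
    using noncausal_cost_eq[OF opt w(1)] E \<rho> by (simp add: E_def[symmetric] divide_ennreal del: ennreal_plus)
  then show "cost Q x u / noncausal_cost A Bu Bw Q w = ennreal (1 + ?\<rho> / E)"
    using E by (simp add: add_divide_distrib)
qed

lemma innovation_state_of_optimum:
  assumes w: "w \<in> ell2" and opt: "optimal_signals w xo uo k \<xi> s"
    and \<zeta>: "\<zeta> \<in> ell2" "\<And>t. \<zeta> (t + 1) = AT *v \<zeta> t + Bw *v w t"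
  shows "\<xi> = \<zeta>"
  using innovation_state_unique[OF w optimal_signalsD(4,10)[OF opt] \<zeta>] .

text \<open>The disturbance is the one whose innovation attains the Hankel norm. It starts at time 0, so up to
then \<open>u\<close>, \<open>x\<close> and \<open>\<xi>\<close> vanish and the residual is that of \<open>s\<close> alone. If the Hankel norm is zero, any nonzero
disturbance will do, since no cost is below the clairvoyant one.\<close>

theorem competitive_lower_bound:
  assumes K: "strictly_causal K" and X: "state_response A Bu Bw K X"
  shows "ennreal (1 + hankel.lam) \<le> worst_case_ratio A Bu Bw Q K X"
proof -
  have lam: "0 \<le> hankel.lam" by (rule lambda_max_product_nonneg[OF hankel.Z1_psd hankel.Pi_psd])
  have Xs: "strictly_causal X" and
    X1: "\<And>w t. w \<in> ell2 \<Longrightarrow> X w (t + 1) = A *v X w t + Bu *v K w t + Bw *v w t"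
    using X by (auto simp: state_response_def)
  have "\<exists>w\<in>ell2 - {\<lambda>_. 0}. ennreal (1 + hankel.lam) \<le> cost Q (X w) (K w) / noncausal_cost A Bu Bw Q w"
  proof (cases "hankel.lam = 0")
    case True
    define w :: "int \<Rightarrow> real^'m" where "w t = (if t = 0 then 1 else 0)" for t
    have w: "w \<in> ell2" unfolding w_def by (rule ell2_single)
    have "w 0 \<noteq> 0" by (simp add: w_def)
    then have w0: "w \<noteq> (\<lambda>_. 0)" by metis
    obtain xo uo k \<xi> s where opt: "optimal_signals w xo uo k \<xi> s"
      using optimal_signals_exist[OF w] by blast
    have "1 \<le> cost Q (X w) (K w) / noncausal_cost A Bu Bw Q w"
    proof (cases "cost Q (X w) (K w) < \<infinity>")
      case True
      note xu = cost_finite_imp_ell2[OF Q True]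
      note ratio = competitive_cost_ratio[OF w w0 opt xu X1[OF w]]
      have "0 \<le> (\<Sum>\<^sub>\<infinity>t. (K w t + Kl *v X w t - Ri *v (transpose Bu *v (U *v \<xi> t - s t))) \<bullet>
          (R *v (K w t + Kl *v X w t - Ri *v (transpose Bu *v (U *v \<xi> t - s t)))))"
        by (intro infsum_nonneg pos_semidefD(2)[OF pos_def_imp_pos_semidef[OF R_pos_def]])
      then show ?thesis using ratio(2) by (simp add: ratio(1))
    next
      case False
      then have "cost Q (X w) (K w) = top" by (simp add: less_top[symmetric])
      then show ?thesis
        using noncausal_cost_eq[OF opt w] by (simp add: ennreal_top_divide)
    qed
    then show ?thesis using w w0 True by auto
  next
    case False
    then have lam_pos: "0 < hankel.lam" using lam by simp
    obtain e s where e: "e \<in> ell2" and s: "s \<in> ell2" and e_neg: "\<And>t. t < 0 \<Longrightarrow> e t = 0"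
      and s_rec: "\<And>t. s t = transpose AK *v s (t + 1) + N *v e t"
      and past: "(\<lambda>t. if t \<le> 0 then s t \<bullet> (B0 *v s t) else 0) summable_on UNIV"
      and energy: "(\<Sum>\<^sub>\<infinity>t. if t \<le> 0 then s t \<bullet> (B0 *v s t) else 0) =
        hankel.lam * (\<Sum>\<^sub>\<infinity>t. e t \<bullet> (RM *v e t))"
      and "0 < hankel.lam \<Longrightarrow> \<exists>t. e t \<noteq> 0"
      by (rule hankel.hankel_norm_attained) (rule that; assumption?)
    then have nz: "\<exists>t. e t \<noteq> 0" using lam_pos by blast
    obtain w \<xi> where w: "w \<in> ell2" and \<xi>: "\<xi> \<in> ell2" "\<And>t. \<xi> (t + 1) = AT *v \<xi> t + Bw *v w t"
      and we: "\<And>t. w t + KM *v \<xi> t = e t"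
      and \<xi>0: "\<And>t. (\<And>i. i < t \<Longrightarrow> e i = 0) \<Longrightarrow> \<xi> t = 0"
      using innovation_realizable[OF e] by metis
    have \<xi>_neg: "\<xi> t = 0" if "t \<le> 0" for t using \<xi>0 e_neg that by simp
    have w_neg: "w t = 0" if "t < 0" for t using we[of t] \<xi>_neg[of t] e_neg[OF that] that by simp
    have w0: "w \<noteq> (\<lambda>_. 0)"
    proof
      assume "w = (\<lambda>_. 0)"
      then have "\<xi> = (\<lambda>_. 0)"
        using innovation_state_unique[OF w \<xi>, of "\<lambda>_. 0"] by simp
      then show False using nz we \<open>w = (\<lambda>_. 0)\<close> by (metis add.right_neutral matrix_vector_mult_0_right)
    qed
    obtain xo uo k \<xi>' s' where opt': "optimal_signals w xo uo k \<xi>' s'"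
      using optimal_signals_exist[OF w] by blast
    have "\<xi>' = \<xi>" by (rule innovation_state_of_optimum[OF w opt' \<xi>])
    moreover have "s' = s"
    proof (rule backward_solution_unique[OF schur_stable_imp_circle_free[OF AK_stable]])
      show "s' \<in> ell2" "s \<in> ell2" using optimal_signalsD(5)[OF opt'] s by auto
      show "s' t = transpose AK *v s' (t + 1) + N *v e t" for t
        using optimal_signalsD(12)[OF opt', of t] by (simp add: \<open>\<xi>' = \<xi>\<close> we)
    qed (rule s_rec)
    ultimately have opt: "optimal_signals w xo uo k \<xi> s" using opt' by simp
    have "ennreal (1 + hankel.lam) \<le> cost Q (X w) (K w) / noncausal_cost A Bu Bw Q w"
    proof (cases "cost Q (X w) (K w) < \<infinity>")
      case True
      note xu = cost_finite_imp_ell2[OF Q True]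
      define r where "r t = K w t + Kl *v X w t - Ri *v (transpose Bu *v (U *v \<xi> t - s t))" for t
      define E where "E = (\<Sum>\<^sub>\<infinity>t. e t \<bullet> (RM *v e t))"
      note ratio = competitive_cost_ratio[OF w w0 opt xu X1[OF w], unfolded we, folded r_def E_def]
      have "hankel.lam * E \<le> (\<Sum>\<^sub>\<infinity>t. r t \<bullet> (R *v r t))"
        unfolding E_def energy[symmetric]
      proof (rule infsum_mono[OF past ratio(3)])
        fix t
        show "(if t \<le> 0 then s t \<bullet> (B0 *v s t) else 0) \<le> r t \<bullet> (R *v r t)"
        proof (cases "t \<le> 0")
          case True
          then have "K w t = 0" "X w t = 0"
            using strictly_causal_zero[OF K w, of t] strictly_causal_zero[OF Xs w, of t] w_neg by auto
          then have "r t = Ri *v (transpose Bu *v s t)"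
            using \<xi>_neg[OF True] by (simp add: r_def matrix_vector_mult_minus_right)
          then show ?thesis using True by (simp add: feedback_energy)
        next
          case False
          then show ?thesis
            using pos_semidefD(2)[OF pos_def_imp_pos_semidef[OF R_pos_def]] by simp
        qed
      qed
      then have "hankel.lam \<le> (\<Sum>\<^sub>\<infinity>t. r t \<bullet> (R *v r t)) / E"
        using ratio(2) by (simp add: pos_le_divide_eq)
      then show ?thesis by (simp add: ratio(1) ennreal_leI)
    next
      case False
      then have "cost Q (X w) (K w) = top" by (simp add: less_top[symmetric])
      then show ?thesis
        using noncausal_cost_eq[OF opt w] by (simp add: ennreal_top_divide)
    qed
    then show ?thesis using w w0 by auto
  qed
  then show ?thesis
    unfolding worst_case_ratio_def by (meson SUP_upper2)
qed

abbreviation "level_gramian g \<equiv> (1 / g) *\<^sub>R Z1"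
abbreviation "loop_invertible Z \<equiv> invertible (mat 1 - AK ** Z ** transpose AK ** Pi0)"
abbreviation "generated Z \<equiv> generated_by_controller A Bu Bw Q P T M U Pi0 Z"

text \<open>The controller depends on the Gramian only through its gain.\<close>

lemma generated_cong:
  assumes "K_gamma A Bu Bw P U Pi0 Z = K_gamma A Bu Bw P U Pi0 Z'"
  shows "generated Z = generated Z'"
  by (intro ext) (simp add: generated_by_controller_def F_gamma_def assms)

context
  fixes g :: real
  assumes g: "0 < g" "hankel.lam \<le> g" and inv: "loop_invertible (level_gramian g)"
begin

interpretation level: nehari_level AK B0 Pi0 Z1 N RM g
  by unfold_locales (rule g inv)+

lemma level_K: "K_gamma A Bu Bw P U Pi0 (level_gramian g) = level.K"
  unfolding K_gamma_def level.K_def level.Z_def by (simp add: N_def matrix_mul_assoc)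

lemma level_F: "F_gamma A Bu Bw Q P T M U Pi0 (level_gramian g) = level.F"
  unfolding F_gamma_def level.F_def level_K
  by (simp add: N_def matrix_transpose_mul matrix_mul_assoc transpose_diff P_sym)

text \<open>The second controller state is that of the central controller, driven by the innovation, and the
residual \<open>r\<close> is the image of the approximation error \<open>s - Pi0 \<xi>2\<close> of that controller.\<close>

lemma generated_worst_case:
  assumes X: "state_response A Bu Bw K X" and gen: "generated (level_gramian g) K X"
  shows "worst_case_ratio A Bu Bw Q K X \<le> ennreal (1 + g)"
  unfolding worst_case_ratio_def
proof (rule SUP_least)
  fix w :: "int \<Rightarrow> real^'m" assume "w \<in> ell2 - {\<lambda>_. 0}"
  then have w: "w \<in> ell2" "w \<noteq> (\<lambda>_. 0)" by auto
  have x1: "X w (t + 1) = A *v X w t + Bu *v K w t + Bw *v w t" for t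
    using X w by (simp add: state_response_def)
  have gen_w: "X w \<in> ell2 \<and> (\<exists>\<xi>1\<in>ell2. \<exists>\<xi>2\<in>ell2. \<forall>t.
      K w t = - (Kl *v X w t) + (Ri ** transpose Bu) *v (U *v \<xi>1 t - Pi0 *v \<xi>2 t) \<and>
      \<xi>1 (t + 1) = AT *v \<xi>1 t + Bw *v w t \<and>
      \<xi>2 (t + 1) = (level.K ** KM) *v \<xi>1 t + level.F *v \<xi>2 t + level.K *v w t)"
    using bspec[OF gen[unfolded generated_by_controller_def level_K level_F] w(1)] .
  then have x: "X w \<in> ell2" by (rule conjunct1)
  obtain \<xi>1 \<xi>2 where \<xi>1: "\<xi>1 \<in> ell2" and \<xi>2: "\<xi>2 \<in> ell2" and ctrl: "\<forall>t.
      K w t = - (Kl *v X w t) + (Ri ** transpose Bu) *v (U *v \<xi>1 t - Pi0 *v \<xi>2 t) \<and>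
      \<xi>1 (t + 1) = AT *v \<xi>1 t + Bw *v w t \<and>
      \<xi>2 (t + 1) = (level.K ** KM) *v \<xi>1 t + level.F *v \<xi>2 t + level.K *v w t"
    using conjunct2[OF gen_w] by (elim bexE) (rule that)
  have Kw: "K w t = - (Kl *v X w t) + (Ri ** transpose Bu) *v (U *v \<xi>1 t - Pi0 *v \<xi>2 t)"
    and \<xi>1_rec: "\<xi>1 (t + 1) = AT *v \<xi>1 t + Bw *v w t"
    and \<xi>2_rec: "\<xi>2 (t + 1) = (level.K ** KM) *v \<xi>1 t + level.F *v \<xi>2 t + level.K *v w t" for t
    by (rule spec[OF ctrl, of t, THEN conjunct1],
        rule spec[OF ctrl, of t, THEN conjunct2, THEN conjunct1],
        rule spec[OF ctrl, of t, THEN conjunct2, THEN conjunct2])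
  have u: "K w \<in> ell2"
  proof -
    have "(\<lambda>t. - (Kl *v X w t) + (Ri ** transpose Bu) *v (U *v \<xi>1 t - Pi0 *v \<xi>2 t)) \<in> ell2"
      by (intro ell2_add ell2_minus ell2_diff ell2_matrix x \<xi>1 \<xi>2)
    then show ?thesis unfolding Kw[symmetric] .
  qed
  obtain xo uo k \<xi> s where opt: "optimal_signals w xo uo k \<xi> s"
    using optimal_signals_exist[OF w(1)] by blast
  have \<xi>: "\<xi> = \<xi>1" by (rule innovation_state_of_optimum[OF w(1) opt \<xi>1 \<xi>1_rec])
  define e where "e t = w t + KM *v \<xi> t" for t
  define r where "r t = K w t + Kl *v X w t - Ri *v (transpose Bu *v (U *v \<xi> t - s t))" for t
  define E where "E = (\<Sum>\<^sub>\<infinity>t. e t \<bullet> (RM *v e t))"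
  note ratio = competitive_cost_ratio[OF w opt x u x1, folded e_def, folded r_def E_def]
  have "r t = Ri *v (transpose Bu *v (s t - Pi0 *v \<xi>2 t))" for t
    by (simp add: r_def Kw \<xi> matrix_vector_mul_assoc[symmetric] matrix_vector_mult_diff_distrib)
  then have "(\<Sum>\<^sub>\<infinity>t. r t \<bullet> (R *v r t)) =
      (\<Sum>\<^sub>\<infinity>t. (s t - Pi0 *v \<xi>2 t) \<bullet> (B0 *v (s t - Pi0 *v \<xi>2 t)))"
    by (simp add: feedback_energy)
  also have "\<dots> \<le> g * E"
    unfolding E_def
  proof (rule level.central_controller_bound)
    show "e \<in> ell2" unfolding e_def \<xi> by (intro ell2_add ell2_matrix w \<xi>1)
    show "s \<in> ell2" "\<xi>2 \<in> ell2" using optimal_signalsD(5)[OF opt] \<xi>2 by auto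
    show "s t = transpose AK *v s (t + 1) + N *v e t" for t
      unfolding e_def by (rule optimal_signalsD(12)[OF opt])
    show "\<xi>2 (t + 1) = level.F *v \<xi>2 t + level.K *v e t" for t
      by (simp add: \<xi>2_rec e_def \<xi> matrix_vector_right_distrib matrix_vector_mul_assoc)
  qed
  finally have "(\<Sum>\<^sub>\<infinity>t. r t \<bullet> (R *v r t)) / E \<le> g"
    using ratio(2) by (simp add: pos_divide_le_eq)
  then show "cost Q (X w) (K w) / noncausal_cost A Bu Bw Q w \<le> ennreal (1 + g)"
    by (simp add: ratio(1) ennreal_leI)
qed

text \<open>The three state equations are solved in turn; each matrix \<open>AT\<close>, \<open>F\<close>, \<open>AK\<close> is stable, so every
response is strictly causal in the disturbance.\<close>

lemma generated_exists:
  "\<exists>K X. strictly_causal K \<and> state_response A Bu Bw K X \<and> generated (level_gramian g) K X"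
proof -
  note F = level.central_controller_stable
  note cfT = schur_stable_imp_circle_free[OF AT_stable]
  note cfF = schur_stable_imp_circle_free[OF F]
  note cfK = schur_stable_imp_circle_free[OF AK_stable]
  let ?G = "Ri ** transpose Bu"
  define f1 where "f1 w t = Bw *v w t" for w :: "int \<Rightarrow> real^'m" and t
  define x1 where "x1 w = ell2_response AT (f1 w)" for w
  define f2 where "f2 w t = (level.K ** KM) *v x1 w t + level.K *v w t" for w t
  define x2 where "x2 w = ell2_response level.F (f2 w)" for w
  define v where "v w t = (?G ** U) *v x1 w t + (- ?G ** Pi0) *v x2 w t" for w t
  define f3 where "f3 w t = Bu *v v w t + Bw *v w t" for w t
  define X where "X w = ell2_response AK (f3 w)" for w
  define K where "K w t = (- Kl) *v X w t + v w t" for w t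
  have neg: "(- M') *v y = - (M' *v y)" for M' :: "real^'c^'d" and y
    using matrix_vector_mult_diff_rdistrib[of 0 M' y] by simp
  have f1: "causal_linear f1" unfolding f1_def
    by (intro causal_linear_matrix causal_linear_id)
  have x1: "causal_linear x1" "strictly_causal x1" unfolding x1_def
    by (rule causal_linear_response[OF AT_stable f1], rule strictly_causal_response[OF AT_stable f1])
  have f2: "causal_linear f2" unfolding f2_def
    by (intro causal_linear_add causal_linear_matrix causal_linear_id x1)
  have x2: "causal_linear x2" "strictly_causal x2" unfolding x2_def
    by (rule causal_linear_response[OF F f2], rule strictly_causal_response[OF F f2])
  have v: "causal_linear v" "strictly_causal v" unfolding v_def
    by (intro causal_linear_add causal_linear_matrix x1 x2,
        intro strictly_causal_add strictly_causal_matrix x1 x2)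
  have f3: "causal_linear f3" unfolding f3_def
    by (intro causal_linear_add causal_linear_matrix causal_linear_id v)
  have X: "causal_linear X" "strictly_causal X" unfolding X_def
    by (rule causal_linear_response[OF AK_stable f3], rule strictly_causal_response[OF AK_stable f3])
  have K: "strictly_causal K" unfolding K_def
    by (intro strictly_causal_add strictly_causal_matrix X v)
  have ell2: "f1 w \<in> ell2" "x1 w \<in> ell2" "f2 w \<in> ell2" "x2 w \<in> ell2" "f3 w \<in> ell2" "X w \<in> ell2"
    if "w \<in> ell2" for w
    using that by (simp_all add: causal_linearD(1)[OF f1 that that] causal_linearD(1)[OF x1(1) that that]
        causal_linearD(1)[OF f2 that that] causal_linearD(1)[OF x2(1) that that]
        causal_linearD(1)[OF f3 that that] causal_linearD(1)[OF X(1) that that])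
  have X_rec: "X w (t + 1) = A *v X w t + Bu *v K w t + Bw *v w t" if "w \<in> ell2" for w t
  proof -
    have "X w (t + 1) = AK *v X w t + f3 w t"
      unfolding X_def by (rule ell2_response(2)[OF cfK ell2(5)[OF that]])
    then show ?thesis
      by (simp add: f3_def K_def AK_vec neg matrix_vector_right_distrib matrix_vector_mult_minus_right
          matrix_vector_mult_diff_distrib)
  qed
  have "state_response A Bu Bw K X"
    using X(2) X_rec by (simp add: state_response_def)
  moreover have "generated (level_gramian g) K X"
    unfolding generated_by_controller_def level_K level_F
  proof (intro ballI conjI)
    fix w :: "int \<Rightarrow> real^'m" assume w: "w \<in> ell2"
    show "X w \<in> ell2" by (rule ell2(6)[OF w])
    have "K w t = - (Kl *v X w t) + ?G *v (U *v x1 w t - Pi0 *v x2 w t)" for t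
      by (simp add: K_def v_def neg matrix_vector_mult_diff_distrib matrix_vector_mul_assoc[symmetric])
    moreover have "x1 w (t + 1) = AT *v x1 w t + Bw *v w t" for t
      unfolding x1_def using ell2_response(2)[OF cfT ell2(1)[OF w]] by (simp add: f1_def)
    moreover have "x2 w (t + 1) = (level.K ** KM) *v x1 w t + level.F *v x2 w t + level.K *v w t" for t
      unfolding x2_def using ell2_response(2)[OF cfF ell2(3)[OF w], of t]
      by (simp only: f2_def[of w t] ac_simps)
    ultimately show "\<exists>\<xi>1\<in>ell2. \<exists>\<xi>2\<in>ell2. \<forall>t.
        K w t = - (Kl *v X w t) + ?G *v (U *v \<xi>1 t - Pi0 *v \<xi>2 t) \<and>
        \<xi>1 (t + 1) = AT *v \<xi>1 t + Bw *v w t \<and>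
        \<xi>2 (t + 1) = (level.K ** KM) *v \<xi>1 t + level.F *v \<xi>2 t + level.K *v w t"
      using ell2(2,4)[OF w] by blast
  qed
  ultimately show ?thesis using K by blast
qed

end

lemma lam_nonneg: "0 \<le> hankel.lam"
  by (rule lambda_max_product_nonneg[OF hankel.Z1_psd hankel.Pi_psd])

lemma ennreal_le_if_all_above:
  assumes "\<And>g. l < g \<Longrightarrow> x \<le> ennreal (1 + g)" "0 \<le> l"
  shows "x \<le> ennreal (1 + l)"
proof (rule ennreal_le_epsilon)
  fix e :: real assume "0 < e"
  then have "x \<le> ennreal (1 + (l + e))" by (intro assms) simp
  also have "\<dots> = ennreal (1 + l) + ennreal e"
    using \<open>0 < e\<close> assms(2) by (subst ennreal_plus[symmetric]) (simp_all add: add_ac)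
  finally show "x \<le> ennreal (1 + l) + ennreal e" .
qed

text \<open>Every level above the largest eigenvalue has a central controller, and the upper bound is the
limit of these levels.\<close>

theorem competitive_ratio_eq: "competitive_ratio A Bu Bw Q = ennreal (1 + hankel.lam)"
proof (rule antisym)
  show "competitive_ratio A Bu Bw Q \<le> ennreal (1 + hankel.lam)"
  proof (rule ennreal_le_if_all_above[OF _ lam_nonneg])
    fix g assume g: "hankel.lam < g"
    then have g': "0 < g" "hankel.lam \<le> g" using lam_nonneg by auto
    note inv = hankel.level_invertible_above[OF g]
    obtain K X where KX: "strictly_causal K" "state_response A Bu Bw K X" "generated (level_gramian g) K X"
      using generated_exists[OF g' inv] by blast
    have "competitive_ratio A Bu Bw Q \<le> worst_case_ratio A Bu Bw Q K X"
      unfolding competitive_ratio_def using KX by (intro INF_lower2[of K] INF_lower2[of X]) auto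
    also have "\<dots> \<le> ennreal (1 + g)" by (rule generated_worst_case[OF g' inv KX(2,3)])
    finally show "competitive_ratio A Bu Bw Q \<le> ennreal (1 + g)" .
  qed
  show "ennreal (1 + hankel.lam) \<le> competitive_ratio A Bu Bw Q"
    unfolding competitive_ratio_def
    by (intro INF_greatest) (auto intro: competitive_lower_bound)
qed

text \<open>For a positive largest eigenvalue, \<open>Zs\<close> is the Gramian of that level. For the eigenvalue 0 the
equation reads \<open>Zs = AK Zs AK\<^sup>*\<close>, as \<open>1 / 0 = 0\<close>, so \<open>Zs = 0\<close>; the gain vanishes as it does at all other levels, and the bounds
of all positive levels apply to the same controller.\<close>

theorem optimal_controller:
  assumes Zs: "solves_Z A Bu P hankel.lam Zs" and inv: "loop_invertible Zs"
  shows "\<exists>K X. strictly_causal K \<and> state_response A Bu Bw K X \<and> generated Zs K X"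
    and "\<And>K X. strictly_causal K \<Longrightarrow> state_response A Bu Bw K X \<Longrightarrow> generated Zs K X \<Longrightarrow>
      worst_case_ratio A Bu Bw Q K X = ennreal (1 + hankel.lam)"
proof -
  have Zs_eq: "Zs = (1 / hankel.lam) *\<^sub>R Z1"
    by (rule hankel.level_gramian_unique) (use Zs in \<open>simp add: solves_Z_def B0_def\<close>)
  have *: "(\<exists>K X. strictly_causal K \<and> state_response A Bu Bw K X \<and> generated Zs K X) \<and>
    (\<forall>K X. state_response A Bu Bw K X \<and> generated Zs K X \<longrightarrow>
      worst_case_ratio A Bu Bw Q K X \<le> ennreal (1 + hankel.lam))"
  proof (cases "hankel.lam = 0")
    case False
    then have g: "0 < hankel.lam" "hankel.lam \<le> hankel.lam" using lam_nonneg by auto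
    show ?thesis
      using generated_exists[OF g] generated_worst_case[OF g] inv unfolding Zs_eq by blast
  next
    case True
    have gain: "K_gamma A Bu Bw P U Pi0 (c *\<^sub>R Z1) = 0" for c
    proof -
      have "K_gamma A Bu Bw P U Pi0 (c *\<^sub>R Z1) =
          c *\<^sub>R (matrix_inv (mat 1 - AK ** (c *\<^sub>R Z1) ** transpose AK ** Pi0) ** (AK ** Z1 ** N))"
        by (simp add: K_gamma_def N_def matrix_mul_assoc matrix_eq matrix_vector_mul_assoc[symmetric]
            scaleR_matrix_vector_assoc[symmetric] matrix_vector_mult_scaleR)
      then show ?thesis by (simp add: hankel.zero_level_gain[OF True] matrix_eq matrix_vector_mul_assoc[symmetric])
    qed
    have gen: "generated Zs = generated (level_gramian g)" for g
      by (rule generated_cong) (simp only: Zs_eq gain)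
    have "worst_case_ratio A Bu Bw Q K X \<le> ennreal (1 + hankel.lam)"
      if "state_response A Bu Bw K X" "generated Zs K X" for K X
    proof (rule ennreal_le_if_all_above[OF _ lam_nonneg])
      fix g assume "hankel.lam < g"
      then show "worst_case_ratio A Bu Bw Q K X \<le> ennreal (1 + g)"
        using generated_worst_case[of g K X] hankel.level_invertible_above[of g] that lam_nonneg
        by (simp add: gen[of g])
    qed
    moreover have "\<exists>K X. strictly_causal K \<and> state_response A Bu Bw K X \<and> generated Zs K X"
      using generated_exists[of 1] hankel.level_invertible_above[of 1] True by (simp add: gen[of 1])
    ultimately show ?thesis by blast
  qed
  then show "\<exists>K X. strictly_causal K \<and> state_response A Bu Bw K X \<and> generated Zs K X" by blast
  show "worst_case_ratio A Bu Bw Q K X = ennreal (1 + hankel.lam)"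
    if "strictly_causal K" "state_response A Bu Bw K X" "generated Zs K X" for K X
    using that * competitive_lower_bound by (blast intro: antisym)
qed

end

theorem theorem1:
  fixes A :: "real^'n^'n" and Bu :: "real^'p^'n" and Bw :: "real^'m^'n"
    and Q P T M U Pi0 Z\<^sub>1 Zs :: "real^'n^'n"
  assumes "pos_def Q"
    and "stabilizable A Bu"
    and "rank Bw = CARD('m)"
    and "full_rank_on_circle A Bw Q"
    and "stabilizing_P A Bu Q P"
    and "stabilizing_T A Bu Q T"
    and "stabilizing_M A Bw Q T M"
    and "solves_U A Bu Bw Q P T M U"
    and "solves_Pi A Bu Bw Q P T M U Pi0"
    and "solves_Z A Bu P 1 Z\<^sub>1"
    and "solves_Z A Bu P (lambda_max (Z\<^sub>1 ** Pi0)) Zs"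
  shows "competitive_ratio A Bu Bw Q = ennreal (1 + lambda_max (Z\<^sub>1 ** Pi0)) \<and>
    (invertible (mat 1 - A_K A Bu P ** Zs ** transpose (A_K A Bu P) ** Pi0) \<longrightarrow>
      (\<exists>K X. strictly_causal K \<and> state_response A Bu Bw K X \<and>
         generated_by_controller A Bu Bw Q P T M U Pi0 Zs K X) \<and>
      (\<forall>K X. strictly_causal K \<and> state_response A Bu Bw K X \<and>
         generated_by_controller A Bu Bw Q P T M U Pi0 Zs K X \<longrightarrow>
         worst_case_ratio A Bu Bw Q K X = ennreal (1 + lambda_max (Z\<^sub>1 ** Pi0))))"
proof -
  interpret competitive A Bu Q P Bw T M U Pi0 Z\<^sub>1
    by unfold_locales (use assms full_rank_on_circle_imp_circle_free in blast)+
  show ?thesis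
    using competitive_ratio_eq optimal_controller[OF assms(11)] by blast
qed

end
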